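(* Let $n\geq 1$ and $p\geq 2$ be integers and let $q_1,\dots,q_n$ be integers relatively prime to $p$. Let $\Sigma$ and $\rho$ be as in the context. Then the quotient poset $\Sigma/\langle\rho\rangle$ is a crystallization of the generalized lens space $L(p,q_1,\dots,q_n)$; that is, $\Sigma/\langle\rho\rangle$ is a $(2n+1)$-dimensional simplicial cell complex with exactly $2(n+1)$ vertices (namely the orbits $U_0,V_0,\dots,U_n,V_n$), its geometric carrier is homeomorphic to $L(p,q_1,\dots,q_n)$, and its derived subdivision is a combinatorial manifold.
   Context: A simplicial cell complex (simplicial poset) is a poset isomorphic to the face poset (closed cells ordered by inclusion, together with $\emptyset$) of a regular CW-complex in which the boundary of every cell is isomorphic as a poset to the boundary complex of a simplex; its geometric carrier $|K|$ is that CW-complex. A crystallization of a closed PL $d$-manifold $M$ is a simplicial cell complex $K$ with exactly $d+1$ vertices such that $|K|\cong M$ and the induced PL structure is that of $M$ (equivalently, the derived subdivision of $K$ is a combinatorial manifold triangulating $M$). For a group $G$ of automorphisms of a poset $X$, the quotient poset $X/G$ is the set of $G$-orbits of elements, with $[\alpha]\leq[\beta]$ iff $\alpha\leq g\beta$ for some $g\in G$. For $0\leq j\leq n$, $0\leq\ell\leq 2p-1$, let $w_{j,\ell}\in\mathbb{C}^{n+1}$ have $j$-th coordinate $e^{\ell\pi i/p}$ and other coordinates $0$; $W_j=\{w_{j,\ell}\}$, $U_j=\{w_{j,2k}:0\leq k\leq p-1\}$, $V_j=W_j\setminus U_j$. $\Sigma_j$ is the cycle complex on $W_j$ with edges $\{w_{j,\ell},w_{j,\ell+1}\}$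 (indices mod $2p$), and $\Sigma=\Sigma_0*\cdots*\Sigma_n$ is the join (simplices are unions $\alpha_0\cup\cdots\cup\alpha_n$, $\alpha_j\in\Sigma_j$), a $2p(n+1)$-vertex triangulation of $S^{2n+1}$. $\rho$ is the automorphism of $\Sigma$ induced by the vertex map $\rho(v)=e^{2\pi i/p}v$ for $v\in W_0$, $\rho(v)=e^{2\pi iq_j/p}v$ for $v\in W_j$, $j\geq1$. The generalized lens space $L(p,q_1,\dots,q_n)$ is the quotient $S^{2n+1}/\langle h\rangle$, where $S^{2n+1}=\{z\in\mathbb{C}^{n+1}:\sum|z_j|^2=1\}$ and $h(z_0,\dots,z_n)=(e^{2\pi i/p}z_0,e^{2\pi iq_1/p}z_1,\dots,e^{2\pi iq_n/p}z_n)$. *)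

theory Defs
  imports "HOL-Analysis.Analysis"
begin

definition partial_order_on_set :: "'a set \<Rightarrow> ('a \<Rightarrow> 'a \<Rightarrow> bool) \<Rightarrow> bool" where
  "partial_order_on_set P le \<longleftrightarrow>
     (\<forall>x\<in>P. le x x) \<and>
     (\<forall>x\<in>P. \<forall>y\<in>P. le x y \<and> le y x \<longrightarrow> x = y) \<and>
     (\<forall>x\<in>P. \<forall>y\<in>P. \<forall>z\<in>P. le x y \<and> le y z \<longrightarrow> le x z)"

text \<open>A (finite) simplicial cell complex = simplicial poset: a finite poset with a least
  element in which every lower interval is isomorphic to a Boolean lattice (the face
  poset of a simplex, including the empty face).\<close>
definition simplicial_cell_complex :: "'a set \<Rightarrow> ('a \<Rightarrow> 'a \<Rightarrow> bool) \<Rightarrow> bool" where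
  "simplicial_cell_complex P le \<longleftrightarrow>
     finite P \<and> partial_order_on_set P le \<and>
     (\<exists>b\<in>P. \<forall>x\<in>P. le b x) \<and>
     (\<forall>x\<in>P. \<exists>(A::nat set) f. finite A \<and> bij_betw f {y\<in>P. le y x} (Pow A) \<and>
        (\<forall>y\<in>P. \<forall>z\<in>P. le y x \<longrightarrow> le z x \<longrightarrow> (le y z \<longleftrightarrow> f y \<subseteq> f z)))"

text \<open>A cell whose lower interval has \<open>2^(k+1)\<close> elements is a \<open>k\<close>-cell.
  The complex has dimension \<open>d\<close> if all cells have dimension at most \<open>d\<close> and some cell
  has dimension \<open>d\<close>.\<close>
definition sc_dim :: "'a set \<Rightarrow> ('a \<Rightarrow> 'a \<Rightarrow> bool) \<Rightarrow> nat \<Rightarrow> bool" where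
  "sc_dim P le d \<longleftrightarrow>
     (\<forall>x\<in>P. card {y\<in>P. le y x} \<le> 2 ^ (d + 1)) \<and>
     (\<exists>x\<in>P. card {y\<in>P. le y x} = 2 ^ (d + 1))"

definition sc_vertices :: "'a set \<Rightarrow> ('a \<Rightarrow> 'a \<Rightarrow> bool) \<Rightarrow> 'a set" where
  "sc_vertices P le = {x\<in>P. card {y\<in>P. le y x} = 2}"

definition derived :: "'a set \<Rightarrow> ('a \<Rightarrow> 'a \<Rightarrow> bool) \<Rightarrow> 'a set set" where
  "derived P le = {C. finite C \<and> C \<subseteq> {x\<in>P. \<not> (\<forall>y\<in>P. le x y)} \<and>
                      (\<forall>x\<in>C. \<forall>y\<in>C. le x y \<or> le y x)}"

definition orbit_of :: "('v \<Rightarrow> 'v) set \<Rightarrow> 'v set \<Rightarrow> 'v set set" where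
  "orbit_of G \<sigma> = (\<lambda>g. g ` \<sigma>) ` G"

definition quot_carrier :: "'v set set \<Rightarrow> ('v \<Rightarrow> 'v) set \<Rightarrow> 'v set set set" where
  "quot_carrier X G = orbit_of G ` X"

definition quot_le :: "('v \<Rightarrow> 'v) set \<Rightarrow> 'v set set \<Rightarrow> 'v set set \<Rightarrow> bool" where
  "quot_le G A B \<longleftrightarrow> (\<exists>\<alpha>\<in>A. \<exists>\<beta>\<in>B. \<exists>g\<in>G. \<alpha> \<subseteq> g ` \<beta>)"

definition cyclic_gen :: "('a \<Rightarrow> 'a) \<Rightarrow> ('a \<Rightarrow> 'a) set" where
  "cyclic_gen g = range (\<lambda>k. g ^^ k) \<union> range (\<lambda>k. (inv g) ^^ k)"

definition simplicial_complex :: "'v set set \<Rightarrow> bool" where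
  "simplicial_complex K \<longleftrightarrow> finite K \<and> {} \<in> K \<and> (\<forall>\<sigma>\<in>K. finite \<sigma>) \<and>
      (\<forall>\<sigma>\<in>K. \<forall>\<tau>. \<tau> \<subseteq> \<sigma> \<longrightarrow> \<tau> \<in> K)"

definition link :: "'v set set \<Rightarrow> 'v set \<Rightarrow> 'v set set" where
  "link K \<sigma> = {\<tau>\<in>K. \<tau> \<inter> \<sigma> = {} \<and> \<tau> \<union> \<sigma> \<in> K}"

text \<open>Geometric realization inside \<open>'v \<Rightarrow> real\<close> (barycentric coordinates), with the
  product (= Euclidean on finite-support pieces) topology.\<close>
definition realization :: "'v set set \<Rightarrow> ('v \<Rightarrow> real) set" where
  "realization K = {x. (\<forall>v. 0 \<le> x v) \<and> {v. x v \<noteq> 0} \<in> K \<and> sum x {v. x v \<noteq> 0} = 1}"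

definition convex_comb :: "('i \<Rightarrow> real) set \<Rightarrow> (('i \<Rightarrow> real) \<Rightarrow> real) \<Rightarrow> 'i \<Rightarrow> real" where
  "convex_comb A a = (\<lambda>i. \<Sum>x\<in>A. a x * x i)"

definition bary_coeffs :: "('i \<Rightarrow> real) set \<Rightarrow> (('i \<Rightarrow> real) \<Rightarrow> real) \<Rightarrow> bool" where
  "bary_coeffs A a \<longleftrightarrow> (\<forall>x\<in>A. 0 \<le> a x) \<and> sum a A = 1"

definition aff_indep :: "('i \<Rightarrow> real) set \<Rightarrow> bool" where
  "aff_indep A \<longleftrightarrow> finite A \<and>
     (\<forall>a. sum a A = 0 \<and> (\<forall>i. (\<Sum>x\<in>A. a x * x i) = 0) \<longrightarrow> (\<forall>x\<in>A. a x = 0))"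

definition geom_simplex :: "('i \<Rightarrow> real) set \<Rightarrow> ('i \<Rightarrow> real) set" where
  "geom_simplex A = {convex_comb A a | a. bary_coeffs A a}"

definition pl_map :: "('i \<Rightarrow> real) set \<Rightarrow> (('i \<Rightarrow> real) \<Rightarrow> ('j \<Rightarrow> real)) \<Rightarrow> bool" where
  "pl_map X f \<longleftrightarrow> (\<exists>T. finite T \<and> \<Union>(geom_simplex ` T) = X \<and>
      (\<forall>A\<in>T. A \<noteq> {} \<and> aff_indep A \<and>
         (\<forall>a. bary_coeffs A a \<longrightarrow> f (convex_comb A a) = (\<lambda>j. \<Sum>x\<in>A. a x * f x j))))"

definition pl_homeomorphic :: "'v set set \<Rightarrow> 'w set set \<Rightarrow> bool" where
  "pl_homeomorphic K L \<longleftrightarrow>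
     (\<exists>f. homeomorphic_map (top_of_set (realization K)) (top_of_set (realization L)) f \<and>
          pl_map (realization K) f)"

definition simplex_boundary :: "nat \<Rightarrow> nat set set" where
  "simplex_boundary d = {A. A \<subset> {0..d+1}}"

definition pl_sphere :: "nat \<Rightarrow> 'v set set \<Rightarrow> bool" where
  "pl_sphere d K \<longleftrightarrow> simplicial_complex K \<and> pl_homeomorphic K (simplex_boundary d)"

text \<open>Combinatorial \<open>d\<close>-manifold (\<open>d \<ge> 1\<close>): every vertex link is a PL \<open>(d-1)\<close>-sphere.\<close>
definition comb_manifold :: "nat \<Rightarrow> 'v set set \<Rightarrow> bool" where
  "comb_manifold d K \<longleftrightarrow> simplicial_complex K \<and>
     (\<forall>v. {v} \<in> K \<longrightarrow> pl_sphere (d - 1) (link K {v}))"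

text \<open>Points of \<open>\<complex>^(n+1)\<close> are represented as \<open>nat \<Rightarrow> complex\<close> with coordinates beyond \<open>n\<close> zero.\<close>

definition wv :: "nat \<Rightarrow> nat \<Rightarrow> nat \<Rightarrow> (nat \<Rightarrow> complex)" where
  "wv p j l = (\<lambda>i. if i = j then cis (real l * pi / real p) else 0)"

definition Wset :: "nat \<Rightarrow> nat \<Rightarrow> (nat \<Rightarrow> complex) set" where
  "Wset p j = {wv p j l | l. l < 2 * p}"

definition Uset :: "nat \<Rightarrow> nat \<Rightarrow> (nat \<Rightarrow> complex) set" where
  "Uset p j = {wv p j (2 * k) | k. k < p}"

definition Vset :: "nat \<Rightarrow> nat \<Rightarrow> (nat \<Rightarrow> complex) set" where
  "Vset p j = Wset p j - Uset p j"

definition cycle_cx :: "nat \<Rightarrow> nat \<Rightarrow> (nat \<Rightarrow> complex) set set" where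
  "cycle_cx p j = {{}} \<union> {{w} | w. w \<in> Wset p j} \<union>
     {{wv p j l, wv p j ((l + 1) mod (2 * p))} | l. l < 2 * p}"

definition Sigma_cx :: "nat \<Rightarrow> nat \<Rightarrow> (nat \<Rightarrow> complex) set set" where
  "Sigma_cx n p = {(\<Union>j\<in>{0..n}. \<alpha> j) | \<alpha>. \<forall>j\<in>{0..n}. \<alpha> j \<in> cycle_cx p j}"

definition coef :: "(nat \<Rightarrow> int) \<Rightarrow> nat \<Rightarrow> int" where
  "coef q j = (if j = 0 then 1 else q j)"

definition rho_v :: "nat \<Rightarrow> (nat \<Rightarrow> int) \<Rightarrow> (nat \<Rightarrow> complex) \<Rightarrow> (nat \<Rightarrow> complex)" where
  "rho_v p q v = (\<lambda>i. cis (2 * pi * real_of_int (coef q i) / real p) * v i)"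

definition lens_h :: "nat \<Rightarrow> (nat \<Rightarrow> int) \<Rightarrow> (nat \<Rightarrow> complex) \<Rightarrow> (nat \<Rightarrow> complex)" where
  "lens_h p q z = (\<lambda>j. cis (2 * pi * real_of_int (coef q j) / real p) * z j)"

definition odd_sphere :: "nat \<Rightarrow> (nat \<Rightarrow> complex) set" where
  "odd_sphere n = {z. (\<forall>j>n. z j = 0) \<and> (\<Sum>j\<le>n. (cmod (z j))\<^sup>2) = 1}"

definition homeomorphic_orbit_space ::
  "'b topology \<Rightarrow> ('a::topological_space) set \<Rightarrow> ('a \<Rightarrow> 'a) set \<Rightarrow> bool" where
  "homeomorphic_orbit_space X S G \<longleftrightarrow>
     (\<exists>f. quotient_map (top_of_set S) X f \<and>
          (\<forall>z\<in>S. \<forall>w\<in>S. f z = f w \<longleftrightarrow> (\<exists>g\<in>G. w = g z)))"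

end

theory Submission
  imports Defs
begin

text \<open>
  The unnormalised barycentric coordinates of a complex form a fan, and a simplexwise linear
  subdivision map is the same as a linear map restricting to a bijection of fans. In this form
  subdivisions compose, pass to joins and include stellar and barycentric subdivisions.

  The colouring of the vertices of \<open>\<Sigma>\<close> by the classes \<open>U\<^sub>j\<close>, \<open>V\<^sub>j\<close> is injective on simplices and
  invariant under the rotation, so the quotient is a simplicial poset, chains of cells lift to
  chains of simplices uniquely up to the group, and by freeness the vertex links of the derived
  subdivision are those of the barycentric subdivision of \<open>\<Sigma>\<close>. Such a link subdivides the join
  of the boundary of a simplex with polygons and pairs of points. As the join of the boundaries of
  two simplices is a stellar subdivision of the boundary of a simplex, all links are PL spheres.

  The vertices of \<open>\<Sigma>\<close> are points of the complex vector space, and taking linear combinations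
  of them is an equivariant bijection from the fan of \<open>\<Sigma>\<close> onto that space. Normalising it gives the
  homeomorphism with the sphere, which descends to the orbit spaces.
\<close>

text \<open>Fans are preferred to realizations because a join then becomes a product: no mass has to
  be shared between the factors, and the new vertex of a stellar subdivision may be put at the sum
  of the vertices of the starred face. Normalisation comes only when realizations are compared. For
  a subdivision only bijectivity is checked; continuity of the inverse follows from compactness.

  Working up to PL homeomorphism would require composing and inverting PL maps through common
  subdivisions. This is avoided: every comparison runs from the finer complex to the coarser one and
  ends in the boundary of a simplex, so that composing matrices is enough and a PL map appears only
  in the last step.

  Spheres are indexed by dimension plus one, which makes the index additive under joins. For a
  simplex \<alpha> of \<Sigma> the sum of \<open>card \<alpha>\<close> and the index of its link is
  2n + 2, and this one invariant drives the whole manifold proof.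

  Cells of the quotient are not determined by their vertices: all top cells share all 2(n+1) of
  them. Hence everything about the quotient is read off chains of cells, which do lift to
  \<Sigma>.\<close>

abbreviation supp :: "('v \<Rightarrow> real) \<Rightarrow> 'v set" where
  "supp x \<equiv> {v. x v \<noteq> 0}"

section \<open>Fans and linear subdivisions\<close>

definition fan :: "'v set set \<Rightarrow> ('v \<Rightarrow> real) set" where
  "fan K = {x. (\<forall>v. 0 \<le> x v) \<and> supp x \<in> K}"

definition lin :: "'v set \<Rightarrow> ('v \<Rightarrow> 'w \<Rightarrow> real) \<Rightarrow> ('v \<Rightarrow> real) \<Rightarrow> 'w \<Rightarrow> real" where
  "lin V P x = (\<lambda>w. \<Sum>v\<in>V. x v * P v w)"

text \<open>\<open>K\<close> subdivides \<open>L\<close>. No condition on single simplices is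
  imposed: for complexes the images of the vertices lie in the fan of \<open>L\<close> and are
  nonnegative, so nothing cancels and every simplex of \<open>K\<close> lands in the cone of one
  simplex of \<open>L\<close>.\<close>

definition refines :: "'v set set \<Rightarrow> 'w set set \<Rightarrow> bool" where
  "refines K L \<longleftrightarrow> (\<exists>P. bij_betw (lin (\<Union>K) P) (fan K) (fan L))"

definition unit_fun :: "'v \<Rightarrow> 'v \<Rightarrow> real" where
  "unit_fun v = (\<lambda>u. if u = v then 1 else 0)"

lemma simplicial_complexD:
  assumes "simplicial_complex K"
  shows "finite K" "{} \<in> K" "\<And>\<sigma>. \<sigma> \<in> K \<Longrightarrow> finite \<sigma>"
    "\<And>\<sigma> \<tau>. \<sigma> \<in> K \<Longrightarrow> \<tau> \<subseteq> \<sigma> \<Longrightarrow> \<tau> \<in> K" "finite (\<Union>K)"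
  using assms unfolding simplicial_complex_def by auto

lemma simplicial_complexI:
  assumes "finite K" "{} \<in> K" "\<And>\<sigma>. \<sigma> \<in> K \<Longrightarrow> finite \<sigma>"
    "\<And>\<sigma> \<tau>. \<sigma> \<in> K \<Longrightarrow> \<tau> \<subseteq> \<sigma> \<Longrightarrow> \<tau> \<in> K"
  shows "simplicial_complex K"
  using assms unfolding simplicial_complex_def by auto

lemma fanD:
  assumes "x \<in> fan K"
  shows "0 \<le> x v" "supp x \<in> K" "v \<notin> \<Union>K \<Longrightarrow> x v = 0"
  using assms unfolding fan_def by auto

lemma lin_compose:
  assumes "finite V" "finite U"
  shows "lin U R (lin V P x) = lin V (\<lambda>v. lin U R (P v)) x"
proof
  fix w
  have "lin U R (lin V P x) w = (\<Sum>u\<in>U. \<Sum>v\<in>V. x v * P v u * R u w)"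
    by (simp add: lin_def sum_distrib_right)
  also have "\<dots> = (\<Sum>v\<in>V. \<Sum>u\<in>U. x v * P v u * R u w)"
    by (rule sum.swap)
  also have "\<dots> = lin V (\<lambda>v. lin U R (P v)) x w"
    by (simp add: lin_def sum_distrib_left mult.assoc)
  finally show "lin U R (lin V P x) w = lin V (\<lambda>v. lin U R (P v)) x w" .
qed

lemma refines_trans:
  assumes "simplicial_complex K" "simplicial_complex L" "refines K L" "refines L M"
  shows "refines K M"
proof -
  obtain P R where P: "bij_betw (lin (\<Union>K) P) (fan K) (fan L)"
    and R: "bij_betw (lin (\<Union>L) R) (fan L) (fan M)"
    using assms(3,4) unfolding refines_def by auto
  have "lin (\<Union>L) R \<circ> lin (\<Union>K) P = lin (\<Union>K) (\<lambda>v. lin (\<Union>L) R (P v))"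
    by (simp add: fun_eq_iff
        lin_compose[OF simplicial_complexD(5)[OF assms(1)] simplicial_complexD(5)[OF assms(2)]])
  then show ?thesis
    using bij_betw_trans[OF P R] unfolding refines_def by auto
qed

lemma lin_unit_fun:
  assumes "finite V"
  shows "lin V unit_fun x = (\<lambda>w. if w \<in> V then x w else 0)"
  using assms by (auto simp: lin_def unit_fun_def fun_eq_iff if_distrib cong: if_cong)

lemma refines_refl:
  assumes "simplicial_complex K"
  shows "refines K K"
proof -
  have "lin (\<Union>K) unit_fun x = x" if "x \<in> fan K" for x
    using lin_unit_fun[of "\<Union>K" x] simplicial_complexD(5)[OF assms] fanD(3)[OF that]
    by (auto simp: fun_eq_iff)
  then have "bij_betw (lin (\<Union>K) unit_fun) (fan K) (fan K)"
    by (intro bij_betw_byWitness[where f' = id]) auto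
  then show ?thesis unfolding refines_def by blast
qed

lemma refines_isomorphic:
  assumes K: "simplicial_complex K" and f: "inj_on f (\<Union>K)"
  shows "refines K ((`) f ` K)" "refines ((`) f ` K) K"
proof -
  let ?V = "\<Union>K"
  \<comment> \<open>Proved with fresh type variables, because the second claim applies it again to
    the inverse relabelling, which runs between the two types in the opposite direction.\<close>
  have gen: "refines K ((`) f ` K)" if K: "simplicial_complex K" and f: "inj_on f (\<Union>K)"
    for K :: "'c set set" and f :: "'c \<Rightarrow> 'd"
  proof -
    let ?V = "\<Union>K" and ?P = "\<lambda>v. unit_fun (f v)"
    have fin: "finite ?V" using simplicial_complexD(5)[OF K] .
    have on: "lin ?V ?P x (f v) = x v" if "v \<in> ?V" for x v
    proof -
      have "lin ?V ?P x (f v) = (\<Sum>u\<in>?V. if u = v then x u else 0)"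
        unfolding lin_def unit_fun_def
        using f that by (intro sum.cong) (auto simp: inj_on_def)
      then show ?thesis using that fin by simp
    qed
    have off: "lin ?V ?P x w = 0" if "w \<notin> f ` ?V" for x w
      unfolding lin_def unit_fun_def using that by (intro sum.neutral) auto
    have nonneg: "0 \<le> lin ?V ?P x w" if "x \<in> fan K" for x w
      using fanD(1)[OF that] by (auto simp: lin_def unit_fun_def intro!: sum_nonneg)
    let ?g = "\<lambda>y v. if v \<in> ?V then y (f v) else 0"
    have "bij_betw (lin ?V ?P) (fan K) (fan ((`) f ` K))"
    proof (rule bij_betw_byWitness[where f' = ?g])
      show "\<forall>x\<in>fan K. ?g (lin ?V ?P x) = x"
        using on fanD(3) by (fastforce simp: fun_eq_iff)
      show "\<forall>y\<in>fan ((`) f ` K). lin ?V ?P (?g y) = y"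
      proof
        fix y assume y: "y \<in> fan ((`) f ` K)"
        have "lin ?V ?P (?g y) w = y w" for w
        proof (cases "w \<in> f ` ?V")
          case True
          then show ?thesis using on[of _ "?g y"] by auto
        next
          case False
          then show ?thesis using off fanD(3)[OF y, of w] by auto
        qed
        then show "lin ?V ?P (?g y) = y" by auto
      qed
      show "lin ?V ?P ` fan K \<subseteq> fan ((`) f ` K)"
      proof clarify
        fix x assume x: "x \<in> fan K"
        have "supp (lin ?V ?P x) = f ` supp x"
        proof (rule set_eqI)
          fix w
          show "w \<in> supp (lin ?V ?P x) \<longleftrightarrow> w \<in> f ` supp x"
          proof (cases "w \<in> f ` ?V")
            case True
            then obtain v where v: "v \<in> ?V" "w = f v" by auto
            have "w \<in> f ` supp x \<longleftrightarrow> v \<in> supp x"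
              unfolding v(2)
              using inj_on_image_mem_iff[OF f v(1), of "supp x"] Union_upper[OF fanD(2)[OF x]] .
            then show ?thesis using on[OF v(1)] v by auto
          next
            case False
            then show ?thesis using off fanD(2)[OF x] by auto
          qed
        qed
        then show "lin ?V ?P x \<in> fan ((`) f ` K)"
          using nonneg[OF x] fanD(2)[OF x] by (auto simp: fan_def)
      qed
      show "?g ` fan ((`) f ` K) \<subseteq> fan K"
      proof clarify
        fix y assume y: "y \<in> fan ((`) f ` K)"
        then obtain \<sigma> where \<sigma>: "\<sigma> \<in> K" "supp y = f ` \<sigma>"
          by (auto simp: fan_def)
        have "supp (?g y) \<subseteq> \<sigma>"
        proof
          fix v assume v: "v \<in> supp (?g y)"
          then have "f v \<in> f ` \<sigma>" "v \<in> ?V" using \<sigma> by (auto split: if_splits)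
          then show "v \<in> \<sigma>" using f \<sigma>(1) by (auto simp: inj_on_def)
        qed
        then have "supp (?g y) \<in> K" using simplicial_complexD(4)[OF K \<sigma>(1)] by blast
        then show "?g y \<in> fan K" using fanD(1)[OF y] by (auto simp: fan_def)
      qed
    qed
    then show ?thesis unfolding refines_def by blast
  qed
  show "refines K ((`) f ` K)" by (rule gen[OF K f])
  let ?h = "the_inv_into ?V f"
  have "simplicial_complex ((`) f ` K)"
    using K unfolding simplicial_complex_def by (auto simp: subset_image_iff)
  moreover have U: "\<Union>((`) f ` K) = f ` ?V" by auto
  moreover have "inj_on ?h (f ` ?V)" using f by (simp add: inj_on_the_inv_into)
  moreover have "(`) ?h ` (`) f ` K = K"
  proof -
    have "?h ` f ` \<sigma> = \<sigma>" if "\<sigma> \<in> K" for \<sigma>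
    proof -
      have "?h (f v) = v" if "v \<in> \<sigma>" for v
        using the_inv_into_f_f[OF f] that \<open>\<sigma> \<in> K\<close> by blast
      then show ?thesis by (force simp: image_image)
    qed
    then show ?thesis by (force simp: image_image)
  qed
  ultimately show "refines ((`) f ` K) K" using gen[of "(`) f ` K" ?h] by metis
qed

section \<open>Joins\<close>

definition join :: "'v set set \<Rightarrow> 'v set set \<Rightarrow> 'v set set" where
  "join K L = {\<sigma> \<union> \<tau> | \<sigma> \<tau>. \<sigma> \<in> K \<and> \<tau> \<in> L}"

definition restr :: "'v set \<Rightarrow> ('v \<Rightarrow> real) \<Rightarrow> 'v \<Rightarrow> real" where
  "restr V x = (\<lambda>v. if v \<in> V then x v else 0)"

lemma simplicial_complex_join:
  assumes "simplicial_complex K" "simplicial_complex L"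
  shows "simplicial_complex (join K L)"
proof -
  have "join K L = (\<lambda>(\<sigma>, \<tau>). \<sigma> \<union> \<tau>) ` (K \<times> L)" by (auto simp: join_def)
  then have "finite (join K L)" using assms by (simp add: simplicial_complexD)
  moreover have "{} \<in> join K L"
    using assms simplicial_complexD(2) unfolding join_def by fastforce
  moreover have "\<rho> \<in> join K L" if "\<upsilon> \<in> join K L" "\<rho> \<subseteq> \<upsilon>" for \<rho> \<upsilon>
  proof -
    obtain \<sigma> \<tau> where that: "\<sigma> \<in> K" "\<tau> \<in> L" "\<rho> \<subseteq> \<sigma> \<union> \<tau>"
      using \<open>\<upsilon> \<in> join K L\<close> \<open>\<rho> \<subseteq> \<upsilon>\<close> by (auto simp: join_def)
    have "\<rho> = (\<rho> \<inter> \<sigma>) \<union> (\<rho> \<inter> \<tau>)" using that by auto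
    moreover have "\<rho> \<inter> \<sigma> \<in> K" "\<rho> \<inter> \<tau> \<in> L"
      using that assms simplicial_complexD(4) by (metis inf_le2)+
    ultimately show ?thesis unfolding join_def by blast
  qed
  moreover have "finite \<upsilon>" if "\<upsilon> \<in> join K L" for \<upsilon>
    using that assms simplicial_complexD(3) by (auto simp: join_def)
  ultimately show ?thesis
    unfolding simplicial_complex_def[of "join K L"] by blast
qed

lemma Union_join:
  assumes "simplicial_complex K" "simplicial_complex L"
  shows "\<Union>(join K L) = \<Union>K \<union> \<Union>L"
proof
  show "\<Union>(join K L) \<subseteq> \<Union>K \<union> \<Union>L" by (auto simp: join_def)
  have "K \<subseteq> join K L"
    using simplicial_complexD(2)[OF assms(2)] unfolding join_def by (auto intro: exI[of _ "{}"])
  moreover have "L \<subseteq> join K L"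
    using simplicial_complexD(2)[OF assms(1)] unfolding join_def by (auto intro: exI[of _ "{}"])
  ultimately show "\<Union>K \<union> \<Union>L \<subseteq> \<Union>(join K L)" by blast
qed

text \<open>Disjoint vertex sets split every support uniquely, so the fan of a join behaves like a
  product. Realizations lack this property, since there the total mass is shared between the
  factors.\<close>

lemma fan_join:
  assumes "simplicial_complex K" "simplicial_complex L" "\<Union>K \<inter> \<Union>L = {}"
  shows "x \<in> fan (join K L) \<longleftrightarrow>
    supp x \<subseteq> \<Union>K \<union> \<Union>L \<and> restr (\<Union>K) x \<in> fan K \<and> restr (\<Union>L) x \<in> fan L"
proof
  assume x: "x \<in> fan (join K L)"
  then obtain \<sigma> \<tau> where *: "\<sigma> \<in> K" "\<tau> \<in> L" "supp x = \<sigma> \<union> \<tau>"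
    by (auto simp: fan_def join_def)
  have "supp (restr (\<Union>K) x) = \<sigma>" "supp (restr (\<Union>L) x) = \<tau>"
    using * assms(3) by (auto simp: restr_def)
  then show "supp x \<subseteq> \<Union>K \<union> \<Union>L \<and> restr (\<Union>K) x \<in> fan K \<and> restr (\<Union>L) x \<in> fan L"
    using * fanD(1)[OF x] by (auto simp: fan_def restr_def)
next
  assume *: "supp x \<subseteq> \<Union>K \<union> \<Union>L \<and> restr (\<Union>K) x \<in> fan K \<and> restr (\<Union>L) x \<in> fan L"
  have "supp x = supp (restr (\<Union>K) x) \<union> supp (restr (\<Union>L) x)"
    using * by (auto simp: restr_def)
  moreover have "supp (restr (\<Union>K) x) \<in> K" "supp (restr (\<Union>L) x) \<in> L"
    using * fanD(2) by blast+
  ultimately have "supp x \<in> join K L" unfolding join_def by blast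
  moreover have "0 \<le> x v" for v
    using * fanD(1)[of "restr (\<Union>K) x" K v] fanD(1)[of "restr (\<Union>L) x" L v]
    by (cases "x v = 0") (auto simp: restr_def split: if_splits)
  ultimately show "x \<in> fan (join K L)" by (auto simp: fan_def)
qed

text \<open>The block matrix \<open>R\<close> acts on the two factors separately. Their images have
  disjoint supports again, so restricting to the vertices of \<open>L\<close> or \<open>L'\<close>
  recovers each factor.\<close>

lemma refines_join:
  assumes K: "simplicial_complex K" and K': "simplicial_complex K'"
    and L: "simplicial_complex L" and L': "simplicial_complex L'"
    and disj: "\<Union>K \<inter> \<Union>K' = {}" "\<Union>L \<inter> \<Union>L' = {}"
    and ref: "refines K L" "refines K' L'"
  shows "refines (join K K') (join L L')"
proof -
  let ?V = "\<Union>K" and ?V' = "\<Union>K'" and ?U = "\<Union>L" and ?U' = "\<Union>L'"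
  obtain P P' where P: "bij_betw (lin ?V P) (fan K) (fan L)"
    and P': "bij_betw (lin ?V' P') (fan K') (fan L')"
    using ref unfolding refines_def by auto
  define R where "R = (\<lambda>v. if v \<in> ?V then P v else P' v)"
  have fin: "finite ?V" "finite ?V'" using K K' simplicial_complexD(5) by blast+
  have lin_R: "lin (?V \<union> ?V') R x = (\<lambda>w. lin ?V P (restr ?V x) w + lin ?V' P' (restr ?V' x) w)" for x
  proof
    fix w
    have "lin (?V \<union> ?V') R x w = (\<Sum>v\<in>?V. x v * R v w) + (\<Sum>v\<in>?V'. x v * R v w)"
      unfolding lin_def using sum.union_disjoint[OF fin disj(1)] .
    also have "(\<Sum>v\<in>?V. x v * R v w) = lin ?V P (restr ?V x) w"
      by (simp add: lin_def R_def restr_def)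
    also have "(\<Sum>v\<in>?V'. x v * R v w) = lin ?V' P' (restr ?V' x) w"
      unfolding lin_def R_def restr_def using disj(1) by (intro sum.cong) auto
    finally show "lin (?V \<union> ?V') R x w = lin ?V P (restr ?V x) w + lin ?V' P' (restr ?V' x) w" .
  qed
  have J: "x \<in> fan (join K K') \<longleftrightarrow>
      supp x \<subseteq> ?V \<union> ?V' \<and> restr ?V x \<in> fan K \<and> restr ?V' x \<in> fan K'" for x
    by (rule fan_join[OF K K' disj(1)])
  have J': "x \<in> fan (join L L') \<longleftrightarrow>
      supp x \<subseteq> ?U \<union> ?U' \<and> restr ?U x \<in> fan L \<and> restr ?U' x \<in> fan L'" for x
    by (rule fan_join[OF L L' disj(2)])
  have img: "lin ?V P (restr ?V x) \<in> fan L" "lin ?V' P' (restr ?V' x) \<in> fan L'"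
    if "x \<in> fan (join K K')" for x
    using that J bij_betwE[OF P] bij_betwE[OF P'] by blast+
  have res: "restr ?U (lin (?V \<union> ?V') R x) = lin ?V P (restr ?V x)"
    "restr ?U' (lin (?V \<union> ?V') R x) = lin ?V' P' (restr ?V' x)"
    if "x \<in> fan (join K K')" for x
    using fanD(3)[OF img(1)[OF that]] fanD(3)[OF img(2)[OF that]] disj(2)
    by (auto simp: lin_R restr_def fun_eq_iff)
  have "bij_betw (lin (?V \<union> ?V') R) (fan (join K K')) (fan (join L L'))"
    unfolding bij_betw_def
  proof
    show "inj_on (lin (?V \<union> ?V') R) (fan (join K K'))"
    proof (rule inj_onI)
      fix x y assume x: "x \<in> fan (join K K')" and y: "y \<in> fan (join K K')"
        and eq: "lin (?V \<union> ?V') R x = lin (?V \<union> ?V') R y"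
      have "restr ?V x = restr ?V y"
        using res(1)[OF x] res(1)[OF y] eq x y J P by (metis bij_betw_imp_inj_on inj_onD)
      moreover have "restr ?V' x = restr ?V' y"
        using res(2)[OF x] res(2)[OF y] eq x y J P' by (metis bij_betw_imp_inj_on inj_onD)
      ultimately have on: "x v = y v" if "v \<in> ?V \<union> ?V'" for v
        using that unfolding restr_def by (metis UnE)
      have off: "x v = y v" if "v \<notin> ?V \<union> ?V'" for v
        using fanD(3)[OF x, of v] fanD(3)[OF y, of v] that unfolding Union_join[OF K K'] by simp
      show "x = y" using on off by (intro ext) (rule case_split)
    qed
    show "lin (?V \<union> ?V') R ` fan (join K K') = fan (join L L')"
    proof (intro equalityI subsetI)
      fix y assume "y \<in> lin (?V \<union> ?V') R ` fan (join K K')"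
      then obtain x where x: "x \<in> fan (join K K')" "y = lin (?V \<union> ?V') R x" by auto
      have "supp y \<subseteq> ?U \<union> ?U'"
        using fanD(3)[OF img(1)[OF x(1)]] fanD(3)[OF img(2)[OF x(1)]]
        unfolding x(2) lin_R by force
      then show "y \<in> fan (join L L')"
        using J'[of y] res[OF x(1)] img[OF x(1)] x(2) by simp
    next
      fix y assume y: "y \<in> fan (join L L')"
      obtain a where a: "a \<in> fan K" "lin ?V P a = restr ?U y"
        using y J' P by (metis bij_betw_iff_bijections)
      obtain b where b: "b \<in> fan K'" "lin ?V' P' b = restr ?U' y"
        using y J' P' by (metis bij_betw_iff_bijections)
      define x where "x = (\<lambda>v. a v + b v)"
      have xr: "restr ?V x = a" "restr ?V' x = b"
        using fanD(3)[OF a(1)] fanD(3)[OF b(1)] disj(1)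
        by (auto simp: restr_def x_def fun_eq_iff)
      have "supp x \<subseteq> ?V \<union> ?V'"
        using fanD(3)[OF a(1)] fanD(3)[OF b(1)] by (force simp: x_def)
      then have "x \<in> fan (join K K')" using J xr a b by simp
      moreover have yU: "supp y \<subseteq> ?U \<union> ?U'" using y J'[of y] by blast
      have "lin (?V \<union> ?V') R x = y"
      proof
        fix w
        show "lin (?V \<union> ?V') R x w = y w"
          using yU disj(2) unfolding lin_R xr a(2) b(2) unfolding restr_def
          by (cases "y w = 0") auto
      qed
      ultimately show "y \<in> lin (?V \<union> ?V') R ` fan (join K K')" by (metis image_eqI)
    qed
  qed
  then show ?thesis
    unfolding refines_def Union_join[OF K K'] by blast
qed

section \<open>Stellar subdivision\<close>

definition stellar :: "'v set set \<Rightarrow> 'v set \<Rightarrow> 'v \<Rightarrow> 'v set set" where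
  "stellar K \<sigma> b = {\<tau> \<in> K. \<not> \<sigma> \<subseteq> \<tau>} \<union> {insert b \<tau> | \<tau>. \<tau> \<in> K \<and> \<not> \<sigma> \<subseteq> \<tau> \<and> \<tau> \<union> \<sigma> \<in> K}"

lemma refines_stellar:
  assumes K: "simplicial_complex K" and \<sigma>: "\<sigma> \<in> K" "\<sigma> \<noteq> {}" and b: "b \<notin> \<Union>K"
  shows "refines (stellar K \<sigma> b) K"
proof -
  let ?S = "stellar K \<sigma> b"
  define P where "P = (\<lambda>v. if v = b then (\<lambda>w. if w \<in> \<sigma> then 1 else 0) else unit_fun v)"
  have bU: "b \<in> \<Union>?S"
  proof -
    have "insert b {} \<in> ?S"
      unfolding stellar_def using simplicial_complexD(2)[OF K] \<sigma> by auto
    then show ?thesis by blast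
  qed
  have sub: "\<Union>?S \<subseteq> insert b (\<Union>K)" by (auto simp: stellar_def)
  have fin: "finite (\<Union>?S)"
    using finite_subset[OF sub] simplicial_complexD(5)[OF K] by simp
  have fin\<sigma>: "finite \<sigma>" using simplicial_complexD(3)[OF K \<sigma>(1)] .
  have b\<sigma>: "b \<notin> \<sigma>" using b \<sigma>(1) by auto
  have lin_P: "lin (\<Union>?S) P x = (\<lambda>w. (if w = b then 0 else x w) + (if w \<in> \<sigma> then x b else 0))"
    if "x \<in> fan ?S" for x
  proof
    fix w
    have "lin (\<Union>?S) P x w = x b * P b w + (\<Sum>v\<in>\<Union>?S - {b}. x v * P v w)"
      unfolding lin_def using fin bU by (rule sum.remove)
    also have "(\<Sum>v\<in>\<Union>?S - {b}. x v * P v w) = (\<Sum>v\<in>\<Union>?S - {b}. if v = w then x v else 0)"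
      by (intro sum.cong) (auto simp: P_def unit_fun_def)
    also have "\<dots> = (if w \<in> \<Union>?S - {b} then x w else 0)"
      using fin by (simp add: sum.delta)
    also have "\<dots> = (if w = b then 0 else x w)"
      using fanD(3)[OF that, of w] by auto
    finally show "lin (\<Union>?S) P x w = (if w = b then 0 else x w) + (if w \<in> \<sigma> then x b else 0)"
      by (simp add: P_def)
  qed
  \<comment> \<open>In the image of \<open>x\<close> the weight \<open>x b\<close> has been added to
    all coordinates in \<sigma>, one of which was zero before. So it is the minimum over \<sigma>,
    and the inverse moves that minimum back to \<open>b\<close>.\<close>
  define g where "g = (\<lambda>y v. if v = b then Min (y ` \<sigma>) else if v \<in> \<sigma> then y v - Min (y ` \<sigma>) else (y v :: real))"
  have sup: "(\<exists>v\<in>\<sigma>. x v = 0) \<and> supp (lin (\<Union>?S) P x) \<in> K" if x: "x \<in> fan ?S" for x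
  proof (cases "x b = 0")
    case True
    have "supp x \<in> ?S" using fanD(2)[OF x] .
    then have "supp x \<in> K" "\<not> \<sigma> \<subseteq> supp x" using True by (auto simp: stellar_def)
    moreover have "lin (\<Union>?S) P x = x" using True by (auto simp: lin_P[OF x])
    ultimately show ?thesis by auto
  next
    case False
    have "supp x \<in> ?S" using fanD(2)[OF x] .
    moreover have "supp x \<notin> K" using False b by blast
    ultimately obtain \<tau> where \<tau>: "supp x = insert b \<tau>" "\<tau> \<in> K" "\<not> \<sigma> \<subseteq> \<tau>" "\<tau> \<union> \<sigma> \<in> K"
      by (auto simp: stellar_def)
    have pos: "x b > 0" using False fanD(1)[OF x, of b] by simp
    have "supp (lin (\<Union>?S) P x) = \<tau> \<union> \<sigma>"
    proof (rule set_eqI)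
      fix w
      have "w \<in> supp x \<longleftrightarrow> w \<in> insert b \<tau>" using \<tau>(1) by simp
      moreover have "b \<notin> \<tau>" using b \<tau>(2) by auto
      ultimately show "w \<in> supp (lin (\<Union>?S) P x) \<longleftrightarrow> w \<in> \<tau> \<union> \<sigma>"
        using pos fanD(1)[OF x, of w] b\<sigma> by (auto simp: lin_P[OF x])
    qed
    moreover obtain v where "v \<in> \<sigma>" "v \<notin> insert b \<tau>" using \<tau>(3) b\<sigma> by blast
    then have "\<exists>v\<in>\<sigma>. x v = 0" using \<tau>(1) by blast
    ultimately show ?thesis using \<tau>(4) by auto
  qed
  have "bij_betw (lin (\<Union>?S) P) (fan ?S) (fan K)"
  proof (rule bij_betw_byWitness[where f' = g])
    show "\<forall>x\<in>fan ?S. g (lin (\<Union>?S) P x) = x"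
    proof
      fix x assume x: "x \<in> fan ?S"
      obtain v where v: "v \<in> \<sigma>" "x v = 0" using sup[OF x] by auto
      have "Min (lin (\<Union>?S) P x ` \<sigma>) = x b"
      proof (rule Min_eqI)
        show "x b \<in> lin (\<Union>?S) P x ` \<sigma>"
          using v b\<sigma> by (intro image_eqI[of _ _ v]) (auto simp: lin_P[OF x])
      qed (use fin\<sigma> b\<sigma> fanD(1)[OF x] in \<open>auto simp: lin_P[OF x]\<close>)
      then show "g (lin (\<Union>?S) P x) = x"
        using b\<sigma> by (auto simp: g_def lin_P[OF x] fun_eq_iff)
    qed
    show "lin (\<Union>?S) P ` fan ?S \<subseteq> fan K"
    proof clarify
      fix x assume x: "x \<in> fan ?S"
      have "0 \<le> lin (\<Union>?S) P x w" for w
        using fanD(1)[OF x] by (auto simp: lin_P[OF x])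
      then show "lin (\<Union>?S) P x \<in> fan K" using sup[OF x] by (simp add: fan_def)
    qed
    have gS: "g y \<in> fan ?S" if y: "y \<in> fan K" for y
    proof -
      let ?m = "Min (y ` \<sigma>)"
      have m_le: "?m \<le> y v" if "v \<in> \<sigma>" for v using fin\<sigma> that by simp
      have "?m \<in> y ` \<sigma>" using fin\<sigma> \<sigma>(2) by (intro Min_in) auto
      then obtain u where u: "u \<in> \<sigma>" "?m = y u" by auto
      have m0: "0 \<le> ?m" using u fanD(1)[OF y] by simp
      have yb: "y b = 0" using fanD(3)[OF y b] .
      have "supp (g y) \<in> ?S"
      proof (cases "?m = 0")
        case True
        then have "g y = y" using yb by (auto simp: g_def fun_eq_iff)
        moreover have "\<not> \<sigma> \<subseteq> supp y" using u True by auto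
        ultimately show ?thesis using fanD(2)[OF y] by (simp add: stellar_def)
      next
        case False
        \<comment> \<open>Subtracting the minimum kills exactly the vertices of \<sigma> where it is
          attained. There is at least one, so the remaining face does not contain \<sigma>.\<close>
        let ?\<tau> = "supp y - {v \<in> \<sigma>. y v = ?m}"
        have "supp (g y) = insert b ?\<tau>"
        proof (rule set_eqI)
          fix v
          show "v \<in> supp (g y) \<longleftrightarrow> v \<in> insert b ?\<tau>"
            using False b\<sigma> m_le[of v] m0 yb by (auto simp: g_def)
        qed
        moreover have "\<sigma> \<subseteq> supp y" using m_le False m0 by force
        then have "?\<tau> \<union> \<sigma> = supp y" by auto
        moreover have "?\<tau> \<in> K"
          by (rule simplicial_complexD(4)[OF K fanD(2)[OF y]]) auto
        moreover have "\<not> \<sigma> \<subseteq> ?\<tau>" using u by auto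
        ultimately have "supp (g y) = insert b ?\<tau> \<and> ?\<tau> \<in> K \<and> \<not> \<sigma> \<subseteq> ?\<tau> \<and> ?\<tau> \<union> \<sigma> \<in> K"
          using fanD(2)[OF y] by presburger
        then show ?thesis unfolding stellar_def by blast
      qed
      moreover have "0 \<le> g y v" for v
        using m0 m_le fanD(1)[OF y] by (auto simp: g_def)
      ultimately show ?thesis by (simp add: fan_def)
    qed
    then show "g ` fan K \<subseteq> fan ?S" by auto
    show "\<forall>y\<in>fan K. lin (\<Union>?S) P (g y) = y"
    proof
      fix y assume y: "y \<in> fan K"
      show "lin (\<Union>?S) P (g y) = y"
        using b\<sigma> fanD(3)[OF y b] unfolding lin_P[OF gS[OF y]] by (auto simp: g_def fun_eq_iff)
    qed
  qed
  then show ?thesis unfolding refines_def by blast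
qed

section \<open>Barycentric subdivision\<close>

text \<open>The order complex of an arbitrary family of sets, so that it covers barycentric
  subdivisions as well as the intervals below and above a simplex.\<close>

definition chains :: "'v set set \<Rightarrow> 'v set set set" where
  "chains S = {C. finite C \<and> C \<subseteq> S \<and> (\<forall>\<sigma>\<in>C. \<forall>\<tau>\<in>C. \<sigma> \<subseteq> \<tau> \<or> \<tau> \<subseteq> \<sigma>)}"

lemma simplicial_complex_chains:
  assumes "finite S"
  shows "simplicial_complex (chains S)"
proof -
  have "chains S \<subseteq> Pow S" by (auto simp: chains_def)
  then have "finite (chains S)" using assms finite_subset by blast
  moreover have "C' \<in> chains S" if "C \<in> chains S" "C' \<subseteq> C" for C C'
    unfolding chains_def mem_Collect_eq
  proof (intro conjI ballI)
    show "finite C'" "C' \<subseteq> S"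
      using that finite_subset[OF that(2)] by (auto simp: chains_def)
    show "\<sigma> \<subseteq> \<tau> \<or> \<tau> \<subseteq> \<sigma>" if "\<sigma> \<in> C'" "\<tau> \<in> C'" for \<sigma> \<tau>
      using that \<open>C \<in> chains S\<close> \<open>C' \<subseteq> C\<close> unfolding chains_def mem_Collect_eq by (meson subsetD)
  qed
  moreover have "{} \<in> chains S" "\<And>C. C \<in> chains S \<Longrightarrow> finite C"
    by (auto simp: chains_def)
  ultimately show ?thesis by (intro simplicial_complexI)
qed

lemma Union_chains: "\<Union>(chains S) = S"
proof
  have "{\<sigma>} \<in> chains S" if "\<sigma> \<in> S" for \<sigma> using that by (auto simp: chains_def)
  then show "S \<subseteq> \<Union>(chains S)" by blast
qed (auto simp: chains_def)

lemma chain_has_top: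
  assumes "finite C" "C \<noteq> {}" "\<forall>\<sigma>\<in>C. \<forall>\<tau>\<in>C. \<sigma> \<subseteq> \<tau> \<or> \<tau> \<subseteq> \<sigma>"
  shows "\<exists>\<beta>\<in>C. \<forall>\<sigma>\<in>C. \<sigma> \<subseteq> \<beta>"
  using assms
proof (induction C rule: finite_ne_induct)
  case (insert \<sigma> C)
  then obtain \<beta> where \<beta>: "\<beta> \<in> C" "\<forall>\<tau>\<in>C. \<tau> \<subseteq> \<beta>" by auto
  then have "\<sigma> \<subseteq> \<beta> \<or> \<beta> \<subseteq> \<sigma>" using insert.prems by auto
  then show ?case
  proof
    assume "\<sigma> \<subseteq> \<beta>"
    then show ?thesis using \<beta> by auto
  next
    assume "\<beta> \<subseteq> \<sigma>"
    then show ?thesis using \<beta> by (intro bexI[of _ \<sigma>]) auto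
  qed
qed auto

lemma lin_fun_upd:
  assumes "finite V" "b \<in> V"
  shows "lin V P (x(b := t)) w = lin V P x w + (t - x b) * P b w"
proof -
  have "lin V P (x(b := t)) w = t * P b w + (\<Sum>v\<in>V - {b}. x v * P v w)"
    unfolding lin_def using sum.remove[OF assms, of "\<lambda>v. (x(b := t)) v * P v w"] by simp
  moreover have "lin V P x w = x b * P b w + (\<Sum>v\<in>V - {b}. x v * P v w)"
    unfolding lin_def by (rule sum.remove[OF assms])
  ultimately show ?thesis by (simp add: algebra_simps)
qed

text \<open>\<open>lin S indicat_real\<close> sends each simplex to the sum of its vertices, so the
  value at \<open>v\<close> is the total weight of the members of the chain containing
  \<open>v\<close>. Vertices lying only in the top simplex see nothing but its weight. Hence support
  and minimum of the image reveal the top simplex and its coefficient.\<close>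

lemma chain_fan_top:
  assumes S: "finite S" "{} \<notin> S" and c: "c \<in> fan (chains S)" and ne: "supp c \<noteq> {}"
  obtains \<beta> where "\<beta> \<in> S" "c \<beta> > 0" "\<forall>\<sigma>\<in>supp c. \<sigma> \<subseteq> \<beta>"
    "supp (lin S indicat_real c) = \<beta>"
    "\<forall>v\<in>\<beta>. c \<beta> \<le> lin S indicat_real c v"
    "\<exists>v\<in>\<beta>. lin S indicat_real c v = c \<beta>"
proof -
  have D: "finite (supp c)" "supp c \<subseteq> S" "\<forall>\<sigma>\<in>supp c. \<forall>\<tau>\<in>supp c. \<sigma> \<subseteq> \<tau> \<or> \<tau> \<subseteq> \<sigma>"
    using fanD(2)[OF c] unfolding chains_def by auto
  obtain \<beta> where \<beta>: "\<beta> \<in> supp c" "\<forall>\<sigma>\<in>supp c. \<sigma> \<subseteq> \<beta>"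
    using chain_has_top[OF D(1) ne D(3)] by auto
  have pos: "c \<beta> > 0" using \<beta>(1) fanD(1)[OF c, of \<beta>] by auto
  have S\<beta>: "\<beta> \<in> S" using \<beta>(1) D(2) by auto
  have rem: "lin S indicat_real c v = c \<beta> * indicat_real \<beta> v + (\<Sum>\<sigma>\<in>S - {\<beta>}. c \<sigma> * indicat_real \<sigma> v)" for v
    unfolding lin_def by (rule sum.remove[OF S(1) S\<beta>])
  have rest: "0 \<le> (\<Sum>\<sigma>\<in>S - {\<beta>}. c \<sigma> * indicat_real \<sigma> v)" for v
    using fanD(1)[OF c] by (intro sum_nonneg) (simp add: indicator_def)
  have ge: "c \<beta> \<le> lin S indicat_real c v" if "v \<in> \<beta>" for v
    using rem[of v] rest[of v] that by simp
  have zero: "lin S indicat_real c v = 0" if "v \<notin> \<beta>" for v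
    unfolding lin_def
  proof (rule sum.neutral, rule ballI)
    fix \<sigma>
    have "\<sigma> \<subseteq> \<beta> \<or> c \<sigma> = 0" using \<beta>(2) by auto
    then show "c \<sigma> * indicat_real \<sigma> v = 0" using that by (auto simp: indicator_def)
  qed
  have sup: "supp (lin S indicat_real c) = \<beta>"
  proof (rule set_eqI)
    fix v show "v \<in> supp (lin S indicat_real c) \<longleftrightarrow> v \<in> \<beta>"
      using ge[of v] zero[of v] pos by (cases "v \<in> \<beta>") auto
  qed
  \<comment> \<open>A vertex of \<beta> outside the next largest member of the chain; if there is
    none, any vertex of \<beta> works, since the empty set is excluded from
    \<open>S\<close>.\<close>
  have "\<exists>v\<in>\<beta>. \<forall>\<sigma>\<in>supp c - {\<beta>}. v \<notin> \<sigma>"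
  proof (cases "supp c - {\<beta>} = {}")
    case True
    then show ?thesis using S(2) S\<beta> by (metis all_not_in_conv)
  next
    case False
    then obtain \<gamma> where \<gamma>: "\<gamma> \<in> supp c - {\<beta>}" "\<forall>\<sigma>\<in>supp c - {\<beta>}. \<sigma> \<subseteq> \<gamma>"
      using chain_has_top[of "supp c - {\<beta>}"] D(1,3) by (meson DiffD1 finite_Diff)
    then have "\<gamma> \<subset> \<beta>" using \<beta> by blast
    then show ?thesis using \<gamma>(2) by blast
  qed
  then obtain v where v: "v \<in> \<beta>" "\<forall>\<sigma>\<in>supp c - {\<beta>}. v \<notin> \<sigma>" by auto
  have "(\<Sum>\<sigma>\<in>S - {\<beta>}. c \<sigma> * indicat_real \<sigma> v) = 0"
    using v(2) by (intro sum.neutral) (auto simp: indicator_def)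
  then have "lin S indicat_real c v = c \<beta>" using rem[of v] v(1) by simp
  then show thesis using that[OF S\<beta> pos \<beta>(2) sup] ge v(1) by blast
qed

lemma bij_betw_barycentric:
  assumes K: "simplicial_complex K"
  defines "S \<equiv> K - {{}}"
  shows "bij_betw (lin S indicat_real) (fan (chains S)) (fan K)"
proof -
  \<comment> \<open>On the fan of a chain the value at the top simplex is the minimum of the image over its support;
    injectivity and surjectivity follow by splitting off the top simplex.\<close>
  let ?F = "lin S indicat_real"
  have S: "finite S" "{} \<notin> S" using simplicial_complexD(1)[OF K] by (auto simp: S_def)
  note top = chain_fan_top[OF S]
  have zero: "?F c = (\<lambda>v. 0)" if "supp c = {}" for c
    using that by (auto simp: lin_def fun_eq_iff)
  have into: "?F c \<in> fan K" if c: "c \<in> fan (chains S)" for c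
  proof -
    have "0 \<le> ?F c v" for v
      unfolding lin_def using fanD(1)[OF c] by (intro sum_nonneg) (simp add: indicator_def)
    moreover have "supp (?F c) \<in> K"
    proof (cases "supp c = {}")
      case True
      then show ?thesis using zero simplicial_complexD(2)[OF K] by simp
    next
      case False
      from top[OF c this] show ?thesis unfolding S_def by (metis DiffD1)
    qed
    ultimately show ?thesis by (simp add: fan_def)
  qed
  have inj: "c = c'" if "c \<in> fan (chains S)" "c' \<in> fan (chains S)" "?F c = ?F c'" for c c'
    using that
  proof (induction "card (supp c)" arbitrary: c c' rule: less_induct)
    case less
    have sup_iff: "supp (?F c) = {} \<longleftrightarrow> supp c = {}" if "c \<in> fan (chains S)" for c
    proof (cases "supp c = {}")
      case True
      then show ?thesis using zero by simp
    next
      case False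
      from top[OF that this] show ?thesis using S(2) False by metis
    qed
    show ?case
    proof (cases "supp c = {}")
      case True
      then have "supp c' = {}" using sup_iff less.prems by metis
      then show ?thesis using True by (auto simp: fun_eq_iff)
    next
      case False
      then have False': "supp c' \<noteq> {}" using sup_iff less.prems by metis
      obtain \<beta> where \<beta>: "\<beta> \<in> S" "c \<beta> > 0" "\<forall>\<sigma>\<in>supp c. \<sigma> \<subseteq> \<beta>" "supp (?F c) = \<beta>"
        "\<forall>v\<in>\<beta>. c \<beta> \<le> ?F c v" "\<exists>v\<in>\<beta>. ?F c v = c \<beta>"
        by (rule top[OF less.prems(1) False]) (rule that)
      obtain \<gamma> where \<gamma>: "\<gamma> \<in> S" "c' \<gamma> > 0" "\<forall>\<sigma>\<in>supp c'. \<sigma> \<subseteq> \<gamma>" "supp (?F c') = \<gamma>"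
        "\<forall>v\<in>\<gamma>. c' \<gamma> \<le> ?F c' v" "\<exists>v\<in>\<gamma>. ?F c' v = c' \<gamma>"
        by (rule top[OF less.prems(2) False']) (rule that)
      have eq: "\<gamma> = \<beta>" using \<beta>(4) \<gamma>(4) less.prems(3) by simp
      obtain v where v: "v \<in> \<beta>" "?F c v = c \<beta>" using \<beta>(6) by blast
      obtain u where u: "u \<in> \<beta>" "?F c' u = c' \<beta>" using \<gamma>(6) eq by blast
      \<comment> \<open>Both coefficients are attained lower bounds over \<beta> of one and the same
        function, so each bounds the other.\<close>
      have ceq: "c \<beta> = c' \<beta>"
        using bspec[OF \<beta>(5) u(1)] bspec[OF \<gamma>(5), of v] v u eq less.prems(3) by simp
      let ?d = "c(\<beta> := 0)" and ?d' = "c'(\<beta> := 0)"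
      have fand: "d(\<beta> := 0) \<in> fan (chains S)" if "d \<in> fan (chains S)" for d
      proof -
        have "supp (d(\<beta> := 0)) \<subseteq> supp d" by auto
        then have "supp (d(\<beta> := 0)) \<in> chains S"
          using simplicial_complexD(4)[OF simplicial_complex_chains[OF S(1)] fanD(2)[OF that]] by blast
        then show ?thesis using fanD(1)[OF that] by (auto simp: fan_def)
      qed
      have "?F ?d = ?F ?d'"
        using less.prems(3) ceq by (auto simp: fun_eq_iff lin_fun_upd[OF S(1) \<beta>(1)])
      moreover have "card (supp ?d) < card (supp c)"
      proof (rule psubset_card_mono)
        show "finite (supp c)" using fanD(2)[OF less.prems(1)] by (simp add: chains_def)
        have "supp ?d = supp c - {\<beta>}" "\<beta> \<in> supp c" using \<beta>(2) by (auto simp del: fun_upd_apply simp: fun_upd_def)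
        then show "supp ?d \<subset> supp c" by blast
      qed
      ultimately have "?d = ?d'"
        using less.hyps[OF _ fand[OF less.prems(1)] fand[OF less.prems(2)]] by simp
      then show ?thesis using ceq by (metis fun_upd_triv fun_upd_upd)
    qed
  qed
  have surj: "\<exists>c\<in>fan (chains S). ?F c = x" if "x \<in> fan K" for x
    using that
  proof (induction "card (supp x)" arbitrary: x rule: less_induct)
    case less
    show ?case
    proof (cases "supp x = {}")
      case True
      have "(\<lambda>\<sigma>. 0) \<in> fan (chains S)" by (auto simp: fan_def chains_def)
      moreover have "?F (\<lambda>\<sigma>. 0) = x" using True by (auto simp: lin_def fun_eq_iff)
      ultimately show ?thesis by blast
    next
      case False
      let ?\<sigma> = "supp x"
      let ?m = "Min (x ` ?\<sigma>)"
      have \<sigma>: "?\<sigma> \<in> K" "finite ?\<sigma>" using fanD(2)[OF less.prems] simplicial_complexD(3)[OF K] by blast+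
      have m_le: "?m \<le> x v" if "v \<in> ?\<sigma>" for v using \<sigma>(2) that by simp
      have "?m \<in> x ` ?\<sigma>" using \<sigma>(2) False by (intro Min_in) auto
      then obtain u where u: "u \<in> ?\<sigma>" "?m = x u" by auto
      have m0: "?m > 0" using u fanD(1)[OF less.prems, of u] by auto
      define y where "y = (\<lambda>v. if v \<in> ?\<sigma> then x v - ?m else 0)"
      have "u \<notin> supp y" using u by (simp add: y_def)
      moreover have "supp y \<subseteq> ?\<sigma>" unfolding y_def by auto
      ultimately have suby: "supp y \<subset> ?\<sigma>" using u(1) by blast
      have "y \<in> fan K"
        using m_le simplicial_complexD(4)[OF K \<sigma>(1), of "supp y"] suby
        by (auto simp: fan_def y_def)
      then obtain c where c: "c \<in> fan (chains S)" "?F c = y"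
        using less.hyps[of y] psubset_card_mono[OF \<sigma>(2) suby] by blast
      \<comment> \<open>The chain obtained for \<open>y\<close> lives inside \<open>supp y\<close>,
        a proper subset of \<open>supp x\<close>. So \<open>supp x\<close> can be put on top of it,
        and its old coefficient there is zero.\<close>
      have sub: "\<tau> \<subseteq> supp y" if "c \<tau> \<noteq> 0" for \<tau>
      proof -
        have "supp c \<noteq> {}" using that by auto
        then obtain \<gamma> where "\<forall>\<sigma>\<in>supp c. \<sigma> \<subseteq> \<gamma>" "supp (?F c) = \<gamma>"
          by (rule top[OF c(1)])
        then show ?thesis using that c(2) by simp
      qed
      have \<sigma>S: "?\<sigma> \<in> S" using \<sigma>(1) False by (simp add: S_def)
      have c\<sigma>: "c ?\<sigma> = 0" using sub[of ?\<sigma>] suby by blast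
      let ?c = "c(?\<sigma> := ?m)"
      have "supp ?c = insert ?\<sigma> (supp c)" using m0 by auto
      moreover have "insert ?\<sigma> (supp c) \<in> chains S"
        using fanD(2)[OF c(1)] sub suby \<sigma>S unfolding chains_def by blast
      ultimately have "?c \<in> fan (chains S)" using fanD(1)[OF c(1)] m0 by (auto simp: fan_def)
      moreover have "?F ?c = x"
      proof
        fix v
        show "?F ?c v = x v"
          unfolding lin_fun_upd[OF S(1) \<sigma>S] c(2) c\<sigma> y_def by (auto simp: indicator_def)
      qed
      ultimately show ?thesis by blast
    qed
  qed
  show ?thesis
    unfolding bij_betw_def
  proof
    show "inj_on ?F (fan (chains S))" using inj by (auto intro: inj_onI)
    show "?F ` fan (chains S) = fan K" using into surj by blast
  qed
qed

lemma refines_barycentric: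
  assumes "simplicial_complex K"
  shows "refines (chains (K - {{}})) K"
  unfolding refines_def Union_chains using bij_betw_barycentric[OF assms] by blast

section \<open>Spheres\<close>

definition bdry :: "'v set \<Rightarrow> 'v set set" where
  "bdry A = {\<tau>. \<tau> \<subset> A}"

text \<open>The index is one more than the dimension: \<open>{..d}\<close> spans a simplex of
  dimension d, whose boundary is a sphere of dimension d - 1. Index 0 describes the complex
  \<open>{{}}\<close>, the unit for joins, and indices of joins add up.\<close>

definition linear_sphere :: "nat \<Rightarrow> 'v set set \<Rightarrow> bool" where
  "linear_sphere d K \<longleftrightarrow> simplicial_complex K \<and> refines K (bdry {..d})"

lemma simplicial_complex_bdry:
  assumes "finite A" "A \<noteq> {}"
  shows "simplicial_complex (bdry A)"
proof -
  have "bdry A \<subseteq> Pow A" by (auto simp: bdry_def)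
  then have "finite (bdry A)" using assms finite_subset by blast
  then show ?thesis
    using assms unfolding simplicial_complex_def by (auto simp: bdry_def intro: finite_subset)
qed

lemma Union_bdry: "\<Union>(bdry A) \<subseteq> A"
  by (auto simp: bdry_def)

lemma image_bdry:
  assumes "inj_on f A"
  shows "(`) f ` bdry A = bdry (f ` A)"
proof
  show "(`) f ` bdry A \<subseteq> bdry (f ` A)"
    using inj_on_image_eq_iff[OF assms] by (auto simp: bdry_def)
  show "bdry (f ` A) \<subseteq> (`) f ` bdry A"
  proof
    fix \<tau> assume "\<tau> \<in> bdry (f ` A)"
    then have "\<tau> \<subseteq> f ` A" "\<tau> \<noteq> f ` A" by (auto simp: bdry_def)
    then obtain \<sigma> where "\<sigma> \<subseteq> A" "\<tau> = f ` \<sigma>" by (meson subset_imageE)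
    then show "\<tau> \<in> (`) f ` bdry A"
      using \<open>\<tau> \<noteq> f ` A\<close> by (intro image_eqI[of _ _ \<sigma>]) (auto simp: bdry_def)
  qed
qed

lemma refines_bdry:
  assumes "finite A" "finite B" "card A = card B" "A \<noteq> {}"
  shows "refines (bdry A) (bdry B)"
proof -
  obtain f where f: "bij_betw f A B" using assms finite_same_card_bij by blast
  have "inj_on f (\<Union>(bdry A))"
    using f Union_bdry[of A] by (metis bij_betw_imp_inj_on inj_on_subset)
  then have "refines (bdry A) ((`) f ` bdry A)"
    by (rule refines_isomorphic(1)[OF simplicial_complex_bdry[OF assms(1,4)]])
  then show ?thesis using f image_bdry[of f A] by (simp add: bij_betw_def)
qed

lemma linear_sphereI:
  assumes "simplicial_complex K" "refines K (bdry A)" "finite A" "card A = d + 1"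
  shows "linear_sphere d K"
proof -
  have "A \<noteq> {}" using assms(4) by auto
  moreover have "refines (bdry A) (bdry {..d})"
    using assms(3,4) \<open>A \<noteq> {}\<close> by (intro refines_bdry) auto
  ultimately show ?thesis
    using refines_trans[OF assms(1) simplicial_complex_bdry[OF assms(3)] assms(2)] assms(1)
    unfolding linear_sphere_def by simp
qed

lemma linear_sphereD:
  assumes "linear_sphere d K" "finite A" "card A = d + 1"
  shows "refines K (bdry A)"
proof -
  have "refines (bdry {..d}) (bdry A)" using assms by (intro refines_bdry) auto
  moreover have "simplicial_complex (bdry {..d})" by (intro simplicial_complex_bdry) auto
  ultimately show ?thesis
    using assms(1) unfolding linear_sphere_def by (blast intro: refines_trans)
qed

lemma linear_sphere_bdry:
  assumes "finite A" "card A = d + 1"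
  shows "linear_sphere d (bdry A)"
proof -
  have "A \<noteq> {}" using assms(2) by auto
  then show ?thesis
    using assms linear_sphereI refines_refl simplicial_complex_bdry by metis
qed

lemma linear_sphere_refines:
  assumes "simplicial_complex K" "refines K L" "linear_sphere d L"
  shows "linear_sphere d K"
  using assms refines_trans[OF assms(1) _ assms(2)] unfolding linear_sphere_def by blast

lemma simplicial_complex_image:
  assumes "simplicial_complex K"
  shows "simplicial_complex ((`) f ` K)"
  using assms unfolding simplicial_complex_def by (auto simp: subset_image_iff)

lemma linear_sphere_image:
  assumes "linear_sphere d K" "inj_on f (\<Union>K)"
  shows "linear_sphere d ((`) f ` K)"
proof (rule linear_sphere_refines[OF _ _ assms(1)])
  have K: "simplicial_complex K" using assms(1) by (simp add: linear_sphere_def)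
  show "simplicial_complex ((`) f ` K)" by (rule simplicial_complex_image[OF K])
  show "refines ((`) f ` K) K" by (rule refines_isomorphic(2)[OF K assms(2)])
qed

section \<open>Joins of boundaries of simplices\<close>

lemma join_bdry_iff:
  assumes "A \<inter> B = {}"
  shows "\<rho> \<in> join (bdry A) (bdry B) \<longleftrightarrow> \<rho> \<subseteq> A \<union> B \<and> \<not> A \<subseteq> \<rho> \<and> \<not> B \<subseteq> \<rho>"
proof
  assume "\<rho> \<in> join (bdry A) (bdry B)"
  then show "\<rho> \<subseteq> A \<union> B \<and> \<not> A \<subseteq> \<rho> \<and> \<not> B \<subseteq> \<rho>"
    using assms by (auto simp: join_def bdry_def)
next
  assume "\<rho> \<subseteq> A \<union> B \<and> \<not> A \<subseteq> \<rho> \<and> \<not> B \<subseteq> \<rho>"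
  then have "\<rho> = (\<rho> \<inter> A) \<union> (\<rho> \<inter> B)" "\<rho> \<inter> A \<subset> A" "\<rho> \<inter> B \<subset> B" by auto
  then show "\<rho> \<in> join (bdry A) (bdry B)" unfolding join_def bdry_def by blast
qed

text \<open>A simplex of the starred complex without \<open>b\<close> only has to avoid containing
  \<open>A\<close>. One with \<open>b\<close> must in addition stay a proper face after adding
  \<open>A\<close>, that is, miss a vertex of \<open>B - {b}\<close>. Together these say that
  neither \<open>A\<close> nor \<open>B\<close> is contained.\<close>

lemma stellar_bdry:
  assumes "A \<inter> B = {}" "b \<in> B" "B \<noteq> {b}"
  shows "stellar (bdry (A \<union> (B - {b}))) A b = join (bdry A) (bdry B)"
proof (rule set_eqI)
  fix \<rho>
  let ?L = "bdry (A \<union> (B - {b}))"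
  show "\<rho> \<in> stellar ?L A b \<longleftrightarrow> \<rho> \<in> join (bdry A) (bdry B)"
  proof (cases "b \<in> \<rho>")
    case False
    then have "\<rho> \<in> stellar ?L A b \<longleftrightarrow> \<rho> \<subset> A \<union> (B - {b}) \<and> \<not> A \<subseteq> \<rho>"
      by (auto simp: stellar_def bdry_def)
    then show ?thesis using False assms unfolding join_bdry_iff[OF assms(1)] by blast
  next
    case True
    let ?\<tau> = "\<rho> - {b}"
    have "\<rho> \<in> stellar ?L A b \<longleftrightarrow> (\<exists>\<tau>. \<rho> = insert b \<tau> \<and> \<tau> \<in> ?L \<and> \<not> A \<subseteq> \<tau> \<and> \<tau> \<union> A \<in> ?L)"
      using True assms by (auto simp: stellar_def bdry_def)
    also have "\<dots> \<longleftrightarrow> ?\<tau> \<in> ?L \<and> \<not> A \<subseteq> ?\<tau> \<and> ?\<tau> \<union> A \<in> ?L"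
    proof
      assume "\<exists>\<tau>. \<rho> = insert b \<tau> \<and> \<tau> \<in> ?L \<and> \<not> A \<subseteq> \<tau> \<and> \<tau> \<union> A \<in> ?L"
      then obtain \<tau> where \<tau>: "\<rho> = insert b \<tau>" "\<tau> \<in> ?L" "\<not> A \<subseteq> \<tau>" "\<tau> \<union> A \<in> ?L" by auto
      then have "b \<notin> \<tau>" using assms by (auto simp: bdry_def)
      then have "?\<tau> = \<tau>" using \<tau>(1) by auto
      then show "?\<tau> \<in> ?L \<and> \<not> A \<subseteq> ?\<tau> \<and> ?\<tau> \<union> A \<in> ?L" using \<tau> by simp
    next
      assume "?\<tau> \<in> ?L \<and> \<not> A \<subseteq> ?\<tau> \<and> ?\<tau> \<union> A \<in> ?L"
      then show "\<exists>\<tau>. \<rho> = insert b \<tau> \<and> \<tau> \<in> ?L \<and> \<not> A \<subseteq> \<tau> \<and> \<tau> \<union> A \<in> ?L"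
        using True by (intro exI[of _ ?\<tau>]) auto
    qed
    also have "\<dots> \<longleftrightarrow> \<rho> \<subseteq> A \<union> B \<and> \<not> A \<subseteq> \<rho> \<and> \<not> B \<subseteq> \<rho>"
      using True assms by (auto simp: bdry_def)
    finally show ?thesis unfolding join_bdry_iff[OF assms(1)] .
  qed
qed

lemma refines_join_bdry:
  assumes "finite A" "finite B" "A \<inter> B = {}" "A \<noteq> {}" "b \<in> B"
  shows "refines (join (bdry A) (bdry B)) (bdry (A \<union> (B - {b})))"
\<comment> \<open>For \<open>B = {b}\<close> the set \<open>A\<close> is not a face of
  \<open>bdry A\<close> and cannot be starred, but then the join is \<open>bdry A\<close>
  itself.\<close>
proof (cases "B = {b}")
  case True
  then have "bdry B = {{}}" by (auto simp: bdry_def)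
  then have "join (bdry A) (bdry B) = bdry A" by (auto simp: join_def)
  moreover have "A \<union> (B - {b}) = A" using True by auto
  ultimately show ?thesis
    using refines_refl[OF simplicial_complex_bdry[OF assms(1,4)]] by simp
next
  case False
  have "A \<in> bdry (A \<union> (B - {b}))" using False assms by (auto simp: bdry_def)
  moreover have "b \<notin> \<Union>(bdry (A \<union> (B - {b})))" using assms by (auto simp: bdry_def)
  moreover have "simplicial_complex (bdry (A \<union> (B - {b})))"
    using assms by (intro simplicial_complex_bdry) auto
  ultimately show ?thesis
    using refines_stellar assms(4) stellar_bdry[OF assms(3,5) False] by metis
qed

lemma linear_sphere_join:
  assumes K: "linear_sphere d K" and L: "linear_sphere e L" and disj: "\<Union>K \<inter> \<Union>L = {}"
  shows "linear_sphere (d + e) (join K L)"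
proof -
  \<comment> \<open>Disjoint copies of the two model simplices. The vertex \<open>d+1\<close> serves
    as starring vertex and drops out, which leaves d + e + 1 vertices.\<close>
  let ?A = "{..d}" and ?B = "{d+1..d+1+e}"
  have sc: "simplicial_complex K" "simplicial_complex L"
    using K L by (auto simp: linear_sphere_def)
  have scb: "simplicial_complex (bdry ?A)" "simplicial_complex (bdry ?B)"
    by (intro simplicial_complex_bdry; auto)+
  have "\<Union>(bdry ?A) \<inter> \<Union>(bdry ?B) = {}"
    using Union_bdry[of ?A] Union_bdry[of ?B] by fastforce
  moreover have "refines K (bdry ?A)" "refines L (bdry ?B)"
    using linear_sphereD[OF K, of ?A] linear_sphereD[OF L, of ?B] by simp_all
  ultimately have "refines (join K L) (join (bdry ?A) (bdry ?B))"
    using sc scb disj by (intro refines_join)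
  moreover have "refines (join (bdry ?A) (bdry ?B)) (bdry (?A \<union> (?B - {d+1})))"
    by (intro refines_join_bdry) auto
  ultimately have "refines (join K L) (bdry (?A \<union> (?B - {d+1})))"
    by (rule refines_trans[OF simplicial_complex_join[OF sc] simplicial_complex_join[OF scb]])
  moreover have "?A \<union> (?B - {d+1}) = {..d+1+e} - {d+1}" by auto
  ultimately show ?thesis
    using simplicial_complex_join[OF sc] by (intro linear_sphereI[of _ "?A \<union> (?B - {d+1})"]) auto
qed

section \<open>Links in the barycentric subdivision\<close>

lemma simplicial_complex_link:
  assumes "simplicial_complex K" "\<sigma> \<in> K"
  shows "simplicial_complex (link K \<sigma>)"
proof -
  have "link K \<sigma> \<subseteq> K" by (auto simp: link_def)
  then have "finite (link K \<sigma>)" using simplicial_complexD(1)[OF assms(1)] finite_subset by blast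
  moreover have "{} \<in> link K \<sigma>" using assms simplicial_complexD(2) by (auto simp: link_def)
  moreover have "\<rho> \<in> link K \<sigma>" if "\<tau> \<in> link K \<sigma>" "\<rho> \<subseteq> \<tau>" for \<rho> \<tau>
  proof -
    have "\<rho> \<union> \<sigma> \<subseteq> \<tau> \<union> \<sigma>" using that by auto
    then show ?thesis
      using that simplicial_complexD(4)[OF assms(1)] unfolding link_def by blast
  qed
  moreover have "finite \<tau>" if "\<tau> \<in> link K \<sigma>" for \<tau>
    using that simplicial_complexD(3)[OF assms(1)] by (auto simp: link_def)
  ultimately show ?thesis by (intro simplicial_complexI)
qed

lemma chains_image:
  assumes "\<And>\<sigma> \<tau>. \<sigma> \<in> S \<Longrightarrow> \<tau> \<in> S \<Longrightarrow> f \<sigma> \<subseteq> f \<tau> \<longleftrightarrow> \<sigma> \<subseteq> \<tau>"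
  shows "chains (f ` S) = (`) f ` chains S"
proof
  show "(`) f ` chains S \<subseteq> chains (f ` S)"
  proof
    fix C assume "C \<in> (`) f ` chains S"
    then obtain D where D: "C = f ` D" "finite D" "D \<subseteq> S"
      and ch: "\<And>\<sigma> \<tau>. \<sigma> \<in> D \<Longrightarrow> \<tau> \<in> D \<Longrightarrow> \<sigma> \<subseteq> \<tau> \<or> \<tau> \<subseteq> \<sigma>"
      by (auto simp: chains_def)
    have "f \<sigma> \<subseteq> f \<tau> \<or> f \<tau> \<subseteq> f \<sigma>" if "\<sigma> \<in> D" "\<tau> \<in> D" for \<sigma> \<tau>
      using ch[OF that] assms[of \<sigma> \<tau>] assms[of \<tau> \<sigma>] that D(3) by auto
    then show "C \<in> chains (f ` S)" using D unfolding chains_def by auto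
  qed
  show "chains (f ` S) \<subseteq> (`) f ` chains S"
  proof
    fix C assume C: "C \<in> chains (f ` S)"
    then obtain D where D: "D \<subseteq> S" "C = f ` D" by (auto simp: chains_def subset_image_iff)
    have "inj_on f S" using assms by (auto intro!: inj_onI)
    then have "finite D" using C D by (auto simp: chains_def dest: finite_imageD inj_on_subset)
    moreover have "\<sigma> \<subseteq> \<tau> \<or> \<tau> \<subseteq> \<sigma>" if "\<sigma> \<in> D" "\<tau> \<in> D" for \<sigma> \<tau>
    proof -
      have "f \<sigma> \<subseteq> f \<tau> \<or> f \<tau> \<subseteq> f \<sigma>" using C D that unfolding chains_def by blast
      then show ?thesis using assms[of \<sigma> \<tau>] assms[of \<tau> \<sigma>] D that by auto
    qed
    ultimately show "C \<in> (`) f ` chains S" using D unfolding chains_def by blast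
  qed
qed

text \<open>Whatever is comparable with \<alpha> and distinct from it lies strictly below or
  strictly above, and anything below is contained in anything above. So the two parts of a chain can
  be chosen independently.\<close>

lemma link_chains:
  assumes "\<alpha> \<in> S"
  shows "link (chains S) {\<alpha>} = join (chains {\<beta>\<in>S. \<beta> \<subset> \<alpha>}) (chains {\<beta>\<in>S. \<alpha> \<subset> \<beta>})"
proof
  show "link (chains S) {\<alpha>} \<subseteq> join (chains {\<beta>\<in>S. \<beta> \<subset> \<alpha>}) (chains {\<beta>\<in>S. \<alpha> \<subset> \<beta>})"
  proof
    fix C assume C: "C \<in> link (chains S) {\<alpha>}"
    then have "insert \<alpha> C \<in> chains S" by (simp add: link_def)
    then have c4: "\<forall>\<sigma>\<in>insert \<alpha> C. \<forall>\<tau>\<in>insert \<alpha> C. \<sigma> \<subseteq> \<tau> \<or> \<tau> \<subseteq> \<sigma>"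
      unfolding chains_def mem_Collect_eq by (elim conjE)
    have c3: "finite C" "C \<subseteq> S" "\<alpha> \<notin> C"
      using C by (auto simp: link_def chains_def)
    note c = c3 c4
    have "C = {\<beta>\<in>C. \<beta> \<subset> \<alpha>} \<union> {\<beta>\<in>C. \<alpha> \<subset> \<beta>}" using c(3,4) by blast
    moreover have "{\<beta>\<in>C. \<beta> \<subset> \<alpha>} \<in> chains {\<beta>\<in>S. \<beta> \<subset> \<alpha>}" "{\<beta>\<in>C. \<alpha> \<subset> \<beta>} \<in> chains {\<beta>\<in>S. \<alpha> \<subset> \<beta>}"
      using c unfolding chains_def by auto
    ultimately show "C \<in> join (chains {\<beta>\<in>S. \<beta> \<subset> \<alpha>}) (chains {\<beta>\<in>S. \<alpha> \<subset> \<beta>})"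
      unfolding join_def by blast
  qed
  show "join (chains {\<beta>\<in>S. \<beta> \<subset> \<alpha>}) (chains {\<beta>\<in>S. \<alpha> \<subset> \<beta>}) \<subseteq> link (chains S) {\<alpha>}"
  proof
    fix E assume "E \<in> join (chains {\<beta>\<in>S. \<beta> \<subset> \<alpha>}) (chains {\<beta>\<in>S. \<alpha> \<subset> \<beta>})"
    then obtain C D where CD: "E = C \<union> D" "finite C" "C \<subseteq> {\<beta>\<in>S. \<beta> \<subset> \<alpha>}" "finite D" "D \<subseteq> {\<beta>\<in>S. \<alpha> \<subset> \<beta>}"
      "\<forall>\<sigma>\<in>C. \<forall>\<tau>\<in>C. \<sigma> \<subseteq> \<tau> \<or> \<tau> \<subseteq> \<sigma>" "\<forall>\<sigma>\<in>D. \<forall>\<tau>\<in>D. \<sigma> \<subseteq> \<tau> \<or> \<tau> \<subseteq> \<sigma>"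
      unfolding join_def chains_def by auto
    have comp: "\<forall>\<sigma>\<in>insert \<alpha> E. \<forall>\<tau>\<in>insert \<alpha> E. \<sigma> \<subseteq> \<tau> \<or> \<tau> \<subseteq> \<sigma>"
    proof (intro ballI)
      fix \<sigma> \<tau> assume "\<sigma> \<in> insert \<alpha> E" "\<tau> \<in> insert \<alpha> E"
      then have "\<sigma> \<in> C \<or> \<sigma> = \<alpha> \<or> \<sigma> \<in> D" "\<tau> \<in> C \<or> \<tau> = \<alpha> \<or> \<tau> \<in> D"
        using CD(1) by auto
      moreover have "\<beta> \<subset> \<alpha>" if "\<beta> \<in> C" for \<beta> using that CD(3) by auto
      moreover have "\<alpha> \<subset> \<beta>" if "\<beta> \<in> D" for \<beta> using that CD(5) by auto
      ultimately show "\<sigma> \<subseteq> \<tau> \<or> \<tau> \<subseteq> \<sigma>"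
        using CD(6,7) by (smt (verit) psubset_imp_subset subset_trans order_refl)
    qed
    have "\<alpha> \<notin> E" using CD(1,3,5) by auto
    moreover have "insert \<alpha> E \<in> chains S" "E \<in> chains S"
      using comp CD(1-5) assms unfolding chains_def by auto
    ultimately show "E \<in> link (chains S) {\<alpha>}" by (auto simp: link_def)
  qed
qed

text \<open>The part below \<alpha> is the barycentric subdivision of \<open>bdry \<alpha>\<close>,
  of index \<open>card \<alpha> - 1\<close>. The part above is that of the link of \<alpha>,
  embedded by adding \<alpha> to each simplex. The link is their join, so the indices add.\<close>

lemma linear_sphere_link_barycentric:
  assumes K: "simplicial_complex K" and \<alpha>: "\<alpha> \<in> K" "\<alpha> \<noteq> {}" and e: "linear_sphere e (link K \<alpha>)"
  shows "linear_sphere (card \<alpha> - 1 + e) (link (chains (K - {{}})) {\<alpha>})"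
proof -
  let ?S = "K - {{}}"
  have fin: "finite \<alpha>" "finite ?S" using \<alpha> K simplicial_complexD by blast+
  have "{\<beta>\<in>?S. \<beta> \<subset> \<alpha>} = bdry \<alpha> - {{}}"
    using simplicial_complexD(4)[OF K \<alpha>(1)] by (auto simp: bdry_def)
  moreover have "linear_sphere (card \<alpha> - 1) (chains (bdry \<alpha> - {{}}))"
  proof (rule linear_sphere_refines)
    show "refines (chains (bdry \<alpha> - {{}})) (bdry \<alpha>)"
      using refines_barycentric simplicial_complex_bdry fin \<alpha>(2) by blast
    show "linear_sphere (card \<alpha> - 1) (bdry \<alpha>)"
      using fin \<alpha>(2) by (intro linear_sphere_bdry) (auto simp: card_gt_0_iff Suc_leI)
    show "simplicial_complex (chains (bdry \<alpha> - {{}}))"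
      using simplicial_complexD(1)[OF simplicial_complex_bdry[OF fin(1) \<alpha>(2)]]
      by (intro simplicial_complex_chains) auto
  qed
  ultimately have 1: "linear_sphere (card \<alpha> - 1) (chains {\<beta>\<in>?S. \<beta> \<subset> \<alpha>})" by simp
  let ?L = "link K \<alpha>" and ?f = "\<lambda>\<tau>. \<tau> \<union> \<alpha>"
  have L: "simplicial_complex ?L" using simplicial_complex_link[OF K \<alpha>(1)] .
  have emb: "?f \<sigma> \<subseteq> ?f \<tau> \<longleftrightarrow> \<sigma> \<subseteq> \<tau>" if "\<sigma> \<in> ?L - {{}}" "\<tau> \<in> ?L - {{}}" for \<sigma> \<tau>
    using that by (auto simp: link_def)
  have "{\<beta>\<in>?S. \<alpha> \<subset> \<beta>} = ?f ` (?L - {{}})"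
  proof
    show "?f ` (?L - {{}}) \<subseteq> {\<beta>\<in>?S. \<alpha> \<subset> \<beta>}" by (auto simp: link_def)
    show "{\<beta>\<in>?S. \<alpha> \<subset> \<beta>} \<subseteq> ?f ` (?L - {{}})"
    proof
      fix \<beta> assume \<beta>: "\<beta> \<in> {\<beta>\<in>?S. \<alpha> \<subset> \<beta>}"
      then have "\<beta> = ?f (\<beta> - \<alpha>)" "\<beta> - \<alpha> \<noteq> {}" "\<beta> - \<alpha> \<union> \<alpha> \<in> K" by (auto simp: Un_absorb2)
      moreover have "\<beta> - \<alpha> \<in> K" using \<beta> simplicial_complexD(4)[OF K] by blast
      ultimately show "\<beta> \<in> ?f ` (?L - {{}})" by (intro image_eqI[of _ _ "\<beta> - \<alpha>"]) (auto simp: link_def)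
    qed
  qed
  then have "chains {\<beta>\<in>?S. \<alpha> \<subset> \<beta>} = (`) ?f ` chains (?L - {{}})"
    using chains_image[of "?L - {{}}" ?f] emb by simp
  moreover have "linear_sphere e (chains (?L - {{}}))"
    using refines_barycentric[OF L] e simplicial_complexD(1)[OF L]
    by (intro linear_sphere_refines[OF simplicial_complex_chains]) auto
  moreover have "inj_on ?f (?L - {{}})" using emb by (intro inj_onI) blast
  ultimately have 2: "linear_sphere e (chains {\<beta>\<in>?S. \<alpha> \<subset> \<beta>})"
    using linear_sphere_image Union_chains by metis
  have "\<Union>(chains {\<beta>\<in>?S. \<beta> \<subset> \<alpha>}) \<inter> \<Union>(chains {\<beta>\<in>?S. \<alpha> \<subset> \<beta>}) = {}"
    unfolding Union_chains by auto
  then show ?thesis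
    using linear_sphere_join[OF 1 2] link_chains[of \<alpha> ?S] \<alpha> by simp
qed

section \<open>Polygons\<close>

definition polygon :: "nat \<Rightarrow> nat set set" where
  "polygon m = {{}} \<union> {{i} | i. i < m} \<union> {{i, (i + 1) mod m} | i. i < m}"

text \<open>Isolating the closing edge removes the modular arithmetic from all others; it is also
  the edge that is subdivided when a vertex is added.\<close>

lemma polygon_alt:
  assumes "m \<ge> 1"
  shows "polygon m = {{}} \<union> {{i} | i. i < m} \<union> {{i, Suc i} | i. Suc i < m} \<union> {{m - 1, 0}}"
proof -
  have "{{i, (i + 1) mod m} | i. i < m} = {{i, Suc i} | i. Suc i < m} \<union> {{m - 1, 0}}" (is "?A = ?B \<union> _")
  proof
    show "?A \<subseteq> ?B \<union> {{m - 1, 0}}"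
    proof clarify
      fix i assume "i < m" "{i, (i + 1) mod m} \<noteq> {m - 1, 0}"
      then have "Suc i < m" by (cases "Suc i = m") auto
      then show "\<exists>i'. {i, (i + 1) mod m} = {i', Suc i'} \<and> Suc i' < m" by (intro exI[of _ i]) auto
    qed
    have "{i, Suc i} \<in> ?A" if "Suc i < m" for i using that by (auto intro!: exI[of _ i])
    moreover have "{m - 1, 0} \<in> ?A" using assms by (auto intro!: exI[of _ "m - 1"])
    ultimately show "?B \<union> {{m - 1, 0}} \<subseteq> ?A"
      by (intro Un_least subsetI) (elim CollectE exE conjE, simp, simp)
  qed
  then show ?thesis unfolding polygon_def by auto
qed

text \<open>The new vertex \<open>m\<close> is inserted in the closing edge. The bound on
  \<open>m\<close> is essential: for m = 2 the closing edge coincides with the edge from 0 to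
  1.\<close>

lemma polygon_Suc:
  assumes "m \<ge> 3"
  shows "polygon (Suc m) = stellar (polygon m) {m - 1, 0} m"
proof -
  have P: "polygon m = {{}} \<union> {{i} | i. i < m} \<union> {{i, Suc i} | i. Suc i < m} \<union> {{m - 1, 0}}"
    using polygon_alt assms by simp
  have P': "polygon (Suc m) = {{}} \<union> {{i} | i. i < Suc m} \<union> {{i, Suc i} | i. i < m} \<union> {{m, 0}}"
    using polygon_alt[of "Suc m"] by simp
  have old: "{\<tau> \<in> polygon m. \<not> {m - 1, 0} \<subseteq> \<tau>} = {{}} \<union> {{i} | i. i < m} \<union> {{i, Suc i} | i. Suc i < m}"
    unfolding P using assms by auto
  \<comment> \<open>The closing edge is a maximal simplex, so only its own proper faces are coned
    off.\<close>
  have "\<tau> \<subseteq> {m - 1, 0}" if "\<tau> \<union> {m - 1, 0} \<in> polygon m" for \<tau>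
  proof -
    have "\<tau> \<union> {m - 1, 0} = {m - 1, 0}"
    proof (rule ccontr)
      assume "\<tau> \<union> {m - 1, 0} \<noteq> {m - 1, 0}"
      then have "\<tau> \<union> {m - 1, 0} \<in> {{}} \<union> {{i} | i. i < m} \<union> {{i, Suc i} | i. Suc i < m}"
        using that[unfolded P] by (meson UnE singletonD)
      then have "\<tau> \<union> {m - 1, 0} \<in> {\<tau> \<in> polygon m. \<not> {m - 1, 0} \<subseteq> \<tau>}"
        by (simp only: old)
      then show False by simp
    qed
    then show ?thesis by blast
  qed
  then have "{\<tau>. \<tau> \<in> polygon m \<and> \<not> {m - 1, 0} \<subseteq> \<tau> \<and> \<tau> \<union> {m - 1, 0} \<in> polygon m} = {{}, {m - 1}, {0}}"
    (is "?T = _")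
  proof (intro equalityI subsetI)
    fix \<tau> assume "\<tau> \<in> {{}, {m - 1}, {0}}"
    then show "\<tau> \<in> ?T"
      unfolding P using assms by auto
  next
    fix \<tau> assume "\<tau> \<in> ?T"
    then have "\<tau> \<subseteq> {m - 1, 0}" "\<not> {m - 1, 0} \<subseteq> \<tau>"
      using \<open>\<And>\<tau>. \<tau> \<union> {m - 1, 0} \<in> polygon m \<Longrightarrow> \<tau> \<subseteq> {m - 1, 0}\<close> by blast+
    then show "\<tau> \<in> {{}, {m - 1}, {0}}" by blast
  qed
  then have new: "{insert m \<tau> | \<tau>. \<tau> \<in> polygon m \<and> \<not> {m - 1, 0} \<subseteq> \<tau> \<and> \<tau> \<union> {m - 1, 0} \<in> polygon m}
      = {{m}, {m, m - 1}, {m, 0}}"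
    by (auto simp: setcompr_eq_image)
  have singles: "{{i} | i. i < Suc m} = {{i} | i. i < m} \<union> {{m}}" by (auto simp: less_Suc_eq)
  have "i = m - 1 \<or> Suc i < m" if "i < m" for i using that by linarith
  moreover have "Suc (m - 1) = m" using assms by simp
  ultimately have edges: "{{i, Suc i} | i. i < m} = {{i, Suc i} | i. Suc i < m} \<union> {{m, m - 1}}"
    using assms by (auto 4 4 simp: insert_commute intro: exI[of _ "m - 1"])
  show ?thesis unfolding stellar_def old new P' singles edges by blast
qed

lemma simplicial_complex_polygon: "simplicial_complex (polygon m)"
proof -
  have "polygon m = {{}} \<union> (\<lambda>i. {i}) ` {..<m} \<union> (\<lambda>i. {i, (i + 1) mod m}) ` {..<m}"
    by (auto simp: polygon_def)
  then have "finite (polygon m)" by simp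
  moreover have "\<tau> \<in> polygon m" if "\<sigma> \<in> polygon m" "\<tau> \<subseteq> \<sigma>" for \<sigma> \<tau>
  proof -
    have sub: "\<tau> = {} \<or> \<tau> = {a} \<or> \<tau> = {b} \<or> \<tau> = \<sigma>" if "\<sigma> = {a, b}" for a b
      using \<open>\<tau> \<subseteq> \<sigma>\<close> that by blast
    have "\<sigma> = {} \<or> (\<exists>i<m. \<sigma> = {i, i}) \<or> (\<exists>i<m. \<sigma> = {i, (i + 1) mod m})"
      using \<open>\<sigma> \<in> polygon m\<close> unfolding polygon_def by auto
    moreover have "{i} \<in> polygon m" if "i < m" for i using that by (auto simp: polygon_def)
    moreover have "{} \<in> polygon m" by (auto simp: polygon_def)
    moreover have "(i + 1) mod m < m" if "i < m" for i using that by simp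
    ultimately show ?thesis
      using sub that by (metis subset_empty)
  qed
  moreover have "\<forall>\<sigma>\<in>polygon m. finite \<sigma>" by (auto simp: polygon_def)
  moreover have "{} \<in> polygon m" by (auto simp: polygon_def)
  ultimately show ?thesis by (intro simplicial_complexI) auto
qed

lemma Union_polygon: "\<Union>(polygon m) = {..<m}"
  by (auto simp: polygon_def)

lemma linear_sphere_polygon:
  assumes "m \<ge> 3"
  shows "linear_sphere 2 (polygon m)"
  using assms
proof (induction m rule: dec_induct)
  case base
  have "polygon 3 = bdry {..2}"
  proof -
    have "{..2} = {0, 1, 2::nat}" by auto
    moreover have "polygon 3 = {{}, {0}, {1}, {2}, {0,1}, {1,2}, {2,0}}"
      unfolding polygon_alt[of 3, simplified]
      by (auto simp: less_Suc_eq numeral_3_eq_3 numeral_2_eq_2)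
    moreover have "\<tau> \<subset> {0, 1, 2} \<longleftrightarrow> \<tau> \<in> {{}, {0}, {1}, {2}, {0,1}, {1,2}, {2,0::nat}}" for \<tau>
    proof
      assume \<tau>: "\<tau> \<subset> {0, 1, 2}"
      then have "\<tau> = (if 0 \<in> \<tau> then {0} else {}) \<union> (if 1 \<in> \<tau> then {1} else {}) \<union> (if 2 \<in> \<tau> then {2} else {})"
        by auto
      moreover have "\<not> (0 \<in> \<tau> \<and> 1 \<in> \<tau> \<and> 2 \<in> \<tau>)" using \<tau> by auto
      ultimately show "\<tau> \<in> {{}, {0}, {1}, {2}, {0,1}, {1,2}, {2,0}}"
        by (auto simp only: if_True if_False split: if_splits)
    next
      assume "\<tau> \<in> {{}, {0}, {1}, {2}, {0,1}, {1,2}, {2,0}}"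
      then show "\<tau> \<subset> {0, 1, 2}"
        by (elim insertE emptyE) (simp_all add: less_le_not_le)
    qed
    ultimately show ?thesis unfolding bdry_def by auto
  qed
  then show ?case using linear_sphere_bdry[of "{..2::nat}" 2] by simp
next
  case (step m)
  have "{m - 1, 0} \<in> polygon m" using polygon_alt[of m] step.hyps by auto
  moreover have "m \<notin> \<Union>(polygon m)" unfolding Union_polygon by auto
  ultimately have "refines (polygon (Suc m)) (polygon m)"
    unfolding polygon_Suc[OF step.hyps(1)]
    by (intro refines_stellar simplicial_complex_polygon) auto
  then show ?case using step.IH linear_sphere_refines simplicial_complex_polygon by blast
qed

section \<open>Topology of realizations\<close>

lemma Hausdorff_space_top_of_set_fun:
  "Hausdorff_space (top_of_set (S :: ('i \<Rightarrow> 'b::metric_space) set))"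
proof -
  have "Hausdorff_space (product_topology (\<lambda>i::'i. euclidean :: 'b topology) UNIV)"
    by (simp add: Hausdorff_space_product_topology)
  then show ?thesis
    unfolding euclidean_product_topology by (rule Hausdorff_space_subtopology)
qed

lemma realization_eq_fan:
  assumes "simplicial_complex K"
  shows "realization K = {x \<in> fan K. sum x (\<Union>K) = 1}"
proof -
  have "sum x (supp x) = sum x (\<Union>K)" if "supp x \<in> K" for x :: "'a \<Rightarrow> real"
    using that simplicial_complexD(5)[OF assms] by (intro sum.mono_neutral_left) auto
  then show ?thesis unfolding realization_def fan_def by auto
qed

lemma continuous_on_lin: "continuous_on S (lin V P)"
  unfolding lin_def
  by (intro continuous_on_coordinatewise_then_product continuous_on_sum continuous_on_mult
      continuous_on_const continuous_on_subset[OF continuous_on_product_coordinates]) auto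

text \<open>The ambient product may be infinite, so compactness comes from Tychonoff for a box that
  is degenerate away from the vertices. The supports are controlled by a finite union of coordinate
  subspaces, one for each simplex.\<close>

lemma compact_realization:
  assumes K: "simplicial_complex K"
  shows "compact (realization K)"
proof -
  let ?V = "\<Union>K"
  let ?box = "PiE UNIV (\<lambda>v. if v \<in> ?V then {0..1::real} else {0})"
  have fin: "finite ?V" "finite K" using K simplicial_complexD by blast+
  have "compactin (product_topology (\<lambda>v. euclidean) UNIV) ?box"
    unfolding compactin_PiE by auto
  then have "compact ?box" by (simp add: euclidean_product_topology)
  moreover have "closed (\<Union>\<sigma>\<in>K. \<Inter>v\<in>-\<sigma>. {x. x v = (0::real)})"
    using fin by (intro closed_UN closed_INT ballI closed_Collect_eq) auto
  moreover have "closed {x. sum x ?V = (1::real)}"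
    by (intro closed_Collect_eq continuous_on_sum) auto
  moreover have "realization K = ?box \<inter> (\<Union>\<sigma>\<in>K. \<Inter>v\<in>-\<sigma>. {x. x v = 0}) \<inter> {x. sum x ?V = 1}" (is "_ = ?R")
  proof
    show "realization K \<subseteq> ?R"
    proof
      fix x assume "x \<in> realization K"
      then have x: "x \<in> fan K" "sum x ?V = 1" using realization_eq_fan[OF K] by auto
      have "x v \<le> 1" if "v \<in> ?V" for v
        using member_le_sum[OF that, of x] fanD(1)[OF x(1)] fin(1) x(2) by simp
      then have "x \<in> ?box" using fanD(1,3)[OF x(1)] by (auto simp: PiE_def Pi_def)
      moreover have "x \<in> (\<Inter>v\<in>-supp x. {x. x v = 0})" by auto
      ultimately show "x \<in> ?R" using fanD(2)[OF x(1)] x(2) by blast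
    qed
    show "?R \<subseteq> realization K"
    proof
      fix x assume x: "x \<in> ?R"
      then obtain \<sigma> where \<sigma>: "\<sigma> \<in> K" "\<forall>v\<in>-\<sigma>. x v = 0" by auto
      have "supp x \<in> K" using \<sigma>(2) by (intro simplicial_complexD(4)[OF K \<sigma>(1)]) auto
      moreover have "0 \<le> x v" for v
        using x by (cases "v \<in> ?V") (auto simp: PiE_def Pi_def split: if_splits)
      ultimately have "x \<in> fan K" by (simp add: fan_def)
      moreover have "sum x ?V = 1" using x by (elim IntE CollectE)
      ultimately show "x \<in> realization K" unfolding realization_eq_fan[OF K] by (intro CollectI conjI)
    qed
  qed
  ultimately show ?thesis by (simp only: compact_Int_closed)
qed

lemma unit_fun_in_fan:
  assumes "simplicial_complex K" "v \<in> \<Union>K"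
  shows "unit_fun v \<in> fan K"
proof -
  have "{v} \<in> K" using assms(2) simplicial_complexD(4)[OF assms(1)] by blast
  moreover have "supp (unit_fun v) = {v}" by (auto simp: unit_fun_def)
  ultimately show ?thesis by (auto simp: fan_def unit_fun_def)
qed

lemma refines_imp_bij_realization:
  assumes K: "simplicial_complex K" and L: "simplicial_complex L" and ref: "refines K L"
  obtains P where "bij_betw (lin (\<Union>K) P) (realization K) (realization L)"
proof -
  let ?V = "\<Union>K" and ?U = "\<Union>L"
  obtain P where P: "bij_betw (lin ?V P) (fan K) (fan L)"
    using ref unfolding refines_def by blast
  have fin: "finite ?V" "finite ?U" using K L simplicial_complexD(5) by blast+
  have linu: "lin ?V P (unit_fun v) = P v" if "v \<in> ?V" for v
  proof
    fix w
    have "lin ?V P (unit_fun v) w = (\<Sum>u\<in>?V. if u = v then P u w else 0)"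
      unfolding lin_def unit_fun_def by (intro sum.cong) auto
    then show "lin ?V P (unit_fun v) w = P v w" using that fin(1) by simp
  qed
  \<comment> \<open>Rescaling each coordinate preserves the fan, so the images of the vertices may be normalised.\<close>
  define m where "m v = (if v \<in> ?V then sum (P v) ?U else 1)" for v
  have zero: "(\<lambda>v. 0) \<in> fan K" using simplicial_complexD(2)[OF K] by (simp add: fan_def)
  \<comment> \<open>The image of a vertex is nonnegative, and injectivity keeps it apart from the
    image 0 of the zero function. So its coordinate sum is positive.\<close>
  have m: "m v > 0" for v
  proof (cases "v \<in> ?V")
    case True
    have u: "unit_fun v \<in> fan K" using unit_fun_in_fan[OF K True] .
    have PL: "P v \<in> fan L" using linu[OF True] bij_betwE[OF P] u by metis
    have "lin ?V P (\<lambda>v. 0) = (\<lambda>w. 0)" by (simp add: lin_def)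
    moreover have "unit_fun v \<noteq> (\<lambda>v. 0)" by (auto simp: unit_fun_def fun_eq_iff)
    ultimately have "P v \<noteq> (\<lambda>w. 0)"
      using linu[OF True] bij_betw_imp_inj_on[OF P] u zero by (metis inj_onD)
    then obtain w where "P v w \<noteq> 0" by (auto simp: fun_eq_iff)
    then have "w \<in> ?U" "P v w > 0" using fanD(3)[OF PL, of w] fanD(1)[OF PL, of w] by auto
    then have "sum (P v) ?U > 0" using fanD(1)[OF PL] fin by (meson sum_pos2)
    then show ?thesis using True by (simp add: m_def)
  qed (simp add: m_def)
  define D where "D x = (\<lambda>v. x v / m v)" for x :: "_ \<Rightarrow> real"
  have mn0: "m v \<noteq> 0" for v using m[of v] by simp
  have "bij_betw D (fan K) (fan K)"
  proof (rule bij_betw_byWitness[where f' = "\<lambda>x v. x v * m v"])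
    have "supp (D x) = supp x" "supp (\<lambda>v. x v * m v) = supp x" for x
      using mn0 by (auto simp: D_def)
    moreover have "0 \<le> D x v \<longleftrightarrow> 0 \<le> x v" "0 \<le> x v * m v \<longleftrightarrow> 0 \<le> x v" for x v
      using m[of v] by (auto simp: D_def zero_le_divide_iff zero_le_mult_iff)
    ultimately show "D ` fan K \<subseteq> fan K" "(\<lambda>x v. x v * m v) ` fan K \<subseteq> fan K"
      unfolding fan_def by auto
  qed (use mn0 in \<open>auto simp: D_def fun_eq_iff\<close>)
  then have "bij_betw (lin ?V P \<circ> D) (fan K) (fan L)" using P by (rule bij_betw_trans)
  moreover have "lin ?V P \<circ> D = lin ?V (\<lambda>v w. P v w / m v)"
    by (auto simp: fun_eq_iff lin_def D_def)
  ultimately have bij: "bij_betw (lin ?V (\<lambda>v w. P v w / m v)) (fan K) (fan L)" by simp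
  \<comment> \<open>After the division every vertex has an image of total mass 1, so the total mass
    of each point is preserved and realizations correspond.\<close>
  have "sum (lin ?V (\<lambda>v w. P v w / m v) x) ?U = sum x ?V" for x
  proof -
    have "sum (lin ?V (\<lambda>v w. P v w / m v) x) ?U = (\<Sum>v\<in>?V. \<Sum>w\<in>?U. x v * (P v w / m v))"
      unfolding lin_def by (rule sum.swap)
    also have "\<dots> = (\<Sum>v\<in>?V. x v * (sum (P v) ?U / m v))"
      by (simp add: sum_distrib_left sum_divide_distrib)
    also have "\<dots> = sum x ?V"
    proof (rule sum.cong)
      fix v assume "v \<in> ?V"
      then have "sum (P v) ?U = m v" by (simp add: m_def)
      then show "x v * (sum (P v) ?U / m v) = x v" using mn0[of v] by simp
    qed simp
    finally show ?thesis .
  qed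
  then have "bij_betw (lin ?V (\<lambda>v w. P v w / m v)) (realization K) (realization L)"
    unfolding realization_eq_fan[OF K] realization_eq_fan[OF L]
    by (intro bij_betw_Collect[OF bij]) simp
  then show thesis by (rule that)
qed

section \<open>Realizations as unions of geometric simplices\<close>

lemma convex_comb_unit_fun:
  assumes "finite \<sigma>"
  shows "convex_comb (unit_fun ` \<sigma>) a = (\<lambda>i. if i \<in> \<sigma> then a (unit_fun i) else 0)"
proof
  fix i
  have inj: "inj_on unit_fun \<sigma>" by (auto simp: inj_on_def unit_fun_def fun_eq_iff split: if_splits)
  have "convex_comb (unit_fun ` \<sigma>) a i = (\<Sum>v\<in>\<sigma>. a (unit_fun v) * unit_fun v i)"
    unfolding convex_comb_def by (simp add: sum.reindex[OF inj])
  also have "\<dots> = (\<Sum>v\<in>\<sigma>. if v = i then a (unit_fun v) else 0)"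
    by (intro sum.cong) (auto simp: unit_fun_def)
  finally show "convex_comb (unit_fun ` \<sigma>) a i = (if i \<in> \<sigma> then a (unit_fun i) else 0)"
    using assms by simp
qed

lemma geom_simplex_unit_fun:
  assumes "finite \<sigma>"
  shows "geom_simplex (unit_fun ` \<sigma>) = {x. (\<forall>v. 0 \<le> x v) \<and> supp x \<subseteq> \<sigma> \<and> sum x \<sigma> = 1}"
proof -
  have inj: "inj_on unit_fun \<sigma>" by (auto simp: inj_on_def unit_fun_def fun_eq_iff split: if_splits)
  have bc: "bary_coeffs (unit_fun ` \<sigma>) a \<longleftrightarrow> (\<forall>v\<in>\<sigma>. 0 \<le> a (unit_fun v)) \<and> (\<Sum>v\<in>\<sigma>. a (unit_fun v)) = 1" for a
    unfolding bary_coeffs_def by (simp add: sum.reindex[OF inj])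
  show ?thesis
  proof
    show "geom_simplex (unit_fun ` \<sigma>) \<subseteq> {x. (\<forall>v. 0 \<le> x v) \<and> supp x \<subseteq> \<sigma> \<and> sum x \<sigma> = 1}"
      unfolding geom_simplex_def convex_comb_unit_fun[OF assms] bc
      by (auto split: if_splits)
    show "{x. (\<forall>v. 0 \<le> x v) \<and> supp x \<subseteq> \<sigma> \<and> sum x \<sigma> = 1} \<subseteq> geom_simplex (unit_fun ` \<sigma>)"
    proof
      fix x assume x: "x \<in> {x. (\<forall>v. 0 \<le> x v) \<and> supp x \<subseteq> \<sigma> \<and> sum x \<sigma> = 1}"
      \<comment> \<open>Coefficients are indexed by points and not by vertices, so the vertex is
        decoded from its unit function.\<close>
      define a where "a y = x (THE v. y = unit_fun v)" for y :: "'a \<Rightarrow> real"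
      have a: "a (unit_fun v) = x v" for v
      proof -
        have "(THE u. unit_fun v = unit_fun u) = v"
          by (rule the_equality) (auto simp: unit_fun_def fun_eq_iff split: if_splits)
        then show ?thesis by (simp add: a_def)
      qed
      have "x = convex_comb (unit_fun ` \<sigma>) a"
        using x unfolding convex_comb_unit_fun[OF assms] by (auto simp: a fun_eq_iff)
      moreover have "bary_coeffs (unit_fun ` \<sigma>) a" using x unfolding bc by (simp add: a)
      ultimately show "x \<in> geom_simplex (unit_fun ` \<sigma>)" unfolding geom_simplex_def by blast
    qed
  qed
qed

lemma aff_indep_unit_fun:
  assumes "finite \<sigma>"
  shows "aff_indep (unit_fun ` \<sigma>)"
  unfolding aff_indep_def
proof (intro conjI allI impI ballI)
  show "finite (unit_fun ` \<sigma>)" using assms by simp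
  fix a y assume a: "sum a (unit_fun ` \<sigma>) = 0 \<and> (\<forall>i. (\<Sum>x\<in>unit_fun ` \<sigma>. a x * x i) = 0)"
    and "y \<in> unit_fun ` \<sigma>"
  then obtain v where v: "v \<in> \<sigma>" "y = unit_fun v" by auto
  have "convex_comb (unit_fun ` \<sigma>) a v = 0" unfolding convex_comb_def using a by blast
  then show "a y = 0" unfolding convex_comb_unit_fun[OF assms] using v by simp
qed

text \<open>The map is linear on the whole function space, so the simplices of \<open>K\<close>
  itself already form a suitable triangulation; the empty simplex is left out because it spans no
  point.\<close>

lemma pl_map_lin:
  assumes K: "simplicial_complex K"
  shows "pl_map (realization K) (lin V P)"
  unfolding pl_map_def
proof (intro exI[of _ "(\<lambda>\<sigma>. unit_fun ` \<sigma>) ` (K - {{}})"] conjI ballI)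
  note fin = simplicial_complexD(3)[OF K]
  show "finite ((\<lambda>\<sigma>. unit_fun ` \<sigma>) ` (K - {{}}))" using simplicial_complexD(1)[OF K] by simp
  have sum_supp: "sum x \<sigma> = sum x (supp x)" if "finite \<sigma>" "supp x \<subseteq> \<sigma>" for x :: "'a \<Rightarrow> real" and \<sigma>
    using that by (intro sum.mono_neutral_right) auto
  show "\<Union>(geom_simplex ` (\<lambda>\<sigma>. unit_fun ` \<sigma>) ` (K - {{}})) = realization K"
  proof (intro equalityI subsetI)
    fix x assume "x \<in> \<Union>(geom_simplex ` (\<lambda>\<sigma>. unit_fun ` \<sigma>) ` (K - {{}}))"
    then obtain \<sigma> where \<sigma>: "\<sigma> \<in> K" "x \<in> geom_simplex (unit_fun ` \<sigma>)" by auto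
    then have x: "\<forall>v. 0 \<le> x v" "supp x \<subseteq> \<sigma>" "sum x \<sigma> = 1"
      using geom_simplex_unit_fun[OF fin[OF \<sigma>(1)]] by auto
    have "supp x \<in> K" by (rule simplicial_complexD(4)[OF K \<sigma>(1) x(2)])
    then show "x \<in> realization K"
      using x sum_supp[OF fin[OF \<sigma>(1)] x(2)] by (simp add: realization_def)
  next
    fix x assume x: "x \<in> realization K"
    then have \<sigma>: "supp x \<in> K" and s: "sum x (supp x) = 1" "\<forall>v. 0 \<le> x v"
      by (auto simp: realization_def)
    have ne: "supp x \<noteq> {}"
    proof
      assume "supp x = {}"
      then show False using s(1) by (simp only: sum.empty)
    qed
    have "x \<in> geom_simplex (unit_fun ` supp x)"
      using s unfolding geom_simplex_unit_fun[OF fin[OF \<sigma>]] by simp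
    then show "x \<in> \<Union>(geom_simplex ` (\<lambda>\<sigma>. unit_fun ` \<sigma>) ` (K - {{}}))"
      using \<sigma> ne by (intro UN_I[of "unit_fun ` supp x"] imageI) auto
  qed
  fix A assume "A \<in> (\<lambda>\<sigma>. unit_fun ` \<sigma>) ` (K - {{}})"
  then obtain \<sigma> where \<sigma>: "\<sigma> \<in> K" "\<sigma> \<noteq> {}" "A = unit_fun ` \<sigma>" by auto
  show "A \<noteq> {}" using \<sigma> by simp
  show "aff_indep A" unfolding \<sigma>(3) by (rule aff_indep_unit_fun[OF fin[OF \<sigma>(1)]])
  show "\<forall>a. bary_coeffs A a \<longrightarrow> lin V P (convex_comb A a) = (\<lambda>j. \<Sum>x\<in>A. a x * lin V P x j)"
  proof (intro allI impI ext)
    fix a j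
    have "lin V P (convex_comb A a) j = (\<Sum>v\<in>V. \<Sum>x\<in>A. a x * x v * P v j)"
      unfolding lin_def convex_comb_def by (simp add: sum_distrib_right)
    also have "\<dots> = (\<Sum>x\<in>A. \<Sum>v\<in>V. a x * x v * P v j)" by (rule sum.swap)
    also have "\<dots> = (\<Sum>x\<in>A. a x * lin V P x j)"
      unfolding lin_def by (simp add: sum_distrib_left mult.assoc)
    finally show "lin V P (convex_comb A a) j = (\<Sum>x\<in>A. a x * lin V P x j)" .
  qed
qed

text \<open>A continuous bijection from a compact space to a Hausdorff space is a homeomorphism, so
  the inverse of the matrix map need not be described.\<close>

lemma refines_imp_pl_homeomorphic:
  assumes K: "simplicial_complex K" and L: "simplicial_complex L" and ref: "refines K L"
  shows "pl_homeomorphic K L"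
proof -
  obtain P where P: "bij_betw (lin (\<Union>K) P) (realization K) (realization L)"
    using refines_imp_bij_realization[OF assms] .
  have "homeomorphic_map (top_of_set (realization K)) (top_of_set (realization L)) (lin (\<Union>K) P)"
  proof (rule continuous_imp_homeomorphic_map)
    show "continuous_map (top_of_set (realization K)) (top_of_set (realization L)) (lin (\<Union>K) P)"
      using continuous_on_lin bij_betw_imp_surj_on[OF P] by (auto simp: continuous_map_in_subtopology)
    show "compact_space (top_of_set (realization K))"
      using compact_realization[OF K] by (simp add: compact_space_subtopology)
  qed (use P Hausdorff_space_top_of_set_fun in \<open>auto simp: bij_betw_def\<close>)
  then show ?thesis unfolding pl_homeomorphic_def using pl_map_lin[OF K] by blast
qed

lemma linear_sphere_imp_pl_sphere:
  assumes "linear_sphere (Suc d) K"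
  shows "pl_sphere d K"
proof -
  have eq: "bdry {..Suc d} = simplex_boundary d"
    by (simp add: bdry_def simplex_boundary_def atLeast0AtMost)
  have "simplicial_complex (simplex_boundary d)"
    unfolding eq[symmetric] by (intro simplicial_complex_bdry) auto
  then show ?thesis
    using assms refines_imp_pl_homeomorphic unfolding pl_sphere_def linear_sphere_def eq by blast
qed

section \<open>Quotients by colour-preserving free actions\<close>

text \<open>The colouring prevents two distinct vertices of one simplex from lying in the same
  orbit. Freeness is phrased on the vertices of \<open>K\<close> only: a group element fixing one
  vertex fixes all of them. It is needed for links, not for the poset structure.\<close>

locale balanced_action =
  fixes K :: "'v set set" and G :: "('v \<Rightarrow> 'v) set" and \<kappa> :: "'v \<Rightarrow> nat"
  assumes cplx: "simplicial_complex K"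
    and id_in: "id \<in> G"
    and comp_in: "g \<in> G \<Longrightarrow> h \<in> G \<Longrightarrow> g \<circ> h \<in> G"
    and left_inverse: "g \<in> G \<Longrightarrow> \<exists>h\<in>G. h \<circ> g = id"
    and act: "g \<in> G \<Longrightarrow> \<sigma> \<in> K \<Longrightarrow> g ` \<sigma> \<in> K"
    and colour: "g \<in> G \<Longrightarrow> v \<in> \<Union>K \<Longrightarrow> \<kappa> (g v) = \<kappa> v"
    and inj_colour: "\<sigma> \<in> K \<Longrightarrow> inj_on \<kappa> \<sigma>"
    and free: "g \<in> G \<Longrightarrow> v \<in> \<Union>K \<Longrightarrow> g v = v \<Longrightarrow> u \<in> \<Union>K \<Longrightarrow> g u = u"
begin

abbreviation orb :: "'v set \<Rightarrow> 'v set set" where "orb \<equiv> orbit_of G"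
abbreviation le :: "'v set set \<Rightarrow> 'v set set \<Rightarrow> bool" where "le \<equiv> quot_le G"
abbreviation Q :: "'v set set set" where "Q \<equiv> quot_carrier K G"
abbreviation S :: "'v set set" where "S \<equiv> K - {{}}"

lemmas cplxD = simplicial_complexD[OF cplx]

section \<open>Rigidity and the order on orbits\<close>

lemma inverse:
  assumes "g \<in> G"
  obtains h where "h \<in> G" "h \<circ> g = id" "g \<circ> h = id"
proof -
  obtain h where h: "h \<in> G" "h \<circ> g = id" using left_inverse[OF assms] by blast
  obtain k where k: "k \<circ> h = id" using left_inverse[OF h(1)] by blast
  have "k = k \<circ> (h \<circ> g)" using h(2) by simp
  also have "\<dots> = g" using k by (simp add: o_assoc)
  finally show thesis using that h k by simp
qed

lemma inj_G: "g \<in> G \<Longrightarrow> inj g"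
  using left_inverse by (metis inj_on_id inj_on_imageI2)

lemma card_G: "g \<in> G \<Longrightarrow> card (g ` \<sigma>) = card \<sigma>"
  by (meson card_image inj_G inj_on_subset subset_UNIV)

text \<open>Two vertices of \<beta> in one orbit have the same colour and hence coincide.
  Consequently the faces of a fixed simplex embed into the quotient.\<close>

lemma rigid_vertex:
  assumes "\<beta> \<in> K" "g \<in> G" "v \<in> \<beta>" "g v \<in> \<beta>"
  shows "g v = v"
proof -
  have "\<kappa> (g v) = \<kappa> v" using assms by (intro colour) auto
  then show ?thesis using inj_colour[OF assms(1)] assms by (meson inj_onD)
qed

lemma rigid:
  assumes "\<beta> \<in> K" "g \<in> G" "\<sigma> \<subseteq> \<beta>" "g ` \<sigma> \<subseteq> \<beta>"
  shows "g ` \<sigma> = \<sigma>"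
proof -
  have "g v = v" if "v \<in> \<sigma>" for v using rigid_vertex[OF assms(1,2)] assms that by blast
  then show ?thesis by force
qed

lemma orb_eq_iff: "orb \<sigma> = orb \<tau> \<longleftrightarrow> (\<exists>g\<in>G. \<tau> = g ` \<sigma>)"
proof
  assume "orb \<sigma> = orb \<tau>"
  moreover have "\<tau> \<in> orb \<tau>" unfolding orbit_of_def by (rule image_eqI[OF _ id_in]) simp
  ultimately have "\<tau> \<in> orb \<sigma>" by simp
  then show "\<exists>g\<in>G. \<tau> = g ` \<sigma>" by (auto simp: orbit_of_def)
next
  assume "\<exists>g\<in>G. \<tau> = g ` \<sigma>"
  then obtain g where g: "g \<in> G" "\<tau> = g ` \<sigma>" by blast
  obtain h where h: "h \<in> G" "h \<circ> g = id" using inverse[OF g(1)] by blast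
  have 1: "k ` \<tau> = (k \<circ> g) ` \<sigma>" for k using g by (simp add: image_comp)
  have 2: "k ` \<sigma> = (k \<circ> h) ` \<tau>" for k using g(2) h(2) by (metis comp_assoc comp_id image_comp)
  show "orb \<sigma> = orb \<tau>"
    unfolding orbit_of_def
  proof (intro equalityI image_subsetI)
    fix k assume "k \<in> G"
    show "k ` \<sigma> \<in> (\<lambda>k. k ` \<tau>) ` G" using 2[of k] comp_in[OF \<open>k \<in> G\<close> h(1)] by (rule image_eqI)
    show "k ` \<tau> \<in> (\<lambda>k. k ` \<sigma>) ` G" using 1[of k] comp_in[OF \<open>k \<in> G\<close> g(1)] by (rule image_eqI)
  qed
qed

lemma orb_image: "g \<in> G \<Longrightarrow> orb (g ` \<sigma>) = orb \<sigma>"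
  using orb_eq_iff by metis

lemma le_orb_iff: "le (orb \<sigma>) (orb \<tau>) \<longleftrightarrow> (\<exists>g\<in>G. g ` \<sigma> \<subseteq> \<tau>)"
proof
  assume "le (orb \<sigma>) (orb \<tau>)"
  then obtain a b g where g: "a \<in> G" "b \<in> G" "g \<in> G" "a ` \<sigma> \<subseteq> g ` b ` \<tau>"
    by (auto simp: quot_le_def orbit_of_def)
  obtain h where h: "h \<in> G" "h \<circ> (g \<circ> b) = id" using inverse comp_in g by metis
  have "h ` a ` \<sigma> \<subseteq> h ` g ` b ` \<tau>" using g(4) by (rule image_mono)
  also have "h ` g ` b ` \<tau> = (h \<circ> (g \<circ> b)) ` \<tau>" by (simp only: image_comp)
  finally have "(h \<circ> a) ` \<sigma> \<subseteq> \<tau>" using h by (simp add: image_comp)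
  then show "\<exists>g\<in>G. g ` \<sigma> \<subseteq> \<tau>" using comp_in h g by blast
next
  assume "\<exists>g\<in>G. g ` \<sigma> \<subseteq> \<tau>"
  then obtain g where g: "g \<in> G" "g ` \<sigma> \<subseteq> \<tau>" by blast
  have "g ` \<sigma> \<in> orb \<sigma>" "id ` \<tau> \<in> orb \<tau>" using g id_in unfolding orbit_of_def by blast+
  moreover have "g ` \<sigma> \<subseteq> id ` id ` \<tau>" using g by simp
  ultimately show "le (orb \<sigma>) (orb \<tau>)" unfolding quot_le_def using id_in by blast
qed

lemma le_orb_below:
  assumes "\<beta> \<in> K" "\<sigma> \<subseteq> \<beta>" "\<tau> \<subseteq> \<beta>"
  shows "le (orb \<sigma>) (orb \<tau>) \<longleftrightarrow> \<sigma> \<subseteq> \<tau>"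
proof
  assume "le (orb \<sigma>) (orb \<tau>)"
  then obtain g where g: "g \<in> G" "g ` \<sigma> \<subseteq> \<tau>" using le_orb_iff by blast
  then have "g ` \<sigma> \<subseteq> \<beta>" using assms(3) by blast
  then show "\<sigma> \<subseteq> \<tau>" using rigid[OF assms(1) g(1) assms(2)] g(2) by simp
next
  assume "\<sigma> \<subseteq> \<tau>"
  then show "le (orb \<sigma>) (orb \<tau>)" unfolding le_orb_iff using id_in by (intro bexI[of _ id]) auto
qed

lemma orb_inj_below:
  assumes "\<beta> \<in> K" "\<sigma> \<subseteq> \<beta>" "\<tau> \<subseteq> \<beta>" "orb \<sigma> = orb \<tau>"
  shows "\<sigma> = \<tau>"
proof -
  obtain g where "g \<in> G" "\<tau> = g ` \<sigma>" using assms(4) orb_eq_iff by blast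
  then show ?thesis using rigid[OF assms(1) _ assms(2), of g] assms(3) by metis
qed

text \<open>Group elements preserve cardinality, so a translate inside \<tau> with no fewer elements
  fills it. Antisymmetry of the quotient order is a consequence.\<close>

lemma le_antisym_card:
  assumes "\<sigma> \<in> K" "\<tau> \<in> K" "le (orb \<sigma>) (orb \<tau>)" "card \<tau> \<le> card \<sigma>"
  shows "orb \<sigma> = orb \<tau>"
proof -
  obtain g where g: "g \<in> G" "g ` \<sigma> \<subseteq> \<tau>" using assms(3) le_orb_iff by blast
  have "g ` \<sigma> = \<tau>"
    using card_seteq[OF cplxD(3)[OF assms(2)] g(2)] card_G[OF g(1)] assms(4) by simp
  then show ?thesis using orb_image[OF g(1)] by metis
qed

lemma le_orb_card:
  assumes "\<tau> \<in> K" "le (orb \<sigma>) (orb \<tau>)"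
  shows "card \<sigma> \<le> card \<tau>"
proof -
  obtain g where g: "g \<in> G" "g ` \<sigma> \<subseteq> \<tau>" using assms(2) le_orb_iff by blast
  then show ?thesis using card_mono[OF cplxD(3)[OF assms(1)] g(2)] card_G[OF g(1)] by simp
qed

lemma Q_eq: "Q = orb ` K"
  by (simp add: quot_carrier_def)

lemma partial_order: "partial_order_on_set Q le"
  unfolding partial_order_on_set_def Q_eq
proof (intro conjI ballI impI)
  fix x assume "x \<in> orb ` K"
  then obtain \<sigma> where "x = orb \<sigma>" by blast
  then show "le x x" using le_orb_iff[of \<sigma> \<sigma>] id_in by (metis image_id id_apply order_refl)
next
  fix x y assume "x \<in> orb ` K" "y \<in> orb ` K" "le x y \<and> le y x"
  then show "x = y" using le_antisym_card le_orb_card by (metis imageE)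
next
  fix x y z assume "x \<in> orb ` K" "y \<in> orb ` K" "z \<in> orb ` K" "le x y \<and> le y z"
  then obtain \<sigma> \<tau> \<rho> where *: "x = orb \<sigma>" "z = orb \<rho>" "le (orb \<sigma>) (orb \<tau>)" "le (orb \<tau>) (orb \<rho>)"
    by (elim imageE conjE) simp
  obtain g where g: "g \<in> G" "g ` \<sigma> \<subseteq> \<tau>" using * le_orb_iff by blast
  obtain h where h: "h \<in> G" "h ` \<tau> \<subseteq> \<rho>" using * le_orb_iff by blast
  have "(h \<circ> g) ` \<sigma> \<subseteq> \<rho>" using g(2) h(2) by auto
  then show "le x z" unfolding *(1,2) using le_orb_iff comp_in[OF h(1) g(1)] by blast
qed

text \<open>Any orbit below that of \<beta> has a representative inside \<beta>, and rigidity makes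
  it unique. So lower intervals of the quotient are Boolean.\<close>

lemma bij_betw_lower:
  assumes "\<beta> \<in> K"
  shows "bij_betw orb (Pow \<beta>) {y\<in>Q. le y (orb \<beta>)}"
  unfolding bij_betw_def
proof
  show "inj_on orb (Pow \<beta>)" using orb_inj_below[OF assms] by (intro inj_onI) auto
  show "orb ` Pow \<beta> = {y\<in>Q. le y (orb \<beta>)}"
  proof (intro equalityI subsetI)
    fix y assume "y \<in> orb ` Pow \<beta>"
    then obtain \<sigma> where \<sigma>: "y = orb \<sigma>" "\<sigma> \<subseteq> \<beta>" by auto
    then have "\<sigma> \<in> K" using cplxD(4)[OF assms] by blast
    then show "y \<in> {y\<in>Q. le y (orb \<beta>)}"
      using \<sigma> le_orb_below[OF assms \<sigma>(2) order_refl] unfolding Q_eq by simp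
  next
    fix y assume "y \<in> {y\<in>Q. le y (orb \<beta>)}"
    then obtain \<sigma> where \<sigma>: "y = orb \<sigma>" "le (orb \<sigma>) (orb \<beta>)" unfolding Q_eq by blast
    then obtain g where "g \<in> G" "g ` \<sigma> \<subseteq> \<beta>" using le_orb_iff by blast
    then show "y \<in> orb ` Pow \<beta>" using \<sigma>(1) orb_image by (metis PowI image_eqI)
  qed
qed

lemma card_lower:
  assumes "\<beta> \<in> K"
  shows "card {y\<in>Q. le y (orb \<beta>)} = 2 ^ card \<beta>"
  using bij_betw_same_card[OF bij_betw_lower[OF assms]] card_Pow[OF cplxD(3)[OF assms]] by simp

lemma simplicial_cell_complex_quotient: "simplicial_cell_complex Q le"
  unfolding simplicial_cell_complex_def
proof (intro conjI ballI)
  show "finite Q" unfolding Q_eq using cplxD(1) by simp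
  show "partial_order_on_set Q le" by (rule partial_order)
  show "\<exists>b\<in>Q. \<forall>x\<in>Q. le b x"
  proof (intro bexI[of _ "orb {}"] ballI)
    show "orb {} \<in> Q" unfolding Q_eq using cplxD(2) by blast
    fix x assume "x \<in> Q"
    then obtain \<sigma> where "x = orb \<sigma>" unfolding Q_eq by blast
    then show "le (orb {}) x" using le_orb_iff id_in by auto
  qed
  fix x assume "x \<in> Q"
  then obtain \<beta> where \<beta>: "\<beta> \<in> K" "x = orb \<beta>" unfolding Q_eq by blast
  let ?i = "the_inv_into (Pow \<beta>) orb"
  have inj: "inj_on orb (Pow \<beta>)" using bij_betw_lower[OF \<beta>(1)] by (simp add: bij_betw_def)
  \<comment> \<open>The colours supply the required finite sets of natural numbers: a cell
    corresponds to the colour set of its representative in \<beta>.\<close>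
  have "bij_betw \<kappa> \<beta> (\<kappa> ` \<beta>)" using inj_colour[OF \<beta>(1)] by (simp add: bij_betw_def)
  then have "bij_betw (\<lambda>\<sigma>. \<kappa> ` \<sigma>) (Pow \<beta>) (Pow (\<kappa> ` \<beta>))" by (rule bij_betw_Pow)
  then have "bij_betw ((\<lambda>\<sigma>. \<kappa> ` \<sigma>) \<circ> ?i) {y\<in>Q. le y x} (Pow (\<kappa> ` \<beta>))"
    using bij_betw_the_inv_into[OF bij_betw_lower[OF \<beta>(1)]] \<beta>(2) bij_betw_trans by blast
  moreover have "le y z \<longleftrightarrow> ((\<lambda>\<sigma>. \<kappa> ` \<sigma>) \<circ> ?i) y \<subseteq> ((\<lambda>\<sigma>. \<kappa> ` \<sigma>) \<circ> ?i) z"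
    if yz: "y \<in> Q" "z \<in> Q" "le y x" "le z x" for y z
  proof -
    have "y \<in> orb ` Pow \<beta>" "z \<in> orb ` Pow \<beta>"
      using yz \<beta> bij_betw_lower[OF \<beta>(1)] by (auto simp: bij_betw_def)
    then obtain \<sigma> \<tau> where *: "y = orb \<sigma>" "\<sigma> \<subseteq> \<beta>" "z = orb \<tau>" "\<tau> \<subseteq> \<beta>" by blast
    have "?i y = \<sigma>" "?i z = \<tau>" using * the_inv_into_f_f[OF inj] by auto
    moreover have "\<kappa> ` \<sigma> \<subseteq> \<kappa> ` \<tau> \<longleftrightarrow> \<sigma> \<subseteq> \<tau>"
      using inj_on_image_subset_iff[OF inj_colour[OF \<beta>(1)]] * by blast
    ultimately show ?thesis using le_orb_below[OF \<beta>(1)] * by simp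
  qed
  ultimately show "\<exists>(A::nat set) f. finite A \<and> bij_betw f {y\<in>Q. le y x} (Pow A) \<and>
        (\<forall>y\<in>Q. \<forall>z\<in>Q. le y x \<longrightarrow> le z x \<longrightarrow> (le y z \<longleftrightarrow> f y \<subseteq> f z))"
    using cplxD(3)[OF \<beta>(1)]
    by (intro exI[of _ "\<kappa> ` \<beta>"] exI[of _ "(\<lambda>\<sigma>. \<kappa> ` \<sigma>) \<circ> ?i"] conjI) blast+
qed

section \<open>Chains of cells, their lifts and their links\<close>

lemma inj_orb_chain:
  assumes "D \<in> chains S"
  shows "inj_on orb D"
proof (rule inj_onI)
  fix \<sigma> \<tau> assume *: "\<sigma> \<in> D" "\<tau> \<in> D" "orb \<sigma> = orb \<tau>"
  have K: "\<sigma> \<in> K" "\<tau> \<in> K" using * assms by (auto simp: chains_def)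
  have "\<sigma> \<subseteq> \<tau> \<or> \<tau> \<subseteq> \<sigma>" using * assms unfolding chains_def by blast
  then show "\<sigma> = \<tau>" using orb_inj_below[OF K(1)] orb_inj_below[OF K(2)] *(3) by auto
qed

text \<open>\<open>derived\<close> removes the cell lying below all others, which here is exactly
  the orbit of the empty simplex.\<close>

lemma derived_alt:
  "derived Q le = {C. finite C \<and> C \<subseteq> orb ` S \<and> (\<forall>x\<in>C. \<forall>y\<in>C. le x y \<or> le y x)}"
proof -
  have bot: "(\<forall>y\<in>Q. le (orb \<sigma>) y) \<longleftrightarrow> \<sigma> = {}" for \<sigma>
  proof
    assume "\<forall>y\<in>Q. le (orb \<sigma>) y"
    moreover have "orb {} \<in> Q" unfolding Q_eq using cplxD(2) by blast
    ultimately show "\<sigma> = {}" using le_orb_iff by auto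
  next
    assume "\<sigma> = {}"
    then show "\<forall>y\<in>Q. le (orb \<sigma>) y" unfolding Q_eq using le_orb_iff id_in by auto
  qed
  have "{x\<in>Q. \<not> (\<forall>y\<in>Q. le x y)} = orb ` S"
  proof (intro equalityI subsetI)
    fix x assume x: "x \<in> {x\<in>Q. \<not> (\<forall>y\<in>Q. le x y)}"
    then obtain \<sigma> where \<sigma>: "\<sigma> \<in> K" "x = orb \<sigma>" unfolding Q_eq by blast
    then have "\<sigma> \<noteq> {}" using x bot[of \<sigma>] by blast
    then show "x \<in> orb ` S" using \<sigma> by simp
  next
    fix x assume "x \<in> orb ` S"
    then obtain \<sigma> where \<sigma>: "\<sigma> \<in> K" "\<sigma> \<noteq> {}" "x = orb \<sigma>" by blast
    then show "x \<in> {x\<in>Q. \<not> (\<forall>y\<in>Q. le x y)}" using bot[of \<sigma>] by (simp add: quot_carrier_def)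
  qed
  then show ?thesis unfolding derived_def by simp
qed

text \<open>A representative \<beta> of largest cardinality belongs to the top cell of the chain.
  All other cells then have representatives inside \<beta>, and there the order of orbits is
  inclusion.\<close>

lemma chain_lift:
  assumes "C \<in> derived Q le"
  shows "\<exists>D\<in>chains S. C = orb ` D"
proof (cases "C = {}")
  case True
  then show ?thesis by (intro bexI[of _ "{}"]) (auto simp: chains_def)
next
  case False
  have C: "finite C" "C \<subseteq> orb ` S" and lin: "\<And>x y. x \<in> C \<Longrightarrow> y \<in> C \<Longrightarrow> le x y \<or> le y x"
    using assms unfolding derived_alt by auto
  let ?R = "{\<beta>\<in>S. orb \<beta> \<in> C}"
  have "finite ?R" using cplxD(1) by simp
  moreover have "?R \<noteq> {}" using False C by blast
  ultimately obtain \<beta> where \<beta>: "\<beta> \<in> ?R" "\<And>\<sigma>. \<sigma> \<in> ?R \<Longrightarrow> card \<sigma> \<le> card \<beta>"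
    using obtains_MAX[of ?R card] by (metis (no_types, lifting) Max_ge finite_imageI imageI)
  have \<beta>K: "\<beta> \<in> K" "orb \<beta> \<in> C" using \<beta>(1) by auto
  have below: "le y (orb \<beta>)" if "y \<in> C" for y
  proof -
    obtain \<sigma> where \<sigma>: "\<sigma> \<in> S" "y = orb \<sigma>" using \<open>y \<in> C\<close> C(2) by blast
    then have "card \<sigma> \<le> card \<beta>" using that by (intro \<beta>(2)) auto
    moreover have "le y (orb \<beta>) \<or> le (orb \<beta>) y" using lin that \<beta>K(2) by blast
    ultimately show ?thesis
      using le_antisym_card[of \<beta> \<sigma>] \<sigma> \<beta>K by auto
  qed
  let ?D = "{\<sigma>. \<sigma> \<subseteq> \<beta> \<and> orb \<sigma> \<in> C}"
  have "?D \<subseteq> S"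
  proof
    fix \<sigma> assume \<sigma>: "\<sigma> \<in> ?D"
    then obtain \<tau> where "\<tau> \<in> S" "orb \<sigma> = orb \<tau>" using C by blast
    then have "\<sigma> \<noteq> {}" using orb_eq_iff by auto
    then show "\<sigma> \<in> S" using \<sigma> cplxD(4)[OF \<beta>K(1)] by blast
  qed
  moreover have "\<sigma> \<subseteq> \<tau> \<or> \<tau> \<subseteq> \<sigma>" if "\<sigma> \<in> ?D" "\<tau> \<in> ?D" for \<sigma> \<tau>
  proof -
    have *: "\<sigma> \<subseteq> \<beta>" "\<tau> \<subseteq> \<beta>" "orb \<sigma> \<in> C" "orb \<tau> \<in> C" using that by auto
    then show ?thesis
      using lin[OF *(3,4)] le_orb_below[OF \<beta>K(1) *(1,2)] le_orb_below[OF \<beta>K(1) *(2,1)] by blast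
  qed
  moreover have "finite ?D" using cplxD(3)[OF \<beta>K(1)] by simp
  ultimately have "?D \<in> chains S" unfolding chains_def by blast
  moreover have "C = orb ` ?D"
  proof
    show "C \<subseteq> orb ` ?D"
    proof
      fix y assume y: "y \<in> C"
      then have "y \<in> Q" using C unfolding Q_eq by blast
      then have "y \<in> orb ` Pow \<beta>"
        using below[OF y] bij_betw_lower[OF \<beta>K(1)] by (auto simp: bij_betw_def)
      then show "y \<in> orb ` ?D" using y by blast
    qed
  qed blast
  ultimately show ?thesis by blast
qed

lemma chain_image_G:
  assumes "D \<in> chains S" "g \<in> G"
  shows "(`) g ` D \<in> chains S"
proof -
  have "g ` \<sigma> \<in> S" if "\<sigma> \<in> D" for \<sigma> using that assms act by (auto simp: chains_def)
  moreover have "g ` \<sigma> \<subseteq> g ` \<tau> \<or> g ` \<tau> \<subseteq> g ` \<sigma>" if "\<sigma> \<in> D" "\<tau> \<in> D" for \<sigma> \<tau>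
  proof -
    have "\<sigma> \<subseteq> \<tau> \<or> \<tau> \<subseteq> \<sigma>" using that assms unfolding chains_def by blast
    then show ?thesis by (meson image_mono)
  qed
  moreover have "finite D" using assms by (simp add: chains_def)
  ultimately show ?thesis unfolding chains_def by blast
qed

text \<open>For links the lift has to pass through a prescribed representative; translating an
  arbitrary lift achieves this.\<close>

lemma chain_lift_at:
  assumes "C \<in> derived Q le" "orb \<alpha> \<in> C"
  shows "\<exists>D\<in>chains S. \<alpha> \<in> D \<and> C = orb ` D"
proof -
  obtain D where D: "D \<in> chains S" "C = orb ` D" using chain_lift[OF assms(1)] by blast
  then obtain \<alpha>' where \<alpha>': "\<alpha>' \<in> D" "orb \<alpha>' = orb \<alpha>" using assms(2) by (metis imageE)
  then obtain g where g: "g \<in> G" "\<alpha> = g ` \<alpha>'" using orb_eq_iff by blast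
  have "orb ` (`) g ` D = C" unfolding D(2) image_image orb_image[OF g(1)] ..
  then show ?thesis using chain_image_G[OF D(1) g(1)] \<alpha>'(1) g(2) by blast
qed

lemma derived_eq: "derived Q le = (`) orb ` chains S"
proof
  show "derived Q le \<subseteq> (`) orb ` chains S" using chain_lift by blast
  show "(`) orb ` chains S \<subseteq> derived Q le"
  proof
    fix C assume "C \<in> (`) orb ` chains S"
    then obtain D where D: "D \<in> chains S" "C = orb ` D" by blast
    have "le (orb \<sigma>) (orb \<tau>) \<or> le (orb \<tau>) (orb \<sigma>)" if "\<sigma> \<in> D" "\<tau> \<in> D" for \<sigma> \<tau>
    proof -
      have "\<sigma> \<subseteq> \<tau> \<or> \<tau> \<subseteq> \<sigma>" "\<sigma> \<in> K" "\<tau> \<in> K" using that D(1) unfolding chains_def by blast+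
      then show ?thesis using le_orb_below by blast
    qed
    moreover have "finite D" "D \<subseteq> S" using D(1) by (auto simp: chains_def)
    ultimately show "C \<in> derived Q le" unfolding derived_alt D(2) by blast
  qed
qed

lemma finite_S: "finite S" using cplxD(1) by simp

lemma simplicial_complex_derived: "simplicial_complex (derived Q le)"
  unfolding derived_eq by (intro simplicial_complex_image simplicial_complex_chains finite_S)

text \<open>Lifting chains through \<alpha> gives surjectivity. Injectivity on the vertices of the
  link goes beyond injectivity on single chains, as two simplices comparable with \<alpha> need not
  be comparable with each other.\<close>

lemma link_derived:
  assumes \<alpha>: "\<alpha> \<in> S"
  shows "link (derived Q le) {orb \<alpha>} = (`) orb ` link (chains S) {\<alpha>}"
    and "inj_on orb (\<Union>(link (chains S) {\<alpha>}))"
proof -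
  show "link (derived Q le) {orb \<alpha>} = (`) orb ` link (chains S) {\<alpha>}"
  proof (intro equalityI subsetI)
    fix C assume "C \<in> link (derived Q le) {orb \<alpha>}"
    then have C: "orb \<alpha> \<notin> C" "insert (orb \<alpha>) C \<in> derived Q le" by (auto simp: link_def)
    obtain D where D: "D \<in> chains S" "\<alpha> \<in> D" "insert (orb \<alpha>) C = orb ` D"
      using chain_lift_at[OF C(2) insertI1] by (elim bexE conjE)
    have "orb ` (D - {\<alpha>}) = orb ` D - {orb \<alpha>}"
      using inj_on_image_set_diff[OF inj_orb_chain[OF D(1)], of D "{\<alpha>}"] D(2) by simp
    then have "C = orb ` (D - {\<alpha>})" using D(3) C(1) by (metis Diff_insert_absorb)
    moreover have "D - {\<alpha>} \<in> link (chains S) {\<alpha>}"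
      using D(1,2) simplicial_complexD(4)[OF simplicial_complex_chains[OF finite_S] D(1)]
      by (simp add: link_def insert_absorb)
    ultimately show "C \<in> (`) orb ` link (chains S) {\<alpha>}" by blast
  next
    fix C assume "C \<in> (`) orb ` link (chains S) {\<alpha>}"
    then obtain D where D: "C = orb ` D" "D \<in> chains S" "\<alpha> \<notin> D" "insert \<alpha> D \<in> chains S"
      by (auto simp: link_def)
    have "orb \<alpha> \<notin> C"
    proof
      assume "orb \<alpha> \<in> C"
      then obtain \<sigma> where "\<sigma> \<in> D" "orb \<alpha> = orb \<sigma>" unfolding D(1) by (rule imageE)
      then show False using inj_onD[OF inj_orb_chain[OF D(4)], of \<alpha> \<sigma>] D(3) by simp
    qed
    moreover have "insert (orb \<alpha>) C \<in> derived Q le"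
      unfolding derived_eq D(1) image_insert[symmetric] by (rule imageI[OF D(4)])
    moreover have "C \<in> derived Q le" unfolding derived_eq D(1) by (rule imageI[OF D(2)])
    ultimately show "C \<in> link (derived Q le) {orb \<alpha>}" by (simp add: link_def)
  qed
  show "inj_on orb (\<Union>(link (chains S) {\<alpha>}))"
  proof (rule inj_onI)
    have comp: "\<beta> \<in> S \<and> (\<beta> \<subseteq> \<alpha> \<or> \<alpha> \<subseteq> \<beta>)" if "\<beta> \<in> \<Union>(link (chains S) {\<alpha>})" for \<beta>
    proof -
      obtain D where "\<beta> \<in> D" "D \<in> link (chains S) {\<alpha>}"
        using \<open>\<beta> \<in> \<Union>(link (chains S) {\<alpha>})\<close> by (elim UnionE)
      then have "\<beta> \<in> D" "insert \<alpha> D \<in> chains S" by (simp_all add: link_def)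
      then show ?thesis unfolding chains_def by blast
    qed
    fix \<beta> \<gamma> assume \<beta>: "\<beta> \<in> \<Union>(link (chains S) {\<alpha>})" and \<gamma>: "\<gamma> \<in> \<Union>(link (chains S) {\<alpha>})"
      and eq: "orb \<beta> = orb \<gamma>"
    have K: "\<alpha> \<in> K" "\<beta> \<in> K" "\<gamma> \<in> K" using \<alpha> comp[OF \<beta>] comp[OF \<gamma>] by auto
    obtain g where g: "g \<in> G" "\<gamma> = g ` \<beta>" using eq orb_eq_iff by blast
    \<comment> \<open>Only the second case uses freeness: the element carrying \<beta> to \<gamma>
      keeps a vertex of \<alpha> inside \<gamma>, hence fixes it by rigidity, hence fixes all
      vertices.\<close>
    consider "\<beta> \<subseteq> \<alpha>" "\<gamma> \<subseteq> \<alpha>" | "\<alpha> \<subseteq> \<beta>" "\<alpha> \<subseteq> \<gamma>" | "\<beta> \<subseteq> \<gamma> \<or> \<gamma> \<subseteq> \<beta>"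
      using comp[OF \<beta>] comp[OF \<gamma>] by blast
    then show "\<beta> = \<gamma>"
    proof cases
      case 1
      then show ?thesis using orb_inj_below[OF K(1)] eq by blast
    next
      case 2
      obtain v where v: "v \<in> \<alpha>" using \<alpha> by blast
      then have "g v = v" using 2 g by (intro rigid_vertex[OF K(3) g(1)]) auto
      moreover have "v \<in> \<Union>K" using v K(1) by blast
      ultimately have "g u = u" if "u \<in> \<beta>" for u
        using free[OF g(1), of v u] that K(2) by blast
      then show ?thesis using g(2) by force
    next
      case 3
      then show ?thesis using orb_inj_below[OF K(2)] orb_inj_below[OF K(3)] eq by blast
    qed
  qed
qed

text \<open>In a d-manifold the link of a simplex with \<open>card \<alpha>\<close> vertices has
  dimension \<open>d - card \<alpha>\<close>, that is, index \<open>d + 1 - card \<alpha>\<close>;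
  the hypothesis states this without subtraction.\<close>

lemma comb_manifold_quotient:
  assumes "\<And>\<alpha>. \<alpha> \<in> S \<Longrightarrow> \<exists>e. card \<alpha> + e = d + 1 \<and> linear_sphere e (link K \<alpha>)" and "d \<ge> 1"
  shows "comb_manifold d (derived Q le)"
  unfolding comb_manifold_def
proof (intro conjI allI impI simplicial_complex_derived)
  fix x assume "{x} \<in> derived Q le"
  then obtain \<alpha> where \<alpha>: "\<alpha> \<in> S" "x = orb \<alpha>" unfolding derived_alt by blast
  obtain e where e: "card \<alpha> + e = d + 1" "linear_sphere e (link K \<alpha>)" using assms(1)[OF \<alpha>(1)] by blast
  have "card \<alpha> > 0" using \<alpha>(1) cplxD(3) by (auto simp: card_gt_0_iff)
  then have d: "card \<alpha> - 1 + e = Suc (d - 1)" using e(1) assms(2) by linarith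
  have "linear_sphere (Suc (d - 1)) (link (chains S) {\<alpha>})"
    using linear_sphere_link_barycentric[OF cplx _ _ e(2)] \<alpha>(1) d by auto
  then have "linear_sphere (Suc (d - 1)) (link (derived Q le) {x})"
    unfolding \<alpha>(2) link_derived(1)[OF \<alpha>(1)] by (rule linear_sphere_image[OF _ link_derived(2)[OF \<alpha>(1)]])
  then show "pl_sphere (d - 1) (link (derived Q le) {x})" by (rule linear_sphere_imp_pl_sphere)
qed

section \<open>The simplicial map induced by passing to orbits, and its fibres\<close>

definition proj :: "('v set \<Rightarrow> real) \<Rightarrow> 'v set set \<Rightarrow> real" where
  "proj = lin S (\<lambda>\<sigma>. unit_fun (orb \<sigma>))"

lemma proj_orb:
  assumes c: "c \<in> fan (chains S)" and \<sigma>: "\<sigma> \<in> supp c"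
  shows "proj c (orb \<sigma>) = c \<sigma>"
proof -
  have D: "supp c \<in> chains S" using fanD(2)[OF c] .
  have "proj c (orb \<sigma>) = (\<Sum>\<tau>\<in>S. if \<tau> = \<sigma> then c \<tau> else 0)"
    unfolding proj_def lin_def
  proof (rule sum.cong)
    fix \<tau>
    show "c \<tau> * unit_fun (orb \<tau>) (orb \<sigma>) = (if \<tau> = \<sigma> then c \<tau> else 0)"
      using inj_onD[OF inj_orb_chain[OF D], of \<tau> \<sigma>] \<sigma> by (auto simp: unit_fun_def)
  qed simp
  moreover have "\<sigma> \<in> S" using D \<sigma> by (auto simp: chains_def)
  ultimately show ?thesis using finite_S by simp
qed

lemma proj_zero:
  assumes "w \<notin> orb ` supp c"
  shows "proj c w = 0"
  unfolding proj_def lin_def using assms by (intro sum.neutral) (auto simp: unit_fun_def)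

lemma supp_proj:
  assumes c: "c \<in> fan (chains S)"
  shows "supp (proj c) = orb ` supp c"
proof (intro equalityI subsetI)
  fix w assume "w \<in> supp (proj c)"
  then show "w \<in> orb ` supp c" using proj_zero by blast
next
  fix w assume "w \<in> orb ` supp c"
  then obtain \<sigma> where "w = orb \<sigma>" "\<sigma> \<in> supp c" by blast
  then show "w \<in> supp (proj c)" using proj_orb[OF c] by simp
qed

lemma proj_image: "proj ` realization (chains S) = realization (derived Q le)"
proof (intro equalityI subsetI)
  have sum_proj: "sum (proj c) (supp (proj c)) = sum c (supp c)" if c: "c \<in> fan (chains S)" for c
  proof -
    have "sum (proj c) (orb ` supp c) = (\<Sum>\<sigma>\<in>supp c. proj c (orb \<sigma>))"
      using sum.reindex[OF inj_orb_chain[OF fanD(2)[OF c]]] by (simp add: o_def)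
    also have "\<dots> = sum c (supp c)" using proj_orb[OF c] by (intro sum.cong) auto
    finally show ?thesis unfolding supp_proj[OF c] .
  qed
  {
    fix y assume "y \<in> proj ` realization (chains S)"
    then obtain c where c: "y = proj c" "c \<in> fan (chains S)" "sum c (supp c) = 1"
      by (auto simp: realization_def fan_def)
    have "supp y \<in> derived Q le"
      unfolding c(1) supp_proj[OF c(2)] derived_eq using fanD(2)[OF c(2)] by (rule imageI)
    moreover have "0 \<le> y w" for w
      unfolding c(1) proj_def lin_def using fanD(1)[OF c(2)]
      by (intro sum_nonneg) (simp add: unit_fun_def)
    moreover have "sum y (supp y) = 1" using sum_proj[OF c(2)] c(1,3) by simp
    ultimately show "y \<in> realization (derived Q le)" unfolding realization_def by blast
  }
  fix y assume "y \<in> realization (derived Q le)"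
  then have y: "\<And>w. 0 \<le> y w" "supp y \<in> derived Q le" "sum y (supp y) = 1"
    by (auto simp: realization_def)
  obtain D where D: "D \<in> chains S" "supp y = orb ` D" using chain_lift[OF y(2)] by blast
  \<comment> \<open>The lifted chain meets each orbit in the support of \<open>y\<close> once, so
    the coefficients can be copied along it.\<close>
  define c where "c \<sigma> = (if \<sigma> \<in> D then y (orb \<sigma>) else 0)" for \<sigma>
  have sc: "supp c = D"
  proof -
    have "y (orb \<sigma>) \<noteq> 0" if "\<sigma> \<in> D" for \<sigma> using that D(2) by blast
    then show ?thesis by (auto simp: c_def)
  qed
  have c: "c \<in> fan (chains S)" using sc D(1) y(1) by (auto simp: fan_def c_def)
  have "proj c w = y w" for w
  proof (cases "w \<in> orb ` D")
    case True
    then obtain \<sigma> where \<sigma>: "\<sigma> \<in> D" "w = orb \<sigma>" by blast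
    have "\<sigma> \<in> supp c" unfolding sc by (rule \<sigma>(1))
    then show ?thesis using proj_orb[OF c, of \<sigma>] \<sigma> by (simp add: c_def)
  next
    case False
    then have "proj c w = 0" using proj_zero[of w c] unfolding sc by simp
    moreover have "y w = 0" using False unfolding D(2)[symmetric] by simp
    ultimately show ?thesis by simp
  qed
  then have eq: "proj c = y" by (rule ext)
  moreover have "c \<in> realization (chains S)"
    using c sum_proj[OF c] y(3) unfolding eq by (simp add: realization_def fan_def)
  ultimately show "y \<in> proj ` realization (chains S)" by blast
qed

lemma bij_G_S:
  assumes "g \<in> G"
  shows "bij_betw ((`) g) S S"
proof -
  obtain h where h: "h \<in> G" "h \<circ> g = id" "g \<circ> h = id" using inverse[OF assms] by blast
  show ?thesis
    by (rule bij_betw_byWitness[where f' = "(`) h"]) (use h assms act in \<open>auto simp: image_comp\<close>)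
qed

lemma proj_invariant:
  assumes "g \<in> G" "\<And>\<sigma>. \<sigma> \<in> S \<Longrightarrow> c' (g ` \<sigma>) = c \<sigma>"
  shows "proj c' = proj c"
proof
  fix w
  have "proj c' w = (\<Sum>\<sigma>\<in>S. c' (g ` \<sigma>) * unit_fun (orb (g ` \<sigma>)) w)"
    unfolding proj_def lin_def
    using sum.reindex_bij_betw[OF bij_G_S[OF assms(1)], of "\<lambda>\<tau>. c' \<tau> * unit_fun (orb \<tau>) w"] by simp
  also have "\<dots> = proj c w"
    unfolding proj_def lin_def by (intro sum.cong) (auto simp: assms(2) orb_image[OF assms(1)])
  finally show "proj c' w = proj c w" .
qed

text \<open>Lifts are unique up to the group: an element aligning the top simplex of one chain with
  its partner in the other aligns all members, because faces of a simplex are determined by their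
  orbits. The conclusion says that \<open>c'\<close> is the translate of \<open>c\<close>.\<close>

lemma proj_fibre:
  assumes c: "c \<in> fan (chains S)" and c': "c' \<in> fan (chains S)" and eq: "proj c = proj c'"
  shows "\<exists>g\<in>G. \<forall>\<sigma>\<in>S. c' (g ` \<sigma>) = c \<sigma>"
proof -
  have D: "supp c \<in> chains S" and D': "supp c' \<in> chains S" using c c' fanD(2) by blast+
  have img: "orb ` supp c = orb ` supp c'" using supp_proj[OF c] supp_proj[OF c'] eq by simp
  show ?thesis
  proof (cases "supp c = {}")
    case True
    then have "supp c' = {}" using img by (metis image_is_empty)
    then show ?thesis using True id_in by (intro bexI[of _ id]) auto
  next
    case False
    have "finite (supp c)" "\<forall>\<sigma>\<in>supp c. \<forall>\<tau>\<in>supp c. \<sigma> \<subseteq> \<tau> \<or> \<tau> \<subseteq> \<sigma>"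
      using D unfolding chains_def by simp_all
    then obtain \<beta> where \<beta>: "\<beta> \<in> supp c" "\<forall>\<sigma>\<in>supp c. \<sigma> \<subseteq> \<beta>"
      using chain_has_top[OF _ False] by blast
    have "orb \<beta> \<in> orb ` supp c'" using \<beta>(1) img by blast
    then obtain \<beta>' where \<beta>': "\<beta>' \<in> supp c'" "orb \<beta> = orb \<beta>'" by blast
    obtain g where g: "g \<in> G" "\<beta>' = g ` \<beta>" using \<beta>'(2) orb_eq_iff by blast
    have \<beta>'K: "\<beta>' \<in> K" using \<beta>'(1) D' by (auto simp: chains_def)
    have into: "g ` \<sigma> \<in> supp c'" if \<sigma>: "\<sigma> \<in> supp c" for \<sigma>
    proof -
      have "orb \<sigma> \<in> orb ` supp c'" using \<sigma> img by blast
      then obtain \<tau> where \<tau>: "\<tau> \<in> supp c'" "orb \<sigma> = orb \<tau>" by blast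
      have \<tau>K: "\<tau> \<in> K" using \<tau>(1) D' by (auto simp: chains_def)
      have sub: "g ` \<sigma> \<subseteq> \<beta>'" using \<beta>(2) \<sigma> g(2) by blast
      have o: "orb (g ` \<sigma>) = orb \<tau>" using \<tau>(2) orb_image[OF g(1)] by simp
      \<comment> \<open>It is not yet known that \<beta>' is the top of its chain, so both
        inclusions are treated.\<close>
      have "\<tau> \<subseteq> \<beta>' \<or> \<beta>' \<subseteq> \<tau>" using \<tau>(1) \<beta>'(1) D' unfolding chains_def by blast
      then have "g ` \<sigma> = \<tau>"
      proof
        assume "\<tau> \<subseteq> \<beta>'"
        then show ?thesis by (rule orb_inj_below[OF \<beta>'K sub _ o])
      next
        assume "\<beta>' \<subseteq> \<tau>"
        then have "g ` \<sigma> \<subseteq> \<tau>" using sub by blast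
        then show ?thesis by (rule orb_inj_below[OF \<tau>K _ order_refl o])
      qed
      then show ?thesis using \<tau>(1) by simp
    qed
    have "c' (g ` \<sigma>) = c \<sigma>" if "\<sigma> \<in> S" for \<sigma>
    proof (cases "\<sigma> \<in> supp c")
      case True
      have "c' (g ` \<sigma>) = proj c' (orb (g ` \<sigma>))" using proj_orb[OF c' into[OF True]] by simp
      also have "\<dots> = c \<sigma>" using proj_orb[OF c True] eq orb_image[OF g(1)] by simp
      finally show ?thesis .
    next
      case False
      have "g ` \<sigma> \<notin> supp c'"
      proof
        assume gs: "g ` \<sigma> \<in> supp c'"
        then have "orb (g ` \<sigma>) \<in> orb ` supp c" using img by blast
        then obtain \<tau> where \<tau>: "\<tau> \<in> supp c" "orb \<sigma> = orb \<tau>" using orb_image[OF g(1)] by auto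
        have "orb (g ` \<sigma>) = orb (g ` \<tau>)" using \<tau>(2) orb_image[OF g(1)] by simp
        then have "g ` \<sigma> = g ` \<tau>" using inj_onD[OF inj_orb_chain[OF D'] _ gs into[OF \<tau>(1)]] by simp
        then have "\<sigma> = \<tau>" using inj_image_eq_iff[OF inj_G[OF g(1)]] by blast
        then show False using False \<tau>(1) by simp
      qed
      then show ?thesis using False by simp
    qed
    then show ?thesis using g(1) by blast
  qed
qed

end

section \<open>The join of polygons and its rotations\<close>

text \<open>The vertices of the polygons indexed by all integers, with period \<open>2 p\<close>.\<close>

definition wz :: "nat \<Rightarrow> nat \<Rightarrow> int \<Rightarrow> (nat \<Rightarrow> complex)" where
  "wz p j z = (\<lambda>i. if i = j then cis (of_int z * pi / real p) else 0)"

definition rot :: "nat \<Rightarrow> (nat \<Rightarrow> int) \<Rightarrow> int \<Rightarrow> (nat \<Rightarrow> complex) \<Rightarrow> (nat \<Rightarrow> complex)" where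
  "rot p q k v = (\<lambda>i. cis (2 * pi * of_int (k * coef q i) / real p) * v i)"

lemma cis_eq_cis_iff: "cis a = cis b \<longleftrightarrow> (\<exists>n::int. a = b + 2 * pi * n)"
  using sin_cos_eq_iff[of a b] by (auto simp: complex_eq_iff)

lemma wz_eq_iff:
  assumes "p \<ge> 1"
  shows "wz p i y = wz p j z \<longleftrightarrow> i = j \<and> (2 * int p) dvd (y - z)"
proof
  assume eq: "wz p i y = wz p j z"
  then have "wz p i y i = wz p j z i" by simp
  then have ij: "i = j" and c: "cis (of_int y * pi / real p) = cis (of_int z * pi / real p)"
    by (auto simp: wz_def split: if_splits)
  from c obtain n :: int where n: "of_int y * pi / real p = of_int z * pi / real p + 2 * pi * n"
    unfolding cis_eq_cis_iff by blast
  then have "of_int y * pi = (of_int z + 2 * real p * n) * pi"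
    using assms by (simp add: field_simps)
  then have "of_int y = of_int z + 2 * real p * n" by simp
  then have "real_of_int y = real_of_int (z + 2 * int p * n)" by simp
  then have "y - z = 2 * int p * n" by linarith
  then show "i = j \<and> (2 * int p) dvd (y - z)" using ij by simp
next
  assume *: "i = j \<and> (2 * int p) dvd (y - z)"
  then obtain n where "y = z + 2 * int p * n" by (metis dvdE diff_add_cancel add.commute)
  then have "of_int y * pi / real p = of_int z * pi / real p + 2 * pi * of_int n"
    using assms by (simp add: field_simps)
  then show "wz p i y = wz p j z" using * cis_eq_cis_iff by (auto simp: wz_def)
qed

lemma wv_eq_wz: "wv p j l = wz p j (int l)"
  by (intro ext) (simp add: wv_def wz_def)

lemma wz_shift:
  assumes "p \<ge> 1" "wz p j y = wz p j z"
  shows "wz p j (y + a) = wz p j (z + a)"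
  using assms(2) unfolding wz_eq_iff[OF assms(1)] by simp

lemma wz_mod:
  assumes "p \<ge> 1"
  shows "wz p j z = wv p j (nat (z mod (2 * int p)))" "nat (z mod (2 * int p)) < 2 * p"
proof -
  have "0 \<le> z mod (2 * int p)" "z mod (2 * int p) < 2 * int p" using assms by simp_all
  then show "nat (z mod (2 * int p)) < 2 * p" by linarith
  have "(2 * int p) dvd (z - z mod (2 * int p))" by simp
  then show "wz p j z = wv p j (nat (z mod (2 * int p)))"
    unfolding wv_eq_wz wz_eq_iff[OF assms] using \<open>0 \<le> z mod (2 * int p)\<close> by simp
qed

lemma Wset_eq:
  assumes "p \<ge> 1"
  shows "Wset p j = range (wz p j)"
proof
  show "Wset p j \<subseteq> range (wz p j)" by (auto simp: Wset_def wv_eq_wz)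
  show "range (wz p j) \<subseteq> Wset p j" unfolding Wset_def using wz_mod[OF assms] by blast
qed

lemma finite_Wset: "finite (Wset p j)"
proof -
  have "Wset p j = wv p j ` {..<2 * p}" by (auto simp: Wset_def)
  then show ?thesis by simp
qed

text \<open>The period \<open>2 * p\<close> is even, so the parity of an index is an invariant of
  the vertex. It separates the classes \<open>U_j\<close> and \<open>V_j\<close>.\<close>

lemma wz_parity:
  assumes "p \<ge> 1" "wz p j y = wz p j z"
  shows "even y \<longleftrightarrow> even z"
proof -
  have "(2 * int p) dvd (y - z)" using assms wz_eq_iff by blast
  then have "even (y - z)" by (meson dvd_mult_left)
  then show ?thesis by simp
qed

lemma Uset_eq:
  assumes "p \<ge> 1"
  shows "Uset p j = wz p j ` {z. even z}"
proof
  show "Uset p j \<subseteq> wz p j ` {z. even z}" by (auto simp: Uset_def wv_eq_wz)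
  show "wz p j ` {z. even z} \<subseteq> Uset p j"
  proof clarify
    fix z :: int assume "even z"
    let ?l = "nat (z mod (2 * int p))"
    have "even (int ?l)"
      using wz_parity[OF assms, of j "int ?l" z] wz_mod(1)[OF assms, of j z] \<open>even z\<close>
      unfolding wv_eq_wz by simp
    then have "even ?l" by (simp only: even_of_nat_iff)
    then obtain k where "?l = 2 * k" by blast
    then have "k < p" "wz p j z = wv p j (2 * k)" using wz_mod(2)[OF assms, of z] wz_mod(1)[OF assms, of j z] by simp_all
    then show "wz p j z \<in> Uset p j" unfolding Uset_def by blast
  qed
qed

lemma Vset_eq:
  assumes "p \<ge> 1"
  shows "Vset p j = wz p j ` {z. odd z}"
  unfolding Vset_def Wset_eq[OF assms] Uset_eq[OF assms]
proof
  show "range (wz p j) - wz p j ` {z. even z} \<subseteq> wz p j ` {z. odd z}" by blast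
  show "wz p j ` {z. odd z} \<subseteq> range (wz p j) - wz p j ` {z. even z}"
    using wz_parity[OF assms] by blast
qed

section \<open>The cycles as polygons and their links\<close>

lemma cycle_cx_polygon: "cycle_cx p j = (`) (wv p j) ` polygon (2 * p)"
proof -
  have W: "{{w} | w. w \<in> Wset p j} = (`) (wv p j) ` {{i} | i. i < 2 * p}"
  proof (intro equalityI subsetI)
    fix X assume "X \<in> {{w} | w. w \<in> Wset p j}"
    then obtain l where "X = wv p j ` {l}" "l < 2 * p" by (auto simp: Wset_def)
    then show "X \<in> (`) (wv p j) ` {{i} | i. i < 2 * p}" by blast
  next
    fix X assume "X \<in> (`) (wv p j) ` {{i} | i. i < 2 * p}"
    then obtain l where "X = {wv p j l}" "l < 2 * p" by auto
    then show "X \<in> {{w} | w. w \<in> Wset p j}" unfolding Wset_def by blast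
  qed
  have E: "{{wv p j l, wv p j ((l + 1) mod (2 * p))} | l. l < 2 * p} =
      (`) (wv p j) ` {{i, (i + 1) mod (2 * p)} | i. i < 2 * p}"
  proof (intro equalityI subsetI)
    fix X assume "X \<in> {{wv p j l, wv p j ((l + 1) mod (2 * p))} | l. l < 2 * p}"
    then obtain l where "X = wv p j ` {l, (l + 1) mod (2 * p)}" "l < 2 * p" by auto
    then show "X \<in> (`) (wv p j) ` {{i, (i + 1) mod (2 * p)} | i. i < 2 * p}" by blast
  next
    fix X assume "X \<in> (`) (wv p j) ` {{i, (i + 1) mod (2 * p)} | i. i < 2 * p}"
    then obtain l where "X = {wv p j l, wv p j ((l + 1) mod (2 * p))}" "l < 2 * p" by auto
    then show "X \<in> {{wv p j l, wv p j ((l + 1) mod (2 * p))} | l. l < 2 * p}" by blast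
  qed
  show ?thesis unfolding cycle_cx_def polygon_def W E image_Un by simp
qed

lemma inj_on_wv:
  assumes "p \<ge> 1"
  shows "inj_on (wv p j) {..<2 * p}"
proof (rule inj_onI)
  fix l m assume lm: "l \<in> {..<2 * p}" "m \<in> {..<2 * p}" "wv p j l = wv p j m"
  then have "(2 * int p) dvd (int l - int m)" unfolding wv_eq_wz wz_eq_iff[OF assms] by simp
  moreover have "\<bar>int l - int m\<bar> < 2 * int p" using lm(1,2) by auto
  ultimately have "int l - int m = 0" by (meson dvd_imp_le_int not_le zdvd_not_zless dvd_abs_iff abs_of_nonneg zero_less_abs_iff)
  then show "l = m" by simp
qed

text \<open>With integer indices the closing edge is no exception, and rotations will act on this
  description by shifts.\<close>

lemma cycle_cx_cases:
  assumes "p \<ge> 1"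
  shows "\<alpha> \<in> cycle_cx p j \<longleftrightarrow>
    \<alpha> = {} \<or> (\<exists>z. \<alpha> = {wz p j z}) \<or> (\<exists>z. \<alpha> = {wz p j z, wz p j (z + 1)})"
proof
  assume "\<alpha> \<in> cycle_cx p j"
  then consider "\<alpha> = {}" | w where "w \<in> Wset p j" "\<alpha> = {w}"
    | l where "l < 2 * p" "\<alpha> = {wv p j l, wv p j ((l + 1) mod (2 * p))}"
    unfolding cycle_cx_def by blast
  then show "\<alpha> = {} \<or> (\<exists>z. \<alpha> = {wz p j z}) \<or> (\<exists>z. \<alpha> = {wz p j z, wz p j (z + 1)})"
  proof cases
    case 2
    then show ?thesis unfolding Wset_eq[OF assms] by blast
  next
    case 3
    have "wv p j ((l + 1) mod (2 * p)) = wz p j (int l + 1)"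
      unfolding wv_eq_wz wz_eq_iff[OF assms] by (simp add: zmod_int mod_eq_dvd_iff[symmetric] add.commute)
    then show ?thesis using 3 wv_eq_wz by metis
  qed simp
next
  assume "\<alpha> = {} \<or> (\<exists>z. \<alpha> = {wz p j z}) \<or> (\<exists>z. \<alpha> = {wz p j z, wz p j (z + 1)})"
  then consider "\<alpha> = {}" | z where "\<alpha> = {wz p j z}" | z where "\<alpha> = {wz p j z, wz p j (z + 1)}"
    by blast
  then show "\<alpha> \<in> cycle_cx p j"
  proof cases
    case 2
    then show ?thesis unfolding cycle_cx_def Wset_eq[OF assms] by blast
  next
    case 3
    let ?l = "nat (z mod (2 * int p))"
    have l: "?l < 2 * p" "wz p j z = wv p j ?l" using wz_mod[OF assms] by blast+
    have "wz p j (z + 1) = wz p j (int ?l + 1)"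
      using wz_shift[OF assms] l(2) unfolding wv_eq_wz by blast
    also have "\<dots> = wv p j ((?l + 1) mod (2 * p))"
      unfolding wv_eq_wz wz_eq_iff[OF assms] by (simp add: zmod_int mod_eq_dvd_iff[symmetric] add.commute)
    finally have "\<alpha> = {wv p j ?l, wv p j ((?l + 1) mod (2 * p))}" using 3 l(2) by simp
    then show ?thesis unfolding cycle_cx_def using l(1) by blast
  qed (simp add: cycle_cx_def)
qed

lemma simplicial_complex_cycle_cx: "simplicial_complex (cycle_cx p j)"
  unfolding cycle_cx_polygon by (intro simplicial_complex_image simplicial_complex_polygon)

lemma Union_cycle_cx: "\<Union>(cycle_cx p j) = Wset p j"
proof -
  have "\<Union>(cycle_cx p j) = wv p j ` \<Union>(polygon (2 * p))" unfolding cycle_cx_polygon by blast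
  then show ?thesis unfolding Union_polygon Wset_def by auto
qed

lemma Wset_disjoint:
  assumes "p \<ge> 1" "i \<noteq> j"
  shows "Wset p i \<inter> Wset p j = {}"
  unfolding Wset_eq[OF assms(1)] using wz_eq_iff[OF assms(1)] assms(2) by auto

text \<open>Here p \<ge> 2 matters: the period is at least 4, so the two neighbours of a vertex are
  distinct.\<close>

lemma wz_succ_neq:
  assumes "p \<ge> 2"
  shows "wz p j (z + 1) \<noteq> wz p j z" "wz p j (z + 1) \<noteq> wz p j (z - 1)"
proof -
  have "\<not> (2 * int p) dvd 1" "\<not> (2 * int p) dvd 2"
    using assms by (auto dest!: zdvd_imp_le)
  then show "wz p j (z + 1) \<noteq> wz p j z" "wz p j (z + 1) \<noteq> wz p j (z - 1)"
    using assms by (simp_all add: wz_eq_iff)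
qed

lemma card_cycle_cx:
  assumes "\<alpha> \<in> cycle_cx p j"
  shows "card \<alpha> \<le> 2"
  using assms unfolding cycle_cx_def by (auto simp: card_insert_if)

text \<open>The links are the polygon itself, a pair of neighbours and \<open>{{}}\<close>, of
  indices 2, 1 and 0. Counting vertices keeps larger simplices out of them.\<close>

lemma link_cycle_cx:
  assumes p: "p \<ge> 2" and \<alpha>: "\<alpha> \<in> cycle_cx p j"
  shows "\<exists>e. card \<alpha> + e = 2 \<and> linear_sphere e (link (cycle_cx p j) \<alpha>)"
proof -
  have p1: "p \<ge> 1" using p by simp
  let ?C = "cycle_cx p j"
  have fin: "finite \<tau>" if "\<tau> \<in> ?C" for \<tau> using simplicial_complexD(3)[OF simplicial_complex_cycle_cx that] .
  have card_link: "card \<tau> + card \<alpha> \<le> 2" if "\<tau> \<in> link ?C \<alpha>" for \<tau>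
  proof -
    have "card (\<tau> \<union> \<alpha>) = card \<tau> + card \<alpha>"
      using that fin[of \<tau>] fin[OF \<alpha>] by (intro card_Un_disjoint) (auto simp: link_def)
    then show ?thesis using that card_cycle_cx[of "\<tau> \<union> \<alpha>" p j] by (simp add: link_def)
  qed
  have empty: "{} \<in> link ?C \<alpha>"
    using simplicial_complexD(2)[OF simplicial_complex_cycle_cx] \<alpha> by (simp add: link_def)
  consider "\<alpha> = {}" | z where "\<alpha> = {wz p j z}" | z where "\<alpha> = {wz p j z, wz p j (z + 1)}"
    using \<alpha> unfolding cycle_cx_cases[OF p1] by blast
  then show ?thesis
  proof cases
    case 1
    have "link ?C {} = ?C" by (simp add: link_def)
    moreover have "linear_sphere 2 ?C"
      unfolding cycle_cx_polygon
      by (rule linear_sphere_image[OF linear_sphere_polygon]) (use inj_on_wv[OF p1] p in \<open>simp_all add: Union_polygon\<close>)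
    ultimately show ?thesis using 1 by simp
  next
    case 2
    let ?A = "{wz p j (z + 1), wz p j (z - 1)}"
    have "link ?C \<alpha> = bdry ?A"
    proof (intro equalityI subsetI)
      fix \<tau> assume \<tau>: "\<tau> \<in> link ?C \<alpha>"
      have "card \<tau> \<le> 1" using card_link[OF \<tau>] 2 by simp
      moreover have "finite \<tau>" using \<tau> fin by (simp add: link_def)
      ultimately consider "\<tau> = {}" | w where "\<tau> = {w}"
        by (metis card_0_eq card_1_singletonE le_less less_one)
      then show "\<tau> \<in> bdry ?A"
      proof cases
        case 1
        then show ?thesis by (simp add: bdry_def psubset_eq)
      next
        case w: 2
        have "{w, wz p j z} \<in> ?C" "w \<noteq> wz p j z" using \<tau> w 2 by (auto simp: link_def insert_commute)
        then obtain y where y: "{w, wz p j z} = {wz p j y, wz p j (y + 1)}"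
          unfolding cycle_cx_cases[OF p1] by (auto simp: doubleton_eq_iff)
        have "w \<in> ?A"
        proof (cases "wz p j z = wz p j y")
          case True
          then have "w = wz p j (y + 1)" using y \<open>w \<noteq> wz p j z\<close> by (auto simp: doubleton_eq_iff)
          then show ?thesis using wz_shift[OF p1 True, of 1] by simp
        next
          case False
          then have "w = wz p j y" "wz p j z = wz p j (y + 1)" using y by (auto simp: doubleton_eq_iff)
          then show ?thesis using wz_shift[OF p1, of j z "y + 1" "-1"] by simp
        qed
        then have "\<tau> \<subseteq> ?A" "\<not> ?A \<subseteq> \<tau>" using w wz_succ_neq(2)[OF p, of j z] by auto
        then show ?thesis by (simp add: bdry_def less_le_not_le)
      qed
    next
      fix \<tau> assume "\<tau> \<in> bdry ?A"
      then have "\<tau> \<subset> ?A" by (simp add: bdry_def)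
      then consider "\<tau> = {}" | "\<tau> = {wz p j (z + 1)}" | "\<tau> = {wz p j (z - 1)}" by blast
      then show "\<tau> \<in> link ?C \<alpha>"
      proof cases
        case 1
        then show ?thesis using empty by simp
      next
        case t: 2
        have "\<tau> \<in> ?C" unfolding t cycle_cx_cases[OF p1] by blast
        moreover have "\<tau> \<union> \<alpha> \<in> ?C" unfolding t 2 cycle_cx_cases[OF p1] by blast
        moreover have "\<tau> \<inter> \<alpha> = {}" unfolding t 2 using wz_succ_neq(1)[OF p, of j z] by simp
        ultimately show ?thesis by (simp add: link_def)
      next
        case t: 3
        have "\<tau> \<in> ?C" unfolding t cycle_cx_cases[OF p1] by blast
        moreover have "\<tau> \<union> \<alpha> = {wz p j (z - 1), wz p j (z - 1 + 1)}" unfolding t 2 by auto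
        then have "\<tau> \<union> \<alpha> \<in> ?C" unfolding cycle_cx_cases[OF p1] by blast
        moreover have "\<tau> \<inter> \<alpha> = {}" unfolding t 2 using wz_succ_neq(1)[OF p, of j "z - 1"] by simp
        ultimately show ?thesis by (simp add: link_def)
      qed
    qed
    moreover have "linear_sphere 1 (bdry ?A)"
      using wz_succ_neq(2)[OF p] by (intro linear_sphere_bdry) auto
    ultimately show ?thesis using 2 by (intro exI[of _ 1]) simp
  next
    case 3
    have c: "card \<alpha> = 2" using 3 wz_succ_neq(1)[OF p, of j z] by simp
    have "link ?C \<alpha> = {{}}"
    proof (intro equalityI subsetI)
      fix \<tau> assume \<tau>: "\<tau> \<in> link ?C \<alpha>"
      then have "card \<tau> = 0" "finite \<tau>" using card_link[OF \<tau>] c fin by (auto simp: link_def)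
      then show "\<tau> \<in> {{}}" by simp
    qed (use empty in simp)
    moreover have "bdry {wz p j z} = {{}}" by (auto simp: bdry_def)
    moreover have "linear_sphere 0 (bdry {wz p j z})" by (intro linear_sphere_bdry) auto
    ultimately show ?thesis using c by (intro exI[of _ 0]) simp
  qed
qed

section \<open>Links in the iterated join\<close>

lemma link_join:
  assumes disj: "\<Union>K \<inter> \<Union>L = {}" and "\<sigma> \<in> K" "\<tau> \<in> L"
  shows "link (join K L) (\<sigma> \<union> \<tau>) = join (link K \<sigma>) (link L \<tau>)"
proof (intro equalityI subsetI)
  fix \<rho> assume \<rho>: "\<rho> \<in> link (join K L) (\<sigma> \<union> \<tau>)"
  then obtain a b c d where *: "\<rho> = a \<union> b" "a \<in> K" "b \<in> L" "\<rho> \<union> (\<sigma> \<union> \<tau>) = c \<union> d" "c \<in> K" "d \<in> L"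
    and dis: "\<rho> \<inter> (\<sigma> \<union> \<tau>) = {}"
    by (auto simp: link_def join_def)
  have sub: "a \<subseteq> \<Union>K" "\<sigma> \<subseteq> \<Union>K" "c \<subseteq> \<Union>K" "b \<subseteq> \<Union>L" "\<tau> \<subseteq> \<Union>L" "d \<subseteq> \<Union>L"
    using * assms by auto
  have "a \<union> \<sigma> = c" "b \<union> \<tau> = d" using sub disj *(1,4) by blast+
  then have "a \<in> link K \<sigma>" "b \<in> link L \<tau>" using * dis by (auto simp: link_def)
  then show "\<rho> \<in> join (link K \<sigma>) (link L \<tau>)" using *(1) unfolding join_def by blast
next
  fix \<rho> assume "\<rho> \<in> join (link K \<sigma>) (link L \<tau>)"
  then obtain a b where *: "\<rho> = a \<union> b" "a \<in> K" "b \<in> L" "a \<inter> \<sigma> = {}" "b \<inter> \<tau> = {}"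
    "a \<union> \<sigma> \<in> K" "b \<union> \<tau> \<in> L"
    by (auto simp: link_def join_def)
  have "a \<inter> \<tau> = {}" "b \<inter> \<sigma> = {}" using disj *(2,3) assms by blast+
  then have "\<rho> \<inter> (\<sigma> \<union> \<tau>) = {}" using * by blast
  moreover have "\<rho> \<union> (\<sigma> \<union> \<tau>) = (a \<union> \<sigma>) \<union> (b \<union> \<tau>)" using *(1) by blast
  then have "\<rho> \<union> (\<sigma> \<union> \<tau>) \<in> join K L" unfolding join_def using *(6,7) by blast
  moreover have "\<rho> \<in> join K L" unfolding join_def using *(1-3) by blast
  ultimately show "\<rho> \<in> link (join K L) (\<sigma> \<union> \<tau>)" by (simp add: link_def)
qed

lemma Sigma_cx_0: "Sigma_cx 0 p = cycle_cx p 0"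
  unfolding Sigma_cx_def by auto

lemma Sigma_cx_Suc: "Sigma_cx (Suc n) p = join (Sigma_cx n p) (cycle_cx p (Suc n))"
proof (intro equalityI subsetI)
  fix \<sigma> assume "\<sigma> \<in> Sigma_cx (Suc n) p"
  then obtain \<alpha> where \<alpha>: "\<sigma> = (\<Union>j\<in>{0..Suc n}. \<alpha> j)" "\<forall>j\<in>{0..Suc n}. \<alpha> j \<in> cycle_cx p j"
    unfolding Sigma_cx_def by blast
  then have "\<sigma> = (\<Union>j\<in>{0..n}. \<alpha> j) \<union> \<alpha> (Suc n)" by (auto simp: atLeast0_atMost_Suc)
  moreover have "(\<Union>j\<in>{0..n}. \<alpha> j) \<in> Sigma_cx n p" unfolding Sigma_cx_def using \<alpha>(2) by auto
  moreover have "\<alpha> (Suc n) \<in> cycle_cx p (Suc n)" using \<alpha>(2) by simp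
  ultimately show "\<sigma> \<in> join (Sigma_cx n p) (cycle_cx p (Suc n))" unfolding join_def by blast
next
  fix \<sigma> assume "\<sigma> \<in> join (Sigma_cx n p) (cycle_cx p (Suc n))"
  then obtain \<alpha> \<beta> where *: "\<sigma> = (\<Union>j\<in>{0..n}. \<alpha> j) \<union> \<beta>" "\<forall>j\<in>{0..n}. \<alpha> j \<in> cycle_cx p j" "\<beta> \<in> cycle_cx p (Suc n)"
    unfolding Sigma_cx_def join_def by blast
  let ?\<gamma> = "\<alpha>(Suc n := \<beta>)"
  have "\<sigma> = (\<Union>j\<in>{0..Suc n}. ?\<gamma> j)" using *(1) by (auto simp: atLeast0_atMost_Suc)
  moreover have "\<forall>j\<in>{0..Suc n}. ?\<gamma> j \<in> cycle_cx p j" using * by auto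
  ultimately show "\<sigma> \<in> Sigma_cx (Suc n) p" unfolding Sigma_cx_def by blast
qed

lemma simplicial_complex_Sigma_cx: "simplicial_complex (Sigma_cx n p)"
  by (induction n) (simp_all add: Sigma_cx_0 Sigma_cx_Suc simplicial_complex_cycle_cx simplicial_complex_join)

lemma Union_Sigma_cx: "\<Union>(Sigma_cx n p) = (\<Union>j\<le>n. Wset p j)"
proof (induction n)
  case 0
  then show ?case by (simp add: Sigma_cx_0 Union_cycle_cx)
next
  case (Suc n)
  then show ?case
    unfolding Sigma_cx_Suc Union_join[OF simplicial_complex_Sigma_cx simplicial_complex_cycle_cx]
    by (auto simp: Union_cycle_cx atMost_Suc)
qed

lemma Sigma_cx_disjoint:
  assumes "p \<ge> 1"
  shows "\<Union>(Sigma_cx n p) \<inter> \<Union>(cycle_cx p (Suc n)) = {}"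
proof -
  have "Wset p j \<inter> Wset p (Suc n) = {}" if "j \<le> n" for j
    using that by (intro Wset_disjoint[OF assms]) simp
  then show ?thesis unfolding Union_Sigma_cx Union_cycle_cx by blast
qed

text \<open>Cardinalities and indices both add over the join, and each polygon contributes
  2.\<close>

lemma link_Sigma_cx:
  assumes p: "p \<ge> 2" and "\<alpha> \<in> Sigma_cx n p"
  shows "\<exists>e. card \<alpha> + e = 2 * n + 2 \<and> linear_sphere e (link (Sigma_cx n p) \<alpha>)"
  using assms(2)
proof (induction n arbitrary: \<alpha>)
  case 0
  then show ?case using link_cycle_cx[OF p] unfolding Sigma_cx_0 mult_0_right add_0 by blast
next
  case (Suc n)
  let ?K = "Sigma_cx n p" and ?L = "cycle_cx p (Suc n)"
  obtain \<sigma> \<tau> where st: "\<alpha> = \<sigma> \<union> \<tau>" "\<sigma> \<in> ?K" "\<tau> \<in> ?L"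
    using Suc.prems unfolding Sigma_cx_Suc join_def by blast
  obtain d where d: "card \<sigma> + d = 2 * n + 2" "linear_sphere d (link ?K \<sigma>)"
    using Suc.IH[OF st(2)] by blast
  obtain e where e: "card \<tau> + e = 2" "linear_sphere e (link ?L \<tau>)"
    using link_cycle_cx[OF p st(3)] by blast
  have disj: "\<Union>?K \<inter> \<Union>?L = {}" using Sigma_cx_disjoint p by simp
  have fin: "finite \<sigma>" "finite \<tau>"
    using st simplicial_complexD(3)[OF simplicial_complex_Sigma_cx] simplicial_complexD(3)[OF simplicial_complex_cycle_cx]
    by blast+
  have "\<sigma> \<inter> \<tau> = {}" using disj st by blast
  then have "card \<alpha> + (d + e) = 2 * Suc n + 2"
    using card_Un_disjoint[OF fin] st(1) d(1) e(1) by simp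
  moreover have "\<Union>(link ?K \<sigma>) \<inter> \<Union>(link ?L \<tau>) = {}" using disj by (auto simp: link_def)
  then have "linear_sphere (d + e) (link (Sigma_cx (Suc n) p) \<alpha>)"
    unfolding Sigma_cx_Suc st(1) link_join[OF disj st(2,3)] by (rule linear_sphere_join[OF d(2) e(2)])
  ultimately show ?case by blast
qed

text \<open>The complementary index in the preceding result is a natural number.\<close>

lemma card_Sigma_cx_le:
  assumes "p \<ge> 2" "\<alpha> \<in> Sigma_cx n p"
  shows "card \<alpha> \<le> 2 * n + 2"
  using link_Sigma_cx[OF assms] by auto

lemma Sigma_cx_facet:
  assumes p: "p \<ge> 2"
  shows "\<exists>\<alpha>\<in>Sigma_cx n p. card \<alpha> = 2 * n + 2"
proof (induction n)
  case 0
  have "{wz p 0 0, wz p 0 (0 + 1)} \<in> cycle_cx p 0" using p cycle_cx_cases[of p] by auto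
  moreover have "card {wz p 0 0, wz p 0 (0 + 1)} = 2" using wz_succ_neq(1)[OF p, of 0 0] by simp
  ultimately show ?case unfolding Sigma_cx_0 by (metis mult_0_right add_0)
next
  case (Suc n)
  then obtain \<alpha> where \<alpha>: "\<alpha> \<in> Sigma_cx n p" "card \<alpha> = 2 * n + 2" by blast
  let ?\<beta> = "{wz p (Suc n) 0, wz p (Suc n) (0 + 1)}"
  have \<beta>: "?\<beta> \<in> cycle_cx p (Suc n)" using p cycle_cx_cases[of p] by auto
  have disj: "\<Union>(Sigma_cx n p) \<inter> \<Union>(cycle_cx p (Suc n)) = {}" using p by (intro Sigma_cx_disjoint) simp
  have "\<alpha> \<inter> ?\<beta> = {}" using disj \<alpha>(1) \<beta> by blast
  moreover have "card ?\<beta> = 2" using wz_succ_neq(1)[OF p, of "Suc n" 0] by simp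
  moreover have "finite \<alpha>" using simplicial_complexD(3)[OF simplicial_complex_Sigma_cx \<alpha>(1)] .
  ultimately have "card (\<alpha> \<union> ?\<beta>) = 2 * Suc n + 2"
    using card_Un_disjoint[of \<alpha> ?\<beta>] \<alpha>(2) by simp
  then show ?case using \<alpha>(1) \<beta> unfolding Sigma_cx_Suc join_def by blast
qed

section \<open>The rotation group and its action\<close>

lemma rot_0: "rot p q 0 = id"
  by (auto simp: rot_def)

lemma rot_add: "rot p q (a + b) = rot p q a \<circ> rot p q b"
proof (intro ext)
  fix v i
  have "2 * pi * of_int ((a + b) * coef q i) / real p =
      2 * pi * of_int (a * coef q i) / real p + 2 * pi * of_int (b * coef q i) / real p"
    by (simp add: add_divide_distrib[symmetric] distrib_left distrib_right)
  then show "rot p q (a + b) v i = (rot p q a \<circ> rot p q b) v i"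
    by (simp add: rot_def cis_mult[symmetric])
qed

lemma rho_v_eq_rot: "rho_v p q = rot p q 1"
  by (auto simp: rho_v_def rot_def)

lemma lens_h_eq_rho_v: "lens_h p q = rho_v p q"
  by (auto simp: lens_h_def rho_v_def)

text \<open>Integer exponents merge the nonnegative powers of the generator and of its inverse into
  one range, and turn composition into addition.\<close>

lemma cyclic_gen_rho_v: "cyclic_gen (rho_v p q) = range (rot p q)"
proof -
  have pos: "rot p q 1 ^^ k = rot p q (int k)" for k
    by (induction k) (simp_all add: rot_0 rot_add[symmetric] add.commute)
  have "inv (rot p q 1) = rot p q (-1)"
    by (rule inv_unique_comp) (simp_all add: rot_0 rot_add[symmetric])
  moreover have neg: "rot p q (-1) ^^ k = rot p q (- int k)" for k
    by (induction k) (simp_all add: rot_0 rot_add[symmetric])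
  ultimately have "cyclic_gen (rho_v p q) = range (\<lambda>k::nat. rot p q (int k)) \<union> range (\<lambda>k::nat. rot p q (- int k))"
    unfolding cyclic_gen_def rho_v_eq_rot by (simp add: pos)
  moreover have "rot p q k \<in> range (\<lambda>k::nat. rot p q (int k)) \<union> range (\<lambda>k::nat. rot p q (- int k))" for k
    by (cases k rule: int_cases2) auto
  ultimately show ?thesis by auto
qed

text \<open>The index moves by an even amount, which is why rotations preserve each class
  \<open>U_j\<close> and \<open>V_j\<close>.\<close>

lemma rot_wz:
  assumes "p \<ge> 1"
  shows "rot p q k (wz p j z) = wz p j (z + 2 * k * coef q j)"
proof
  fix i
  have "2 * pi * of_int (k * coef q j) / real p + of_int z * pi / real p =
      of_int (z + 2 * k * coef q j) * pi / real p"
    unfolding add_divide_distrib[symmetric] by (simp add: algebra_simps)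
  then show "rot p q k (wz p j z) i = wz p j (z + 2 * k * coef q j) i"
    by (simp add: rot_def wz_def cis_mult)
qed

text \<open>Numbers the classes \<open>U_0\<close>, \<open>V_0\<close>, \<open>U_1\<close>,
  \<open>V_1\<close> and so on consecutively. A vertex has a single nonzero coordinate, which the
  description operator reads off.\<close>

definition colour_of :: "nat \<Rightarrow> (nat \<Rightarrow> complex) \<Rightarrow> nat" where
  "colour_of p v = (let j = (THE j. v j \<noteq> 0) in 2 * j + (if v \<in> Uset p j then 0 else 1))"

lemma colour_of_wz:
  assumes "p \<ge> 1"
  shows "colour_of p (wz p j z) = 2 * j + (if even z then 0 else 1)"
proof -
  have "(THE i. wz p j z i \<noteq> 0) = j" by (rule the_equality) (auto simp: wz_def split: if_splits)
  moreover have "wz p j z \<in> Uset p j \<longleftrightarrow> even z"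
    unfolding Uset_eq[OF assms] using wz_parity[OF assms] by blast
  ultimately show ?thesis by (simp add: colour_of_def Let_def)
qed

lemma coef_coprime:
  assumes "\<forall>j\<in>{1..n}. coprime (q j) (int p)" "j \<le> n"
  shows "coprime (coef q j) (int p)"
  using assms by (auto simp: coef_def)

lemma Sigma_vertexE:
  assumes "p \<ge> 1" "v \<in> \<Union>(Sigma_cx n p)"
  obtains j z where "j \<le> n" "v = wz p j z"
  using assms(2) unfolding Union_Sigma_cx Wset_eq[OF assms(1)] by blast

lemma balanced_action_Sigma:
  assumes p: "p \<ge> 2" and q: "\<forall>j\<in>{1..n}. coprime (q j) (int p)"
  shows "balanced_action (Sigma_cx n p) (cyclic_gen (rho_v p q)) (colour_of p)"
proof -
  have p1: "p \<ge> 1" using p by simp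
  show ?thesis
    unfolding cyclic_gen_rho_v
  proof (unfold_locales, goal_cases)
    case 1
    show ?case by (rule simplicial_complex_Sigma_cx)
  next
    case 2
    show ?case unfolding rot_0[of p q, symmetric] by (rule rangeI)
  next
    case (3 g h)
    then obtain a b where "g = rot p q a" "h = rot p q b" by blast
    then have "g \<circ> h = rot p q (a + b)" by (simp add: rot_add)
    then show ?case by (rule range_eqI)
  next
    case (4 g)
    then obtain k where k: "g = rot p q k" by blast
    have "rot p q (- k) \<circ> g = id" unfolding k rot_add[symmetric] by (simp add: rot_0)
    then show ?case by blast
  next
    case (5 g \<sigma>)
    then obtain k where k: "g = rot p q k" by blast
    obtain \<alpha> where \<alpha>: "\<sigma> = (\<Union>j\<in>{0..n}. \<alpha> j)" "\<forall>j\<in>{0..n}. \<alpha> j \<in> cycle_cx p j"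
      using 5(2) unfolding Sigma_cx_def by blast
    have "g ` \<alpha> j \<in> cycle_cx p j" if "j \<in> {0..n}" for j
    proof -
      have "\<alpha> j \<in> cycle_cx p j" using \<alpha>(2) that by blast
      then consider "\<alpha> j = {}" | z where "\<alpha> j = {wz p j z}" | z where "\<alpha> j = {wz p j z, wz p j (z + 1)}"
        unfolding cycle_cx_cases[OF p1] by blast
      then show ?thesis
      proof cases
        case 1
        then show ?thesis using cycle_cx_cases[OF p1] by simp
      next
        case 2
        then have "g ` \<alpha> j = {wz p j (z + 2 * k * coef q j)}" by (simp add: k rot_wz[OF p1])
        then show ?thesis unfolding cycle_cx_cases[OF p1] by blast
      next
        case 3
        then have "g ` \<alpha> j = {wz p j (z + 2 * k * coef q j), wz p j (z + 2 * k * coef q j + 1)}"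
          by (simp add: k rot_wz[OF p1] add.assoc add.commute)
        then show ?thesis unfolding cycle_cx_cases[OF p1] by blast
      qed
    qed
    moreover have "g ` \<sigma> = (\<Union>j\<in>{0..n}. g ` \<alpha> j)" unfolding \<alpha>(1) by blast
    ultimately show ?case unfolding Sigma_cx_def by blast
  next
    case (6 g v)
    then obtain k where k: "g = rot p q k" by blast
    obtain j z where "v = wz p j z" using Sigma_vertexE[OF p1 6(2)] by metis
    then show ?case by (simp add: k rot_wz[OF p1] colour_of_wz[OF p1])
  next
    case (7 \<sigma>)
    obtain \<alpha> where \<alpha>: "\<sigma> = (\<Union>j\<in>{0..n}. \<alpha> j)" "\<forall>j\<in>{0..n}. \<alpha> j \<in> cycle_cx p j"
      using 7 unfolding Sigma_cx_def by blast
    have mem: "\<exists>j z. j \<in> {0..n} \<and> v \<in> \<alpha> j \<and> v = wz p j z" if "v \<in> \<sigma>" for v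
    proof -
      obtain j where j: "j \<in> {0..n}" "v \<in> \<alpha> j" using \<open>v \<in> \<sigma>\<close> \<alpha>(1) by blast
      then have "v \<in> Wset p j" using \<alpha>(2) Union_cycle_cx by blast
      then show ?thesis using j unfolding Wset_eq[OF p1] by blast
    qed
    show ?case
    proof (rule inj_onI)
      fix u v assume u: "u \<in> \<sigma>" and v: "v \<in> \<sigma>" and eq: "colour_of p u = colour_of p v"
      obtain i y where y: "i \<in> {0..n}" "u \<in> \<alpha> i" "u = wz p i y" using mem[OF u] by blast
      obtain j z where z: "j \<in> {0..n}" "v \<in> \<alpha> j" "v = wz p j z" using mem[OF v] by blast
      have "2 * i + (if even y then 0 else 1) = 2 * j + (if even z then 0 else 1::nat)"
        using eq y(3) z(3) colour_of_wz[OF p1] by metis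
      then have ij: "i = j" and par: "even y \<longleftrightarrow> even z" by (auto split: if_splits) presburger+
      have "\<alpha> j \<in> cycle_cx p j" using \<alpha>(2) z(1) by blast
      then consider "\<alpha> j = {}" | x where "\<alpha> j = {wz p j x}" | x where "\<alpha> j = {wz p j x, wz p j (x + 1)}"
        unfolding cycle_cx_cases[OF p1] by blast
      then show "u = v"
      proof cases
        case 3
        \<comment> \<open>The ends of an edge have consecutive indices, hence different parities and
          colours.\<close>
        have "even x \<longleftrightarrow> \<not> even (x + 1)" by simp
        then show ?thesis using 3 y z ij par wz_parity[OF p1] by (metis insertE singletonD)
      qed (use y z ij in auto)
    qed
  next
    case (8 g v u)
    then obtain k where k: "g = rot p q k" by blast
    obtain j z where v: "j \<le> n" "v = wz p j z" using Sigma_vertexE[OF p1 8(2)] by metis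
    obtain i y where u: "u = wz p i y" using Sigma_vertexE[OF p1 8(4)] by metis
    \<comment> \<open>A fixed vertex in the j-th polygon gives p | k q_j, so p | k by coprimality.
      Then the shift in every polygon is a multiple of the period.\<close>
    have "(2 * int p) dvd (2 * (k * coef q j))"
      using 8(3) unfolding k v(2) rot_wz[OF p1] wz_eq_iff[OF p1] by (simp add: mult.assoc)
    then have "int p dvd k * coef q j" by simp
    then have "int p dvd k"
      using coef_coprime[OF q v(1)] by (simp add: coprime_commute coprime_dvd_mult_left_iff)
    then show ?case unfolding k u rot_wz[OF p1] wz_eq_iff[OF p1] by simp
  qed
qed

section \<open>The fan of the join of polygons\<close>

text \<open>The argument is nonnegative because the imaginary part is. It is below \<theta> because
  turning back by \<theta> leaves imaginary part \<open>- a * sin \<theta>\<close>, which is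
  negative. Requiring \<open>a > 0\<close> but only \<open>b \<ge> 0\<close> gives half-open
  sectors, which do not overlap.\<close>

lemma sector_polar:
  fixes a b \<theta> :: real
  assumes \<theta>: "0 < \<theta>" "\<theta> < pi" and ab: "a > 0" "b \<ge> 0"
  obtains r s where "r > 0" "0 \<le> s" "s < \<theta>" "of_real a + of_real b * cis \<theta> = of_real r * cis s"
proof -
  define w where "w = of_real a + of_real b * cis \<theta>"
  define s where "s = Arg w"
  have sin\<theta>: "sin \<theta> > 0" using \<theta> sin_gt_zero by blast
  have Im_w: "Im w = b * sin \<theta>" by (simp add: w_def)
  have w0: "w \<noteq> 0"
  proof
    assume "w = 0"
    then have "b = 0" using Im_w sin\<theta> by simp
    then show False using \<open>w = 0\<close> ab by (simp add: w_def)
  qed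
  have w: "w = of_real (cmod w) * cis s" using rcis_cmod_Arg[of w] by (simp add: s_def rcis_def)
  have r: "cmod w > 0" using w0 by simp
  have s0: "0 \<le> s" unfolding s_def Arg_less_0 using Im_w ab sin\<theta> by simp
  have "s < \<theta>"
  proof (rule ccontr)
    assume "\<not> s < \<theta>"
    moreover have "s \<le> pi" unfolding s_def by (rule Arg_le_pi)
    ultimately have "0 \<le> sin (s - \<theta>)" using \<theta> by (intro sin_ge_zero) auto
    moreover have "w * cis (- \<theta>) = of_real (cmod w) * cis (s - \<theta>)"
      by (subst w) (simp add: cis_mult mult.assoc)
    then have "Im (w * cis (- \<theta>)) = cmod w * sin (s - \<theta>)" by simp
    moreover have "w * cis (- \<theta>) = of_real a * cis (- \<theta>) + of_real b"
      by (simp add: w_def distrib_right mult.assoc cis_mult)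
    then have "Im (w * cis (- \<theta>)) = - a * sin \<theta>" by simp
    ultimately show False using r ab sin\<theta> by (smt (verit) mult_nonneg_nonneg mult_pos_pos mult_minus_left)
  qed
  then show thesis using that[OF r s0] w by (simp add: w_def)
qed

definition ray :: "nat \<Rightarrow> int \<Rightarrow> complex" where
  "ray p z = cis (of_int z * pi / real p)"

lemma ray_add: "ray p (y + z) = ray p y * ray p z"
  by (simp add: ray_def cis_mult add_divide_distrib distrib_right)

text \<open>Comparing arguments identifies the half-open sector up to full turns, that is, up to the
  period of the indices. Inside one sector the two directions are linearly independent over the
  reals.\<close>

lemma sector_unique:
  fixes a b a' b' :: real
  assumes p: "p \<ge> 2" and pos: "a > 0" "b \<ge> 0" "a' > 0" "b' \<ge> 0"
    and eq: "of_real a * ray p z + of_real b * ray p (z + 1) = of_real a' * ray p y + of_real b' * ray p (y + 1)"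
  shows "(2 * int p) dvd (z - y)" "a = a'" "b = b'"
proof -
  define \<theta> where "\<theta> = pi / real p"
  have \<theta>: "0 < \<theta>" "\<theta> < pi" using p by (auto simp: \<theta>_def field_simps)
  have ray1: "ray p 1 = cis \<theta>" by (simp add: ray_def \<theta>_def)
  have fac: "of_real a * ray p z + of_real b * ray p (z + 1) = ray p z * (of_real a + of_real b * cis \<theta>)"
    for a b z by (simp add: ray_add ray1 algebra_simps)
  obtain r s where rs: "r > 0" "0 \<le> s" "s < \<theta>" "of_real a + of_real b * cis \<theta> = of_real r * cis s"
    using sector_polar[OF \<theta> pos(1,2)] by metis
  obtain r' s' where rs': "r' > 0" "0 \<le> s'" "s' < \<theta>" "of_real a' + of_real b' * cis \<theta> = of_real r' * cis s'"
    using sector_polar[OF \<theta> pos(3,4)] by metis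
  have ry: "ray p z * cis s = cis (of_int z * \<theta> + s)" for z s by (simp add: ray_def \<theta>_def cis_mult)
  have e: "of_real r * cis (of_int z * \<theta> + s) = of_real r' * cis (of_int y * \<theta> + s')"
    using eq unfolding fac rs(4) rs'(4) ry[symmetric] by (simp add: mult.left_commute)
  then have "cmod (of_real r * cis (of_int z * \<theta> + s)) = cmod (of_real r' * cis (of_int y * \<theta> + s'))" by simp
  then have "r = r'" using rs(1) rs'(1) by (simp add: norm_mult)
  then have "cis (of_int z * \<theta> + s) = cis (of_int y * \<theta> + s')" using e rs(1) by simp
  then obtain m :: int where m: "of_int z * \<theta> + s = of_int y * \<theta> + s' + 2 * pi * m"
    unfolding cis_eq_cis_iff by blast
  have "pi = real p * \<theta>" using p by (simp add: \<theta>_def)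
  then have d: "of_int (z - y - 2 * int p * m) * \<theta> = s' - s" using m by (simp add: algebra_simps)
  \<comment> \<open>Both offsets lie in [0, \<theta>), so they differ by less than \<theta>; an
    integer multiple of \<theta> that small must vanish.\<close>
  let ?k = "z - y - 2 * int p * m"
  have "?k = 0"
  proof (rule ccontr)
    assume "?k \<noteq> 0"
    then have "1 \<le> \<bar>real_of_int ?k\<bar>" by linarith
    then have "\<theta> \<le> \<bar>real_of_int ?k\<bar> * \<theta>" using \<theta>(1) by simp
    also have "\<dots> = \<bar>s' - s\<bar>" using d \<theta>(1) by (metis abs_mult abs_of_pos)
    finally show False using rs rs' by linarith
  qed
  then have "z - y = 2 * int p * m" by linarith
  then show dvd: "(2 * int p) dvd (z - y)" by simp
  have "wz p 0 z = wz p 0 y" using dvd p by (simp add: wz_eq_iff)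
  then have "wz p 0 z 0 = wz p 0 y 0" by simp
  then have "ray p z = ray p y" by (simp add: wz_def ray_def)
  moreover have "ray p y \<noteq> 0" by (simp add: ray_def)
  ultimately have eq2: "of_real a + of_real b * cis \<theta> = of_real a' + of_real b' * cis \<theta>"
    using eq unfolding fac by simp
  then have "Im (of_real a + of_real b * cis \<theta>) = Im (of_real a' + of_real b' * cis \<theta>)" by simp
  then show "b = b'" using sin_gt_zero[OF \<theta>] by simp
  then show "a = a'" using eq2 by simp
qed

lemma sector_exists:
  assumes p: "p \<ge> 2" and "\<zeta> \<noteq> 0"
  obtains z and a b :: real where "a > 0" "b \<ge> 0" "\<zeta> = of_real a * ray p z + of_real b * ray p (z + 1)"
proof -
  define \<theta> where "\<theta> = pi / real p"
  have \<theta>: "0 < \<theta>" "\<theta> < pi" using p by (auto simp: \<theta>_def field_simps)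
  have sin\<theta>: "sin \<theta> > 0" using \<theta> sin_gt_zero by blast
  \<comment> \<open>The floor places the argument of \<zeta> in the half-open sector that starts at
    direction \<open>z\<close>, with offset \<open>s\<close> below \<theta>.\<close>
  define z where "z = \<lfloor>Arg \<zeta> / \<theta>\<rfloor>"
  define s where "s = Arg \<zeta> - of_int z * \<theta>"
  have "of_int z \<le> Arg \<zeta> / \<theta>" "Arg \<zeta> / \<theta> < of_int z + 1" unfolding z_def by linarith+
  then have s: "0 \<le> s" "s < \<theta>" using \<theta>(1) by (auto simp: s_def field_simps)
  \<comment> \<open>The two weights solve a + b cis \<theta> = |\<zeta>| cis s by the law of sines;
    \<open>s < \<theta>\<close> makes the first one positive.\<close>
  define a where "a = cmod \<zeta> * sin (\<theta> - s) / sin \<theta>"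
  define b where "b = cmod \<zeta> * sin s / sin \<theta>"
  have "sin (\<theta> - s) > 0" using s \<theta> by (intro sin_gt_zero) auto
  then have "a > 0" using assms(2) sin\<theta> by (simp add: a_def)
  moreover have "b \<ge> 0" using s \<theta> sin\<theta> sin_ge_zero[of s] by (simp add: b_def)
  moreover have "\<zeta> = of_real a * ray p z + of_real b * ray p (z + 1)"
  proof -
    have key: "of_real (sin (\<theta> - s)) + of_real (sin s) * cis \<theta> = of_real (sin \<theta>) * cis s"
      by (simp add: complex_eq_iff sin_diff algebra_simps)
    have "ray p 1 = cis \<theta>" by (simp add: ray_def \<theta>_def)
    then have "of_real a * ray p z + of_real b * ray p (z + 1) =
        ray p z * of_real (cmod \<zeta> / sin \<theta>) * (of_real (sin (\<theta> - s)) + of_real (sin s) * cis \<theta>)"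
      by (simp add: ray_add a_def b_def add_divide_distrib algebra_simps)
    also have "\<dots> = of_real (cmod \<zeta>) * (ray p z * cis s)"
      unfolding key using sin\<theta> by (simp add: field_simps)
    also have "ray p z * cis s = cis (Arg \<zeta>)"
      by (simp add: ray_def cis_mult s_def \<theta>_def)
    also have "of_real (cmod \<zeta>) * cis (Arg \<zeta>) = \<zeta>" using rcis_cmod_Arg[of \<zeta>] by (simp add: rcis_def)
    finally show ?thesis by simp
  qed
  ultimately show thesis by (rule that)
qed

definition sector :: "nat \<Rightarrow> nat \<Rightarrow> int \<Rightarrow> real \<Rightarrow> real \<Rightarrow> (nat \<Rightarrow> complex) \<Rightarrow> real" where
  "sector p j z a b = (\<lambda>v. if v = wz p j z then a else if v = wz p j (z + 1) then b else 0)"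

definition coord_sum :: "nat \<Rightarrow> nat \<Rightarrow> ((nat \<Rightarrow> complex) \<Rightarrow> real) \<Rightarrow> complex" where
  "coord_sum p j x = (\<Sum>v\<in>Wset p j. of_real (x v) * v j)"

lemma sector_in_fan:
  assumes p: "p \<ge> 2" and "a > 0" "b \<ge> 0"
  shows "sector p j z a b \<in> fan (cycle_cx p j)"
proof -
  have p1: "p \<ge> 1" using p by simp
  have edge: "{wz p j z, wz p j (z + 1)} \<in> cycle_cx p j" unfolding cycle_cx_cases[OF p1] by blast
  have "supp (sector p j z a b) \<in> cycle_cx p j"
    by (rule simplicial_complexD(4)[OF simplicial_complex_cycle_cx edge]) (auto simp: sector_def)
  then show ?thesis using assms by (auto simp: fan_def sector_def)
qed

text \<open>A single vertex is treated as the start of its edge and never as the end. This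
  convention matches the half-open sectors.\<close>

lemma fan_cycle_cx_cases:
  assumes p: "p \<ge> 2" and x: "x \<in> fan (cycle_cx p j)" and "x \<noteq> (\<lambda>v. 0)"
  obtains z a b where "a > 0" "b \<ge> 0" "x = sector p j z a b"
proof -
  have p1: "p \<ge> 1" using p by simp
  note nn = fanD(1)[OF x]
  have "supp x \<in> cycle_cx p j" using fanD(2)[OF x] .
  then consider "supp x = {}" | z where "supp x = {wz p j z}" | z where "supp x = {wz p j z, wz p j (z + 1)}"
    unfolding cycle_cx_cases[OF p1] by blast
  then show thesis
  proof cases
    case 1
    then show thesis using assms(3) by auto
  next
    case 2
    have "x v \<noteq> 0 \<longleftrightarrow> v = wz p j z" for v using 2 by blast
    then have "x = sector p j z (x (wz p j z)) 0" "x (wz p j z) > 0"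
      using nn[of "wz p j z"] unfolding sector_def by (intro ext, metis, metis less_le)
    then show thesis using that by blast
  next
    case 3
    have sx: "x v \<noteq> 0 \<longleftrightarrow> v = wz p j z \<or> v = wz p j (z + 1)" for v using 3 by blast
    have "x = sector p j z (x (wz p j z)) (x (wz p j (z + 1)))"
      unfolding sector_def using sx by (intro ext) metis
    moreover have "x (wz p j z) > 0" using sx[of "wz p j z"] nn[of "wz p j z"] by simp
    ultimately show thesis using that nn by blast
  qed
qed

lemma coord_sum_sector:
  assumes p: "p \<ge> 2"
  shows "coord_sum p j (sector p j z a b) = of_real a * ray p z + of_real b * ray p (z + 1)"
proof -
  have p1: "p \<ge> 1" using p by simp
  have ne: "wz p j (z + 1) \<noteq> wz p j z" by (rule wz_succ_neq(1)[OF p])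
  have "{wz p j z, wz p j (z + 1)} \<subseteq> Wset p j" unfolding Wset_eq[OF p1] by blast
  then have "coord_sum p j (sector p j z a b) =
      (\<Sum>v\<in>{wz p j z, wz p j (z + 1)}. of_real (sector p j z a b v) * v j)"
    unfolding coord_sum_def using finite_Wset
    by (intro sum.mono_neutral_right) (auto simp: sector_def)
  also have "\<dots> = of_real a * ray p z + of_real b * ray p (z + 1)"
    using ne by (simp add: sector_def wz_def ray_def)
  finally show ?thesis .
qed

text \<open>The half-open sectors between consecutive vertices of the regular polygon tile the
  punctured plane, and the origin comes from the zero function alone.\<close>

lemma bij_betw_coord_sum:
  assumes p: "p \<ge> 2"
  shows "bij_betw (coord_sum p j) (fan (cycle_cx p j)) UNIV"
proof -
  have p1: "p \<ge> 1" using p by simp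
  have zero: "coord_sum p j (\<lambda>v. 0) = 0" by (simp add: coord_sum_def)
  have nz: "coord_sum p j x \<noteq> 0" if x: "x \<in> fan (cycle_cx p j)" "x \<noteq> (\<lambda>v. 0)" for x
  proof
    assume 0: "coord_sum p j x = 0"
    obtain z a b where ab: "a > 0" "b \<ge> 0" "x = sector p j z a b"
      using fan_cycle_cx_cases[OF p x] by metis
    define \<theta> where "\<theta> = pi / real p"
    have \<theta>: "0 < \<theta>" "\<theta> < pi" using p by (auto simp: \<theta>_def field_simps)
    have "ray p 1 = cis \<theta>" by (simp add: ray_def \<theta>_def)
    then have "ray p z * (of_real a + of_real b * cis \<theta>) = 0"
      using 0 unfolding ab(3) coord_sum_sector[OF p] by (simp add: ray_add algebra_simps)
    then have "of_real a + of_real b * cis \<theta> = 0" by (simp add: ray_def)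
    then show False using sector_polar[OF \<theta> ab(1,2)] by (metis cis_neq_zero less_irrefl mult_eq_0_iff of_real_eq_0_iff)
  qed
  show ?thesis
    unfolding bij_betw_def
  proof
    show "inj_on (coord_sum p j) (fan (cycle_cx p j))"
    proof (rule inj_onI)
      fix x y assume x: "x \<in> fan (cycle_cx p j)" and y: "y \<in> fan (cycle_cx p j)"
        and eq: "coord_sum p j x = coord_sum p j y"
      show "x = y"
      proof (cases "x = (\<lambda>v. 0) \<or> y = (\<lambda>v. 0)")
        case True
        then show ?thesis using nz[OF x] nz[OF y] eq zero by metis
      next
        case False
        obtain z a b where ab: "a > 0" "b \<ge> 0" "x = sector p j z a b"
          using fan_cycle_cx_cases[OF p x] False by metis
        obtain z' a' b' where ab': "a' > 0" "b' \<ge> 0" "y = sector p j z' a' b'"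
          using fan_cycle_cx_cases[OF p y] False by metis
        have e: "of_real a * ray p z + of_real b * ray p (z + 1) = of_real a' * ray p z' + of_real b' * ray p (z' + 1)"
          using eq unfolding ab(3) ab'(3) coord_sum_sector[OF p] .
        note u = sector_unique[OF p ab(1,2) ab'(1,2) e]
        have w: "wz p j z = wz p j z'" using u(1) wz_eq_iff[OF p1] by simp
        have w1: "wz p j (z + 1) = wz p j (z' + 1)" using wz_shift[OF p1 w] .
        show ?thesis unfolding ab(3) ab'(3) sector_def u(2,3) w w1 ..
      qed
    qed
    show "coord_sum p j ` fan (cycle_cx p j) = UNIV"
    proof (intro equalityI subsetI)
      fix \<zeta> :: complex
      show "\<zeta> \<in> coord_sum p j ` fan (cycle_cx p j)"
      proof (cases "\<zeta> = 0")
        case True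
        have "(\<lambda>v. 0) \<in> fan (cycle_cx p j)" by (simp add: fan_def cycle_cx_def)
        then show ?thesis using zero True by (metis image_eqI)
      next
        case False
        then obtain z a b where ab: "a > 0" "b \<ge> 0" "\<zeta> = of_real a * ray p z + of_real b * ray p (z + 1)"
          using sector_exists[OF p] by metis
        then show ?thesis using coord_sum_sector[OF p] sector_in_fan[OF p ab(1,2)] by (metis image_eqI)
      qed
    qed simp
  qed
qed

section \<open>All coordinates of the complex vector space at once\<close>

lemma fan_Sigma_cx_iff:
  assumes p: "p \<ge> 1"
  shows "x \<in> fan (Sigma_cx n p) \<longleftrightarrow>
    supp x \<subseteq> (\<Union>j\<le>n. Wset p j) \<and> (\<forall>j\<le>n. restr (Wset p j) x \<in> fan (cycle_cx p j))"
proof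
  assume x: "x \<in> fan (Sigma_cx n p)"
  then obtain \<alpha> where \<alpha>: "supp x = (\<Union>j\<in>{0..n}. \<alpha> j)" "\<forall>j\<in>{0..n}. \<alpha> j \<in> cycle_cx p j"
    unfolding fan_def Sigma_cx_def by blast
  have sub: "\<alpha> j \<subseteq> Wset p j" if "j \<le> n" for j using \<alpha>(2) that Union_cycle_cx by fastforce
  have "restr (Wset p j) x \<in> fan (cycle_cx p j)" if j: "j \<le> n" for j
  proof -
    have "supp (restr (Wset p j) x) = supp x \<inter> Wset p j" by (auto simp: restr_def)
    also have "\<dots> = \<alpha> j"
    proof
      show "\<alpha> j \<subseteq> supp x \<inter> Wset p j" unfolding \<alpha>(1) using sub[OF j] j by auto
      show "supp x \<inter> Wset p j \<subseteq> \<alpha> j"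
      proof
        fix v assume v: "v \<in> supp x \<inter> Wset p j"
        then obtain i where i: "i \<le> n" "v \<in> \<alpha> i" unfolding \<alpha>(1) by auto
        then have "v \<in> Wset p i" using sub by blast
        then have "i = j" using v Wset_disjoint[OF p, of i j] by blast
        then show "v \<in> \<alpha> j" using i by simp
      qed
    qed
    finally show ?thesis using \<alpha>(2) j fanD(1)[OF x] by (simp add: fan_def restr_def)
  qed
  moreover have "supp x \<subseteq> (\<Union>j\<le>n. Wset p j)"
    using fanD(2)[OF x] Union_Sigma_cx by blast
  ultimately show "supp x \<subseteq> (\<Union>j\<le>n. Wset p j) \<and> (\<forall>j\<le>n. restr (Wset p j) x \<in> fan (cycle_cx p j))" by blast
next
  assume *: "supp x \<subseteq> (\<Union>j\<le>n. Wset p j) \<and> (\<forall>j\<le>n. restr (Wset p j) x \<in> fan (cycle_cx p j))"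
  let ?\<alpha> = "\<lambda>j. supp (restr (Wset p j) x)"
  have "supp x = (\<Union>j\<in>{0..n}. ?\<alpha> j)"
  proof
    show "supp x \<subseteq> (\<Union>j\<in>{0..n}. ?\<alpha> j)"
    proof
      fix v assume v: "v \<in> supp x"
      then obtain j where "j \<le> n" "v \<in> Wset p j" using * by blast
      then show "v \<in> (\<Union>j\<in>{0..n}. ?\<alpha> j)" using v by (intro UN_I[of j]) (auto simp: restr_def)
    qed
    show "(\<Union>j\<in>{0..n}. ?\<alpha> j) \<subseteq> supp x" by (auto simp: restr_def)
  qed
  moreover have "\<forall>j\<in>{0..n}. ?\<alpha> j \<in> cycle_cx p j" using * by (intro ballI fanD(2)) auto
  ultimately have "supp x \<in> Sigma_cx n p"
    unfolding Sigma_cx_def by (intro CollectI exI[of _ ?\<alpha>] conjI)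
  moreover have "0 \<le> x v" for v
  proof (cases "v \<in> supp x")
    case True
    then obtain j where "j \<le> n" "v \<in> Wset p j" using * by blast
    then show ?thesis using * fanD(1)[of "restr (Wset p j) x" "cycle_cx p j" v] by (simp add: restr_def)
  qed simp
  ultimately show "x \<in> fan (Sigma_cx n p)" by (simp add: fan_def)
qed

definition vertex_sum :: "nat \<Rightarrow> nat \<Rightarrow> ((nat \<Rightarrow> complex) \<Rightarrow> real) \<Rightarrow> (nat \<Rightarrow> complex)" where
  "vertex_sum n p x = (\<lambda>i. \<Sum>v\<in>\<Union>(Sigma_cx n p). of_real (x v) * v i)"

text \<open>A vertex of the j-th polygon vanishes off coordinate j, so each coordinate sees exactly
  one polygon.\<close>

lemma vertex_sum_coord:
  assumes p: "p \<ge> 1"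
  shows "vertex_sum n p x i = (if i \<le> n then coord_sum p i (restr (Wset p i) x) else 0)"
proof -
  have zero: "v i = 0" if "v \<in> Wset p j" "j \<noteq> i" for v j
    using that unfolding Wset_eq[OF p] by (auto simp: wz_def)
  show ?thesis
  proof (cases "i \<le> n")
    case True
    have "vertex_sum n p x i = (\<Sum>v\<in>Wset p i. of_real (x v) * v i)"
      unfolding vertex_sum_def Union_Sigma_cx
    proof (rule sum.mono_neutral_right)
      show "finite (\<Union>j\<le>n. Wset p j)" using finite_Wset by blast
      show "Wset p i \<subseteq> (\<Union>j\<le>n. Wset p j)" using True by blast
      show "\<forall>v\<in>(\<Union>j\<le>n. Wset p j) - Wset p i. of_real (x v) * v i = 0"
      proof
        fix v assume "v \<in> (\<Union>j\<le>n. Wset p j) - Wset p i"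
        then obtain j where "v \<in> Wset p j" "j \<noteq> i" by blast
        then show "of_real (x v) * v i = 0" using zero by simp
      qed
    qed
    then show ?thesis using True by (simp add: coord_sum_def restr_def)
  next
    case False
    have "v i = 0" if "v \<in> \<Union>(Sigma_cx n p)" for v
      using that zero False unfolding Union_Sigma_cx by blast
    then have "vertex_sum n p x i = 0" unfolding vertex_sum_def by (intro sum.neutral) simp
    then show ?thesis using False by simp
  qed
qed

lemma bij_betw_vertex_sum:
  assumes p: "p \<ge> 2"
  shows "bij_betw (vertex_sum n p) (fan (Sigma_cx n p)) {z. \<forall>j>n. z j = 0}"
proof -
  have p1: "p \<ge> 1" using p by simp
  note iff = fan_Sigma_cx_iff[OF p1] and vc = vertex_sum_coord[OF p1]
  have bij: "bij_betw (coord_sum p j) (fan (cycle_cx p j)) UNIV" for j by (rule bij_betw_coord_sum[OF p])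
  show ?thesis
    unfolding bij_betw_def
  proof
    show "inj_on (vertex_sum n p) (fan (Sigma_cx n p))"
    proof (rule inj_onI)
      fix x y assume x: "x \<in> fan (Sigma_cx n p)" and y: "y \<in> fan (Sigma_cx n p)"
        and eq: "vertex_sum n p x = vertex_sum n p y"
      have r: "restr (Wset p j) x = restr (Wset p j) y" if j: "j \<le> n" for j
      proof -
        have "coord_sum p j (restr (Wset p j) x) = coord_sum p j (restr (Wset p j) y)"
          using fun_cong[OF eq, of j] j by (simp add: vc)
        then show ?thesis using x y j bij_betw_imp_inj_on[OF bij[of j]] unfolding iff by (meson inj_onD)
      qed
      show "x = y"
      proof
        fix v
        show "x v = y v"
        proof (cases "v \<in> (\<Union>j\<le>n. Wset p j)")
          case True
          then obtain j where j: "j \<le> n" "v \<in> Wset p j" by blast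
          then show ?thesis using fun_cong[OF r[OF j(1)], of v] by (simp add: restr_def)
        next
          case False
          then show ?thesis using fanD(3)[OF x, of v] fanD(3)[OF y, of v] unfolding Union_Sigma_cx by simp
        qed
      qed
    qed
    show "vertex_sum n p ` fan (Sigma_cx n p) = {z. \<forall>j>n. z j = 0}"
    proof (intro equalityI subsetI)
      fix z assume "z \<in> vertex_sum n p ` fan (Sigma_cx n p)"
      then show "z \<in> {z. \<forall>j>n. z j = 0}" by (auto simp: vc)
    next
      fix z :: "nat \<Rightarrow> complex" assume z: "z \<in> {z. \<forall>j>n. z j = 0}"
      have "\<exists>a. a \<in> fan (cycle_cx p j) \<and> coord_sum p j a = z j" for j
        using bij_betw_imp_surj_on[OF bij[of j]] by (metis UNIV_I imageE)
      then obtain a where a: "\<And>j. a j \<in> fan (cycle_cx p j)" "\<And>j. coord_sum p j (a j) = z j" by metis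
      define x where "x v = (\<Sum>j\<le>n. a j v)" for v
      have off: "a i v = 0" if "v \<in> Wset p j" "i \<noteq> j" for i j v
      proof -
        have "v \<notin> Wset p i" using that Wset_disjoint[OF p1 that(2)] by blast
        then show ?thesis using fanD(3)[OF a(1)[of i], of v] unfolding Union_cycle_cx by simp
      qed
      have on: "x v = a j v" if "v \<in> Wset p j" "j \<le> n" for j v
      proof -
        have "x v = (\<Sum>i\<in>{j}. a i v)"
          unfolding x_def using that off[OF that(1)] by (intro sum.mono_neutral_right) auto
        then show ?thesis by simp
      qed
      have res: "restr (Wset p j) x = a j" if "j \<le> n" for j
      proof
        fix v
        show "restr (Wset p j) x v = a j v"
          using on[OF _ that, of v] fanD(3)[OF a(1)[of j], of v] unfolding Union_cycle_cx by (simp add: restr_def)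
      qed
      have "supp x \<subseteq> (\<Union>j\<le>n. Wset p j)"
      proof
        fix v assume "v \<in> supp x"
        then obtain j where "j \<le> n" "a j v \<noteq> 0" unfolding x_def by (auto elim: sum.not_neutral_contains_not_neutral)
        then show "v \<in> (\<Union>j\<le>n. Wset p j)" using fanD(3)[OF a(1)[of j], of v] unfolding Union_cycle_cx by blast
      qed
      then have "x \<in> fan (Sigma_cx n p)" unfolding iff using res a(1) by simp
      moreover have "vertex_sum n p x = z"
      proof
        fix i show "vertex_sum n p x i = z i" using z a(2) by (simp add: vc res)
      qed
      ultimately show "z \<in> vertex_sum n p ` fan (Sigma_cx n p)" by blast
    qed
  qed
qed

section \<open>The orbit space of the sphere\<close>

text \<open>The linear map to the vector space, precomposed with the barycentric subdivision.
  Written as a sum over simplices it can be reindexed by a group element, which will show its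
  equivariance.\<close>

definition bary_sum :: "nat \<Rightarrow> nat \<Rightarrow> ((nat \<Rightarrow> complex) set \<Rightarrow> real) \<Rightarrow> (nat \<Rightarrow> complex)" where
  "bary_sum n p c = (\<lambda>i. \<Sum>\<sigma>\<in>Sigma_cx n p - {{}}. of_real (c \<sigma>) * (\<Sum>v\<in>\<sigma>. v i))"

lemma bary_sum_eq_vertex_sum:
  "bary_sum n p c = vertex_sum n p (lin (Sigma_cx n p - {{}}) indicat_real c)"
proof
  fix i
  let ?S = "Sigma_cx n p - {{}}" and ?V = "\<Union>(Sigma_cx n p)"
  note D = simplicial_complexD[OF simplicial_complex_Sigma_cx[of n p]]
  have "vertex_sum n p (lin ?S indicat_real c) i = (\<Sum>v\<in>?V. \<Sum>\<sigma>\<in>?S. of_real (c \<sigma> * indicat_real \<sigma> v) * v i)"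
    by (simp add: vertex_sum_def lin_def sum_distrib_right)
  also have "\<dots> = (\<Sum>\<sigma>\<in>?S. \<Sum>v\<in>?V. of_real (c \<sigma> * indicat_real \<sigma> v) * v i)" by (rule sum.swap)
  also have "\<dots> = (\<Sum>\<sigma>\<in>?S. of_real (c \<sigma>) * (\<Sum>v\<in>\<sigma>. v i))"
  proof (rule sum.cong[OF refl])
    fix \<sigma> assume \<sigma>: "\<sigma> \<in> ?S"
    have "(\<Sum>v\<in>?V. of_real (c \<sigma> * indicat_real \<sigma> v) * v i) = (\<Sum>v\<in>\<sigma>. of_real (c \<sigma> * indicat_real \<sigma> v) * v i)"
      using \<sigma> D(5) by (intro sum.mono_neutral_right) (auto simp: indicator_def)
    also have "\<dots> = of_real (c \<sigma>) * (\<Sum>v\<in>\<sigma>. v i)" by (simp add: sum_distrib_left)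
    finally show "(\<Sum>v\<in>?V. of_real (c \<sigma> * indicat_real \<sigma> v) * v i) = of_real (c \<sigma>) * (\<Sum>v\<in>\<sigma>. v i)" .
  qed
  finally show "bary_sum n p c i = vertex_sum n p (lin ?S indicat_real c) i" by (simp add: bary_sum_def)
qed

lemma bij_betw_bary_sum:
  assumes "p \<ge> 2"
  shows "bij_betw (bary_sum n p) (fan (chains (Sigma_cx n p - {{}}))) {z. \<forall>j>n. z j = 0}"
proof -
  have "bary_sum n p = vertex_sum n p \<circ> lin (Sigma_cx n p - {{}}) indicat_real"
    by (simp add: fun_eq_iff bary_sum_eq_vertex_sum)
  then show ?thesis
    using bij_betw_trans[OF bij_betw_barycentric[OF simplicial_complex_Sigma_cx] bij_betw_vertex_sum[OF assms]]
    by simp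
qed

lemma bary_sum_scale: "bary_sum n p (\<lambda>\<sigma>. t * c \<sigma>) = (\<lambda>i. of_real t * bary_sum n p c i)"
  by (auto simp: bary_sum_def sum_distrib_left mult.assoc)

lemma continuous_on_bary_sum: "continuous_on A (bary_sum n p)"
  unfolding bary_sum_def
  by (intro continuous_on_coordinatewise_then_product continuous_on_sum continuous_on_mult
      continuous_on_const continuous_on_of_real continuous_on_subset[OF continuous_on_product_coordinates]) auto

section \<open>Radial projection onto the sphere\<close>

definition znorm :: "nat \<Rightarrow> (nat \<Rightarrow> complex) \<Rightarrow> real" where
  "znorm n z = sqrt (\<Sum>j\<le>n. (cmod (z j))\<^sup>2)"

lemma znorm_scale: "t \<ge> 0 \<Longrightarrow> znorm n (\<lambda>i. of_real t * z i) = t * znorm n z"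
  by (simp add: znorm_def norm_mult power_mult_distrib sum_distrib_left[symmetric] real_sqrt_mult)

lemma znorm_rot: "znorm n (rot p q k z) = znorm n z"
  by (simp add: znorm_def rot_def norm_mult)

lemma znorm_pos:
  assumes "\<forall>j>n. z j = 0" "z \<noteq> (\<lambda>i. 0)"
  shows "znorm n z > 0"
proof -
  obtain i where i: "z i \<noteq> 0" using assms(2) by (auto simp: fun_eq_iff)
  then have "i \<le> n" using assms(1) by (meson not_le)
  then have "(\<Sum>j\<le>n. (cmod (z j))\<^sup>2) > 0" using i by (intro sum_pos2[of _ i]) auto
  then show ?thesis by (simp add: znorm_def)
qed

lemma odd_sphere_iff: "z \<in> odd_sphere n \<longleftrightarrow> (\<forall>j>n. z j = 0) \<and> znorm n z = 1"
  by (simp add: odd_sphere_def znorm_def)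

lemma fan_scale:
  assumes "c \<in> fan K" "t > 0"
  shows "(\<lambda>v. t * c v) \<in> fan K"
  using assms by (simp add: fan_def)

definition radial :: "nat \<Rightarrow> nat \<Rightarrow> ((nat \<Rightarrow> complex) set \<Rightarrow> real) \<Rightarrow> (nat \<Rightarrow> complex)" where
  "radial n p c = (\<lambda>i. of_real (1 / znorm n (bary_sum n p c)) * bary_sum n p c i)"

text \<open>\<open>bary_sum\<close> is a bijection of cones commuting with positive scaling. Every
  ray meets the realization once and its image ray meets the sphere once, so normalising stays
  bijective; compactness handles the inverse.\<close>

lemma homeomorphic_map_radial:
  fixes n p :: nat
  assumes p: "p \<ge> 2"
  defines "A \<equiv> realization (chains (Sigma_cx n p - {{}}))"
  shows "homeomorphic_map (top_of_set A) (top_of_set (odd_sphere n)) (radial n p)"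
proof -
  let ?S = "Sigma_cx n p - {{}}" and ?F = "bary_sum n p"
  have finS: "finite ?S" using simplicial_complexD(1)[OF simplicial_complex_Sigma_cx] by simp
  have sc: "simplicial_complex (chains ?S)" by (rule simplicial_complex_chains[OF finS])
  have A: "c \<in> A \<longleftrightarrow> c \<in> fan (chains ?S) \<and> sum c ?S = 1" for c
    unfolding A_def realization_eq_fan[OF sc] Union_chains by simp
  have bij: "bij_betw ?F (fan (chains ?S)) {z. \<forall>j>n. z j = 0}" by (rule bij_betw_bary_sum[OF p])
  have zero: "(\<lambda>\<sigma>. 0) \<in> fan (chains ?S)" by (simp add: fan_def chains_def)
  have F0: "?F (\<lambda>\<sigma>. 0) = (\<lambda>i. 0)" by (simp add: bary_sum_def)
  have E: "\<forall>j>n. ?F c j = 0" if "c \<in> A" for c using bij_betwE[OF bij] that A by blast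
  have npos: "znorm n (?F c) > 0" if c: "c \<in> A" for c
  proof (rule znorm_pos[OF E[OF c]])
    show "?F c \<noteq> (\<lambda>i. 0)"
    proof
      assume "?F c = (\<lambda>i. 0)"
      then have "c = (\<lambda>\<sigma>. 0)" using inj_onD[OF bij_betw_imp_inj_on[OF bij]] F0 zero c A by metis
      then show False using c A by simp
    qed
  qed
  show ?thesis
  proof (rule continuous_imp_homeomorphic_map)
    show "compact_space (top_of_set A)"
      using compact_realization[OF sc] by (simp add: A_def compact_space_subtopology)
    show "Hausdorff_space (top_of_set (odd_sphere n))" by (rule Hausdorff_space_top_of_set_fun)
    have img: "radial n p ` A = odd_sphere n"
    proof (intro equalityI subsetI)
      fix z assume "z \<in> radial n p ` A"
      then obtain c where c: "c \<in> A" "z = radial n p c" by blast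
      have "znorm n z = 1"
        unfolding c(2) radial_def using npos[OF c(1)] by (subst znorm_scale) auto
      moreover have "\<forall>j>n. z j = 0" using E[OF c(1)] by (simp add: c(2) radial_def)
      ultimately show "z \<in> odd_sphere n" by (simp add: odd_sphere_iff)
    next
      fix z assume z: "z \<in> odd_sphere n"
      then have "z \<in> {z. \<forall>j>n. z j = 0}" by (simp add: odd_sphere_iff)
      then obtain c where c: "c \<in> fan (chains ?S)" "?F c = z"
        using bij_betw_imp_surj_on[OF bij] by (metis (no_types, lifting) imageE)
      have "supp c \<noteq> {}"
      proof
        assume "supp c = {}"
        then have "c = (\<lambda>\<sigma>. 0)" by auto
        then have "z = (\<lambda>i. 0)" using c(2) F0 by simp
        then show False using z by (simp add: odd_sphere_iff znorm_def)
      qed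
      then obtain \<sigma> where \<sigma>: "c \<sigma> \<noteq> 0" by blast
      then have "\<sigma> \<in> ?S" using fanD(3)[OF c(1), of \<sigma>] unfolding Union_chains by blast
      moreover have "c \<sigma> > 0" using \<sigma> fanD(1)[OF c(1), of \<sigma>] by simp
      ultimately have pos: "sum c ?S > 0" using finS fanD(1)[OF c(1)] by (meson sum_pos2)
      \<comment> \<open>Rescales the preimage to total mass 1. Its image is then \<open>t\<close>
        times \<open>z\<close>, and dividing by the norm undoes the factor.\<close>
      define t where "t = 1 / sum c ?S"
      have t: "t > 0" "t * sum c ?S = 1" using pos by (simp_all add: t_def)
      define d where "d = (\<lambda>\<sigma>. t * c \<sigma>)"
      have "sum d ?S = 1" unfolding d_def sum_distrib_left[symmetric] by (rule t(2))
      moreover have "d \<in> fan (chains ?S)" unfolding d_def by (rule fan_scale[OF c(1) t(1)])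
      ultimately have dA: "d \<in> A" unfolding A by simp
      have Fd: "?F d = (\<lambda>i. of_real t * z i)"
        unfolding d_def bary_sum_scale c(2) ..
      have "znorm n (?F d) = t"
        unfolding Fd using t(1) z by (subst znorm_scale) (auto simp: odd_sphere_iff)
      then have "radial n p d = z" using t(1) by (simp add: radial_def Fd fun_eq_iff)
      then show "z \<in> radial n p ` A" using dA by blast
    qed
    show "radial n p ` topspace (top_of_set A) = topspace (top_of_set (odd_sphere n))" using img by simp
    have "continuous_on A (\<lambda>c. radial n p c i)" for i
    proof -
      have cF: "continuous_on A (\<lambda>c. ?F c j)" for j
        using continuous_on_product_then_coordinatewise[OF continuous_on_bary_sum] .
      have "continuous_on A (\<lambda>c. znorm n (?F c))"
        unfolding znorm_def by (intro continuous_intros cF)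
      then show ?thesis
        unfolding radial_def using npos
        by (intro continuous_on_mult continuous_on_of_real continuous_on_divide continuous_on_const cF)
           (auto simp: less_imp_neq[symmetric])
    qed
    then have "continuous_on A (radial n p)" by (rule continuous_on_coordinatewise_then_product)
    then show "continuous_map (top_of_set A) (top_of_set (odd_sphere n)) (radial n p)"
      using img by (auto simp: continuous_map_in_subtopology)
    show "inj_on (radial n p) (topspace (top_of_set A))"
    proof (rule inj_onI)
      fix c d assume "c \<in> topspace (top_of_set A)" "d \<in> topspace (top_of_set A)"
        and eq: "radial n p c = radial n p d"
      then have c: "c \<in> A" and d: "d \<in> A" by simp_all
      let ?s = "1 / znorm n (?F c)" and ?t = "1 / znorm n (?F d)"
      have st: "?s > 0" "?t > 0" using npos[OF c] npos[OF d] by simp_all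
      have "?F (\<lambda>\<sigma>. ?s * c \<sigma>) = ?F (\<lambda>\<sigma>. ?t * d \<sigma>)"
        using eq unfolding radial_def bary_sum_scale .
      moreover have "(\<lambda>\<sigma>. ?s * c \<sigma>) \<in> fan (chains ?S)" "(\<lambda>\<sigma>. ?t * d \<sigma>) \<in> fan (chains ?S)"
        using c d A st by (blast intro: fan_scale)+
      ultimately have sc: "(\<lambda>\<sigma>. ?s * c \<sigma>) = (\<lambda>\<sigma>. ?t * d \<sigma>)"
        using inj_onD[OF bij_betw_imp_inj_on[OF bij]] by blast
      then have "(\<Sum>\<sigma>\<in>?S. ?s * c \<sigma>) = (\<Sum>\<sigma>\<in>?S. ?t * d \<sigma>)" by (simp only: fun_eq_iff)
      \<comment> \<open>Both points have total mass 1, so the masses of the two scaled points are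
        the scaling factors themselves.\<close>
      then have "?s = ?t" using c d A unfolding sum_distrib_left[symmetric] by simp
      then show "c = d" using sc st by (auto simp: fun_eq_iff)
    qed
  qed
qed

text \<open>The quotient map is the inverse of \<open>radial\<close> followed by
  \<open>proj\<close>. Its fibres are the orbits, since those of \<open>proj\<close> are the
  translates of a point and \<open>radial\<close> turns translation by a rotation into the rotation
  itself.\<close>

lemma homeomorphic_orbit_space_lens:
  assumes p: "p \<ge> 2" and q: "\<forall>j\<in>{1..n}. coprime (q j) (int p)"
  defines "G \<equiv> cyclic_gen (rho_v p q)"
  shows "homeomorphic_orbit_space (top_of_set (realization (derived (quot_carrier (Sigma_cx n p) G) (quot_le G))))
           (odd_sphere n) G"
proof -
  interpret balanced_action "Sigma_cx n p" G "colour_of p"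
    unfolding G_def by (rule balanced_action_Sigma[OF p q])
  define A where "A = realization (chains S)"
  let ?B = "realization (derived Q le)"
  have sc: "simplicial_complex (chains S)" by (rule simplicial_complex_chains[OF finite_S])
  have A: "c \<in> A \<longleftrightarrow> c \<in> fan (chains S) \<and> sum c S = 1" for c
    unfolding A_def realization_eq_fan[OF sc] Union_chains by simp
  have hom: "homeomorphic_map (top_of_set A) (top_of_set (odd_sphere n)) (radial n p)"
    unfolding A_def by (rule homeomorphic_map_radial[OF p])
  then obtain r where "homeomorphic_maps (top_of_set A) (top_of_set (odd_sphere n)) (radial n p) r"
    unfolding homeomorphic_map_maps by blast
  then have r: "continuous_map (top_of_set (odd_sphere n)) (top_of_set A) r"
    and rl: "\<And>c. c \<in> A \<Longrightarrow> r (radial n p c) = c"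
    and lr: "\<And>z. z \<in> odd_sphere n \<Longrightarrow> radial n p (r z) = z"
    by (auto simp: homeomorphic_maps_def)
  have surj: "radial n p ` A = odd_sphere n" using homeomorphic_imp_surjective_map[OF hom] by simp
  have rA: "r z \<in> A" if "z \<in> odd_sphere n" for z using that rl surj by (metis imageE)
  have rimg: "r ` odd_sphere n = A"
  proof
    show "A \<subseteq> r ` odd_sphere n" using rl surj by (metis image_eqI subsetI)
  qed (use rA in blast)
  \<comment> \<open>The second hypothesis says that \<open>c'\<close> is the translate of
    \<open>c\<close>, without mentioning an inverse. Rotations multiply every coordinate by a
    complex number of modulus 1, so they preserve \<open>znorm\<close> and commute with the
    normalisation.\<close>
  have equiv: "radial n p c' = rot p q k (radial n p c)"
    if "rot p q k \<in> G" "\<And>\<sigma>. \<sigma> \<in> S \<Longrightarrow> c' (rot p q k ` \<sigma>) = c \<sigma>" for c c' k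
  proof -
    let ?g = "rot p q k"
    have F: "bary_sum n p c' = ?g (bary_sum n p c)"
    proof
      fix i
      let ?w = "cis (2 * pi * of_int (k * coef q i) / real p)"
      have "bary_sum n p c' i = (\<Sum>\<sigma>\<in>S. of_real (c' (?g ` \<sigma>)) * (\<Sum>v\<in>?g ` \<sigma>. v i))"
        unfolding bary_sum_def
        using sum.reindex_bij_betw[OF bij_G_S[OF that(1)], of "\<lambda>\<tau>. of_real (c' \<tau>) * (\<Sum>v\<in>\<tau>. v i)"] by simp
      also have "\<dots> = (\<Sum>\<sigma>\<in>S. ?w * (of_real (c \<sigma>) * (\<Sum>v\<in>\<sigma>. v i)))"
      proof (rule sum.cong[OF refl])
        fix \<sigma> assume \<sigma>: "\<sigma> \<in> S"
        have "inj_on ?g \<sigma>" using inj_G[OF that(1)] by (meson inj_on_subset subset_UNIV)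
        then have "(\<Sum>v\<in>?g ` \<sigma>. v i) = (\<Sum>v\<in>\<sigma>. ?g v i)" by (simp add: sum.reindex)
        also have "\<dots> = ?w * (\<Sum>v\<in>\<sigma>. v i)" by (simp add: rot_def sum_distrib_left)
        finally show "of_real (c' (?g ` \<sigma>)) * (\<Sum>v\<in>?g ` \<sigma>. v i) = ?w * (of_real (c \<sigma>) * (\<Sum>v\<in>\<sigma>. v i))"
          using that(2)[OF \<sigma>] by (simp add: mult.left_commute)
      qed
      also have "\<dots> = ?g (bary_sum n p c) i" by (simp add: bary_sum_def rot_def sum_distrib_left)
      finally show "bary_sum n p c' i = ?g (bary_sum n p c) i" .
    qed
    show ?thesis
      unfolding radial_def F znorm_rot by (simp add: rot_def fun_eq_iff)
  qed
  let ?f = "proj \<circ> r"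
  have "quotient_map (top_of_set (odd_sphere n)) (top_of_set ?B) ?f"
  proof (rule continuous_imp_quotient_map)
    have "compact (radial n p ` A)"
    proof (rule compact_continuous_image)
      show "compact A" unfolding A_def by (rule compact_realization[OF sc])
      show "continuous_on A (radial n p)"
        using homeomorphic_imp_continuous_map[OF hom] by (simp add: continuous_map_in_subtopology)
    qed
    then show "compact_space (top_of_set (odd_sphere n))" by (simp add: surj compact_space_subtopology)
    show "Hausdorff_space (top_of_set ?B)" by (rule Hausdorff_space_top_of_set_fun)
    have img: "proj ` A = ?B" unfolding A_def by (rule proj_image)
    show "?f ` topspace (top_of_set (odd_sphere n)) = topspace (top_of_set ?B)"
      by (simp only: topspace_euclidean_subtopology image_comp[symmetric] rimg img)
    have "continuous_map (top_of_set A) (top_of_set ?B) proj"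
      using img continuous_on_lin unfolding proj_def by (auto simp: continuous_map_in_subtopology)
    then show "continuous_map (top_of_set (odd_sphere n)) (top_of_set ?B) ?f"
      by (rule continuous_map_compose[OF r])
  qed
  moreover have "?f z = ?f w \<longleftrightarrow> (\<exists>g\<in>G. w = g z)" if z: "z \<in> odd_sphere n" and w: "w \<in> odd_sphere n" for z w
  proof
    have fans: "r z \<in> fan (chains S)" "r w \<in> fan (chains S)" using rA[OF z] rA[OF w] A by blast+
    {
      assume "?f z = ?f w"
      then obtain g where g: "g \<in> G" "\<forall>\<sigma>\<in>S. r w (g ` \<sigma>) = r z \<sigma>"
        using proj_fibre[OF fans] by auto
      obtain k where k: "g = rot p q k" using g(1) unfolding G_def cyclic_gen_rho_v by blast
      have "radial n p (r w) = g (radial n p (r z))"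
        unfolding k using g unfolding k by (intro equiv) auto
      then show "\<exists>g\<in>G. w = g z" using lr[OF z] lr[OF w] g(1) by auto
    }
    assume "\<exists>g\<in>G. w = g z"
    then obtain g where g: "g \<in> G" "w = g z" by blast
    obtain k where k: "g = rot p q k" using g(1) unfolding G_def cyclic_gen_rho_v by blast
    obtain h where h: "h \<in> G" "h \<circ> g = id" "g \<circ> h = id" using inverse[OF g(1)] by blast
    \<comment> \<open>The translate of \<open>r z\<close> by \<open>g\<close>. As
      \<open>radial n p\<close> carries it to \<open>w\<close>, it must be \<open>r w\<close>, and
      translates have equal projections.\<close>
    define c where "c = (\<lambda>\<tau>. r z (h ` \<tau>))"
    have cg: "c (g ` \<sigma>) = r z \<sigma>" for \<sigma> using h(2) by (simp add: c_def image_comp)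
    have "supp c = (`) g ` supp (r z)"
    proof (intro equalityI subsetI)
      fix \<tau> assume "\<tau> \<in> supp c"
      then have "h ` \<tau> \<in> supp (r z)" by (simp add: c_def)
      moreover have "\<tau> = g ` h ` \<tau>" using h(3) by (simp add: image_comp)
      ultimately show "\<tau> \<in> (`) g ` supp (r z)" by (rule image_eqI[rotated])
    next
      fix \<tau> assume "\<tau> \<in> (`) g ` supp (r z)"
      then show "\<tau> \<in> supp c" using cg by auto
    qed
    then have "supp c \<in> chains S" using chain_image_G[OF fanD(2)[OF fans(1)] g(1)] by simp
    then have cfan: "c \<in> fan (chains S)" using fanD(1)[OF fans(1)] by (simp add: fan_def c_def)
    have "sum c S = (\<Sum>\<sigma>\<in>S. c (g ` \<sigma>))"
      using sum.reindex_bij_betw[OF bij_G_S[OF g(1)], of c] by simp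
    also have "\<dots> = 1" unfolding cg using rA[OF z] A by simp
    finally have cA: "c \<in> A" using cfan A by blast
    have "radial n p c = g (radial n p (r z))" unfolding k
      using g(1) cg unfolding k by (intro equiv) auto
    then have "radial n p c = w" using lr[OF z] g(2) by simp
    then have "r w = c" using rl[OF cA] by simp
    then show "?f z = ?f w" using proj_invariant[OF g(1), of c "r z"] cg by simp
  qed
  ultimately show ?thesis unfolding homeomorphic_orbit_space_def by blast
qed

section \<open>The vertices of the quotient\<close>

definition vertex_class :: "nat \<Rightarrow> nat \<Rightarrow> bool \<Rightarrow> (nat \<Rightarrow> complex) set set" where
  "vertex_class p j b = {{wz p j z} | z. even z = b}"

lemma vertex_class_U:
  assumes "p \<ge> 1"
  shows "{{u} | u. u \<in> Uset p j} = vertex_class p j True"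
  unfolding Uset_eq[OF assms] vertex_class_def by blast

lemma vertex_class_V:
  assumes "p \<ge> 1"
  shows "{{v} | v. v \<in> Vset p j} = vertex_class p j False"
  unfolding Vset_eq[OF assms] vertex_class_def by blast

lemma inj_vertex_class:
  assumes "p \<ge> 1" "vertex_class p i b = vertex_class p j c"
  shows "i = j" "b = c"
proof -
  define z :: int where "z = (if b then 0 else 1)"
  have "{wz p i z} \<in> vertex_class p i b" unfolding vertex_class_def z_def by auto
  then have "{wz p i z} \<in> vertex_class p j c" using assms(2) by simp
  then obtain y where y: "wz p i z = wz p j y" "even y = c" unfolding vertex_class_def by auto
  then show ij: "i = j" using wz_eq_iff[OF assms(1)] by blast
  have "even z = even y" using wz_parity[OF assms(1)] y(1) ij by blast
  then show "b = c" using y(2) by (auto simp: z_def split: if_splits)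
qed

text \<open>Coprimality in its second use: q_j is invertible modulo p, so the shifts by 2 k q_j
  reach every even residue modulo 2p and the group is transitive on each class.\<close>

lemma orbit_of_vertex:
  assumes p: "p \<ge> 1" and cop: "coprime (coef q j) (int p)"
  shows "orbit_of (cyclic_gen (rho_v p q)) {wz p j z} = vertex_class p j (even z)"
proof (intro equalityI subsetI)
  fix X assume "X \<in> orbit_of (cyclic_gen (rho_v p q)) {wz p j z}"
  then obtain k where "X = rot p q k ` {wz p j z}" unfolding orbit_of_def cyclic_gen_rho_v by blast
  then have "X = {wz p j (z + 2 * k * coef q j)}" by (simp add: rot_wz[OF p])
  moreover have "even (z + 2 * k * coef q j) = even z" by simp
  ultimately show "X \<in> vertex_class p j (even z)" unfolding vertex_class_def by blast
next
  fix X assume "X \<in> vertex_class p j (even z)"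
  then obtain y where y: "X = {wz p j y}" "even y = even z" unfolding vertex_class_def by blast
  then have "even (y - z)" by simp
  then obtain m where m: "y - z = 2 * m" by blast
  \<comment> \<open>Bezout turns half the distance of the two indices into the exponent
    \<open>m * a\<close> of the rotation required.\<close>
  obtain a b where "a * coef q j + b * int p = 1" using cop by (metis bezout_int coprime_iff_gcd_eq_1)
  then have "m = m * (a * coef q j + b * int p)" by simp
  then have "z + 2 * (m * a) * coef q j - y = 2 * int p * (- (m * b))"
    using m by (simp add: algebra_simps)
  then have "wz p j (z + 2 * (m * a) * coef q j) = wz p j y" unfolding wz_eq_iff[OF p] by simp
  then have "X = rot p q (m * a) ` {wz p j z}" by (simp add: rot_wz[OF p] y(1))
  then show "X \<in> orbit_of (cyclic_gen (rho_v p q)) {wz p j z}"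
    unfolding orbit_of_def cyclic_gen_rho_v by blast
qed

theorem theorem3p3:
  fixes n p :: nat and q :: "nat \<Rightarrow> int"
  assumes "n \<ge> 1" and "p \<ge> 2"
    and "\<forall>j\<in>{1..n}. coprime (q j) (int p)"
  defines "G \<equiv> cyclic_gen (rho_v p q)"
  defines "Q \<equiv> quot_carrier (Sigma_cx n p) G"
  shows "simplicial_cell_complex Q (quot_le G)
       \<and> sc_dim Q (quot_le G) (2 * n + 1)
       \<and> sc_vertices Q (quot_le G) =
            {{{u} | u. u \<in> Uset p j} | j. j \<le> n} \<union> {{{v} | v. v \<in> Vset p j} | j. j \<le> n}
       \<and> card (sc_vertices Q (quot_le G)) = 2 * (n + 1)
       \<and> homeomorphic_orbit_space (top_of_set (realization (derived Q (quot_le G))))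
            (odd_sphere n) (cyclic_gen (lens_h p q))
       \<and> comb_manifold (2 * n + 1) (derived Q (quot_le G))"
proof -
  have p1: "p \<ge> 1" using assms(2) by simp
  interpret A: balanced_action "Sigma_cx n p" G "colour_of p"
    unfolding G_def by (rule balanced_action_Sigma[OF assms(2,3)])
  have Q: "Q = orbit_of G ` Sigma_cx n p" unfolding Q_def quot_carrier_def ..
  have lower: "card {y\<in>Q. quot_le G y (orbit_of G \<beta>)} = 2 ^ card \<beta>" if "\<beta> \<in> Sigma_cx n p" for \<beta>
    unfolding Q_def by (rule A.card_lower[OF that])
  have dim: "sc_dim Q (quot_le G) (2 * n + 1)"
    unfolding sc_dim_def
  proof
    show "\<forall>x\<in>Q. card {y\<in>Q. quot_le G y x} \<le> 2 ^ (2 * n + 1 + 1)"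
    proof
      fix x assume "x \<in> Q"
      then obtain \<beta> where \<beta>: "\<beta> \<in> Sigma_cx n p" "x = orbit_of G \<beta>" unfolding Q by blast
      have "(2::nat) ^ card \<beta> \<le> 2 ^ (2 * n + 2)"
        by (rule power_increasing[OF card_Sigma_cx_le[OF assms(2) \<beta>(1)]]) simp
      then show "card {y\<in>Q. quot_le G y x} \<le> 2 ^ (2 * n + 1 + 1)" using lower[OF \<beta>(1)] \<beta>(2) by simp
    qed
    obtain \<beta> where \<beta>: "\<beta> \<in> Sigma_cx n p" "card \<beta> = 2 * n + 2" using Sigma_cx_facet[OF assms(2)] by blast
    have "card {y\<in>Q. quot_le G y (orbit_of G \<beta>)} = 2 ^ (2 * n + 1 + 1)" using lower[OF \<beta>(1)] \<beta>(2) by simp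
    then show "\<exists>x\<in>Q. card {y\<in>Q. quot_le G y x} = 2 ^ (2 * n + 1 + 1)" using \<beta>(1) unfolding Q by blast
  qed
  let ?H = "\<lambda>(j, b). vertex_class p j b"
  have orbv: "orbit_of G {wz p j z} = vertex_class p j (even z)" if "j \<le> n" for j z
    unfolding G_def by (rule orbit_of_vertex[OF p1 coef_coprime[OF assms(3) that]])
  have singleton: "{wz p j z} \<in> Sigma_cx n p" if "j \<le> n" for j z
  proof -
    have "wz p j z \<in> \<Union>(Sigma_cx n p)" using that unfolding Union_Sigma_cx Wset_eq[OF p1] by blast
    then show ?thesis using A.cplxD(4) by blast
  qed
  have verts: "sc_vertices Q (quot_le G) = ?H ` ({..n} \<times> UNIV)"
  proof (intro equalityI subsetI)
    fix x assume x: "x \<in> sc_vertices Q (quot_le G)"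
    then obtain \<beta> where \<beta>: "\<beta> \<in> Sigma_cx n p" "x = orbit_of G \<beta>" unfolding sc_vertices_def Q by blast
    \<comment> \<open>The interval below an orbit is Boolean of rank \<open>card \<beta>\<close>, so
      an interval with two elements comes from a single vertex.\<close>
    have "(2::nat) ^ card \<beta> = 2 ^ 1" using x lower[OF \<beta>(1)] \<beta>(2) unfolding sc_vertices_def by simp
    then have "card \<beta> = 1" by (simp only: power_inject_exp one_less_numeral_iff semiring_norm)
    then obtain v where v: "\<beta> = {v}" by (rule card_1_singletonE)
    then have "v \<in> \<Union>(Sigma_cx n p)" using \<beta>(1) by blast
    then obtain j z where "j \<le> n" "v = wz p j z" by (rule Sigma_vertexE[OF p1])
    then have "x = ?H (j, even z)" "(j, even z) \<in> {..n} \<times> UNIV" using \<beta>(2) v orbv by simp_all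
    then show "x \<in> ?H ` ({..n} \<times> UNIV)" by (rule image_eqI)
  next
    fix x assume "x \<in> ?H ` ({..n} \<times> UNIV)"
    then obtain j b where jb: "j \<le> n" "x = vertex_class p j b" by auto
    define z :: int where "z = (if b then 0 else 1)"
    have "x = orbit_of G {wz p j z}" using orbv[OF jb(1), of z] jb(2) by (simp add: z_def split: if_splits)
    then show "x \<in> sc_vertices Q (quot_le G)"
      using lower[OF singleton[OF jb(1)]] singleton[OF jb(1)] unfolding sc_vertices_def Q by simp
  qed
  have "card (?H ` ({..n} \<times> UNIV)) = card ({..n} \<times> (UNIV :: bool set))"
  proof (intro card_image inj_onI)
    fix x y assume eq: "?H x = ?H y"
    obtain i b where x: "x = (i, b)" by (cases x)
    obtain j c where y: "y = (j, c)" by (cases y)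
    show "x = y" using inj_vertex_class[OF p1, of i b j c] eq unfolding x y by simp
  qed
  then have card: "card (sc_vertices Q (quot_le G)) = 2 * (n + 1)"
    unfolding verts by (simp add: card_cartesian_product)
  have verts': "sc_vertices Q (quot_le G) =
      {{{u} | u. u \<in> Uset p j} | j. j \<le> n} \<union> {{{v} | v. v \<in> Vset p j} | j. j \<le> n}"
    unfolding verts vertex_class_U[OF p1] vertex_class_V[OF p1]
  proof (intro equalityI subsetI)
    fix x assume "x \<in> ?H ` ({..n} \<times> UNIV)"
    then obtain j b where "j \<le> n" "x = vertex_class p j b" by auto
    then show "x \<in> {vertex_class p j True | j. j \<le> n} \<union> {vertex_class p j False | j. j \<le> n}"
      by (cases b) auto
  next
    fix x assume "x \<in> {vertex_class p j True | j. j \<le> n} \<union> {vertex_class p j False | j. j \<le> n}"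
    then obtain j b where "j \<le> n" "x = vertex_class p j b" by auto
    then show "x \<in> ?H ` ({..n} \<times> UNIV)" by (intro image_eqI[of _ _ "(j, b)"]) auto
  qed
  have manifold: "comb_manifold (2 * n + 1) (derived Q (quot_le G))"
    unfolding Q_def
  proof (rule A.comb_manifold_quotient)
    fix \<alpha> assume "\<alpha> \<in> Sigma_cx n p - {{}}"
    then show "\<exists>e. card \<alpha> + e = 2 * n + 1 + 1 \<and> linear_sphere e (link (Sigma_cx n p) \<alpha>)"
      using link_Sigma_cx[OF assms(2), of \<alpha> n] by simp
  qed simp
  show ?thesis
    using A.simplicial_cell_complex_quotient dim verts' card manifold
      homeomorphic_orbit_space_lens[OF assms(2,3)]
    unfolding Q_def G_def lens_h_eq_rho_v by blast
qed

end
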